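(* Let $\mathbf t=(t_k)_{k\ge1}\in\ell^1(\mathbb N)$ be a summable sequence of strictly positive real numbers. Let $\mathcal R(\mathcal H_{1/2},\sigma_{\mathbf t})\subset\mathcal L(F^2_{\mathbf t}(\mathcal H))$ be the $C^\ast$ algebra generated by the resolvents $R(\lambda,z)$, $\lambda\in\mathbb C\setminus i\mathbb R$, $z\in\mathcal H_{1/2}$, and let $$\mathcal R_{cl}^{\mathbf t}=C^\ast\big(\{(\lambda-2i\sigma_{\mathbf t}(\cdot,z))^{-1}:\lambda\in\mathbb C\setminus i\mathbb R,\ z\in\mathcal H_{1/2}\}\big)\subset L^\infty(\mathcal H,\mu_{\mathbf t}).$$ Then $$\mathcal R(\mathcal H_{1/2},\sigma_{\mathbf t})\subset\mathcal T^{\mathbf t}(\mathcal R_{cl}^{\mathbf t}).$$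
   Context: Let $\mathcal H=\ell^2(\mathbb N)$ (complex), and $$\mathcal H_{1/2}=\Big\{z\in\ell^2(\mathbb N):\sum_n\frac{|z_n|^2}{t_n}<\infty\Big\},\qquad \mathcal H_1=\Big\{z\in\ell^2(\mathbb N):\sum_n\frac{|z_n|^2}{t_n^2}<\infty\Big\}.$$ Put $\langle z,w\rangle_{1/2}=\sum_n z_n\overline{w_n}/t_n$, $\|z\|_{1/2}^2=\langle z,z\rangle_{1/2}$ and $\sigma_{\mathbf t}(z,w)=\operatorname{Im}\langle z,w\rangle_{1/2}$ (defined for $z,w\in\mathcal H_{1/2}$, and also when one argument is in $\mathcal H_1$ and the other in $\mathcal H$). $\mu_{\mathbf t}$ is the Gaussian probability measure on the Borel sets of $\mathcal H$ obtained by restricting the infinite product $\prod_k\mu_{t_k}$ on $\mathbb C^\infty$, with $d\mu_{t_k}(z)=\frac1{\pi t_k}e^{-|z|^2/t_k}dV(z)$ on $\mathbb C$, to $\mathcal H$ (on which the product measure is concentrated). $F_{\mathbf t}^2(\mathcal H)$ is the closure in $L^2(\mathcal H,\mu_{\mathbf t})$ of the analytic polynomials, i.e. of the linear span of the monomials $z^\alpha=z_1^{\alpha_1}z_2^{\alpha_2}\cdots$, with $\alpha$ a finitely supported sequence in $\mathbb N_0$. $P^{\mathbf t}$ is the orthogonal projection of $L^2(\mathcal H,\mu_{\mathbf t})$ onto $F^2_{\mathbf t}(\mathcal H)$, and for $\varphi\in L^\infty(\mathcal H,\mu_{\mathbf t})$ the Toeplitz operator is $T_\varphi^{\mathbf t}g=P^{\mathbf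 t}(\varphi g)$, $g\in F^2_{\mathbf t}(\mathcal H)$. For $S\subset L^\infty(\mathcal H,\mu_{\mathbf t})$, $\mathcal T^{\mathbf t}(S)$ is the $C^\ast$ algebra generated by $\{T_f^{\mathbf t}:f\in S\}$. Weyl operators: for $z\in\mathcal H_1$ and an analytic polynomial $p$, $W_z^{\mathbf t}p(w)=e^{\langle w,z\rangle_{1/2}-\frac12\|z\|_{1/2}^2}p(w-z)$; this extends to a unitary operator on $F_{\mathbf t}^2(\mathcal H)$, and $z\mapsto W_z^{\mathbf t}$ is strongly continuous with respect to $\|\cdot\|_{1/2}$ and hence extends to a strongly continuous map from $\mathcal H_{1/2}$ to the unitary operators on $F_{\mathbf t}^2(\mathcal H)$, satisfying $W_z^{\mathbf t}W_w^{\mathbf t}=e^{-i\sigma_{\mathbf t}(z,w)}W_{z+w}^{\mathbf t}$ (known facts). Resolvents: for $z\in\mathcal H_{1/2}$, $R(\lambda,z)=(\phi(z)-i\lambda)^{-1}$, where $i\phi(z)$ is the generator of the unitary group $(W^{\mathbf t}_{sz})_{s\in\mathbb R}$; equivalently $R(\lambda,z)=i\int_0^\infty e^{-\lambda s}W_{-sz}^{\mathbf t}\,ds$ if $\operatorname{Re}\lambda>0$ and $R(\lambda,z)=-i\int_0^\infty e^{\lambda s}W_{sz}^{\mathbf t}\,ds$ if $\operatorname{Re}\lambda<0$ (strong operator topology). Meaning of $\sigma_{\mathbf t}(\cdot,z)$ as a function on $\mathcal H$ for $z\in\mathcal H_{1/2}$: for $z\in\mathcal H_1$ the function $w\mapsto\langle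 w,z\rangle_{1/2}$ is defined on all of $\mathcal H$ and lies in $L^2(\mathcal H,\mu_{\mathbf t})$; the map $z\mapsto\langle\cdot,z\rangle_{1/2}\in L^2(\mathcal H,\mu_{\mathbf t})$ is continuous with respect to $\|\cdot\|_{1/2}$ and is extended by continuity to $\mathcal H_{1/2}$. Then $\sigma_{\mathbf t}(\cdot,z)=\operatorname{Im}\langle\cdot,z\rangle_{1/2}$ is an almost everywhere defined real measurable function. *)

theory Defs
  imports "HOL-Probability.Probability"
begin

section \<open>Sequence spaces\<close>

text \<open>
  The index set is the type \<open>nat\<close>, so the first coordinate is \<open>z 0\<close>. The sequence \<open>t\<close> is a free
  parameter throughout; it is summable and strictly positive in all intended uses.
\<close>

definition ell2 :: "(nat \<Rightarrow> complex) set" where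
  "ell2 = {z. summable (\<lambda>n. (cmod (z n))\<^sup>2)}"

definition ell2_norm :: "(nat \<Rightarrow> complex) \<Rightarrow> real" where
  "ell2_norm z = sqrt (\<Sum>n. (cmod (z n))\<^sup>2)"

definition ell2_open :: "(nat \<Rightarrow> complex) set \<Rightarrow> bool" where
  "ell2_open U \<longleftrightarrow> U \<subseteq> ell2 \<and>
     (\<forall>x\<in>U. \<exists>e>0. \<forall>y\<in>ell2. ell2_norm (\<lambda>n. y n - x n) < e \<longrightarrow> y \<in> U)"

definition H_half :: "(nat \<Rightarrow> real) \<Rightarrow> (nat \<Rightarrow> complex) set" where
  "H_half t = {z \<in> ell2. summable (\<lambda>n. (cmod (z n))\<^sup>2 / t n)}"

definition H_one :: "(nat \<Rightarrow> real) \<Rightarrow> (nat \<Rightarrow> complex) set" where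
  "H_one t = {z \<in> ell2. summable (\<lambda>n. (cmod (z n))\<^sup>2 / (t n)\<^sup>2)}"

definition ip_half :: "(nat \<Rightarrow> real) \<Rightarrow> (nat \<Rightarrow> complex) \<Rightarrow> (nat \<Rightarrow> complex) \<Rightarrow> complex" where
  "ip_half t z w = (\<Sum>n. z n * cnj (w n) / complex_of_real (t n))"

definition norm_half :: "(nat \<Rightarrow> real) \<Rightarrow> (nat \<Rightarrow> complex) \<Rightarrow> real" where
  "norm_half t z = sqrt (Re (ip_half t z z))"


section \<open>The Gaussian measure\<close>

definition gaussian_complex :: "real \<Rightarrow> complex measure" where
  "gaussian_complex s =
     density lborel (\<lambda>z. ennreal (exp (- (cmod z)\<^sup>2 / s) / (pi * s)))"

definition gaussian :: "(nat \<Rightarrow> real) \<Rightarrow> (nat \<Rightarrow> complex) measure" where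
  "gaussian t = restrict_space (PiM UNIV (\<lambda>k. gaussian_complex (t k))) ell2"

lemma space_gaussian: "space (gaussian t) = ell2"
  by (simp add: gaussian_def space_restrict_space space_PiM gaussian_complex_def)

text \<open>
  The sigma algebra carried by the restricted product measure is the Borel sigma algebra of the
  Hilbert space (for the norm topology).
\<close>

lemma ell2_norm_less_iff:
  assumes "e > 0" "summable (\<lambda>n. (cmod (z n))\<^sup>2)"
  shows "ell2_norm z < e \<longleftrightarrow> (\<Sum>n. (cmod (z n))\<^sup>2) < e\<^sup>2"
proof -
  have "(\<Sum>n. (cmod (z n))\<^sup>2) \<ge> 0" using assms by (intro suminf_nonneg) auto
  then show ?thesis unfolding ell2_norm_def
    using real_sqrt_less_iff[of "\<Sum>n. (cmod (z n))\<^sup>2" "e\<^sup>2"] assms(1) by simp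
qed

lemma cmod_add_sq_le: "(cmod (a + b))\<^sup>2 \<le> 2 * (cmod a)\<^sup>2 + 2 * (cmod b)\<^sup>2"
proof -
  have "(cmod (a + b))\<^sup>2 \<le> (cmod a + cmod b)\<^sup>2"
    by (intro power_mono norm_triangle_ineq) auto
  also have "\<dots> \<le> 2 * (cmod a)\<^sup>2 + 2 * (cmod b)\<^sup>2"
    using sum_squares_bound[of "cmod a" "cmod b"] by (simp add: power2_sum)
  finally show ?thesis .
qed

lemma ell2_add_bound:
  assumes "a \<in> ell2" "b \<in> ell2"
  shows "(\<lambda>n. a n + b n) \<in> ell2"
    and "(\<Sum>n. (cmod (a n + b n))\<^sup>2) \<le> 2 * (\<Sum>n. (cmod (a n))\<^sup>2) + 2 * (\<Sum>n. (cmod (b n))\<^sup>2)"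
proof -
  have sm: "summable (\<lambda>n. 2 * (cmod (a n))\<^sup>2 + 2 * (cmod (b n))\<^sup>2)"
    using assms by (auto simp: ell2_def intro!: summable_add summable_mult)
  show s: "(\<lambda>n. a n + b n) \<in> ell2"
    unfolding ell2_def using cmod_add_sq_le
    by (auto intro!: summable_comparison_test'[OF sm, where N=0])
  have "(\<Sum>n. (cmod (a n + b n))\<^sup>2) \<le> (\<Sum>n. 2 * (cmod (a n))\<^sup>2 + 2 * (cmod (b n))\<^sup>2)"
    using s sm cmod_add_sq_le by (intro suminf_le) (auto simp: ell2_def)
  also have "\<dots> = 2 * (\<Sum>n. (cmod (a n))\<^sup>2) + 2 * (\<Sum>n. (cmod (b n))\<^sup>2)"
    using assms by (subst suminf_add[symmetric])
      (auto simp: ell2_def suminf_mult intro!: summable_mult)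
  finally show "(\<Sum>n. (cmod (a n + b n))\<^sup>2) \<le> 2 * (\<Sum>n. (cmod (a n))\<^sup>2) + 2 * (\<Sum>n. (cmod (b n))\<^sup>2)" .
qed

lemma ell2_uminus: "a \<in> ell2 \<Longrightarrow> (\<lambda>n. - a n) \<in> ell2"
  by (simp add: ell2_def)

lemma ell2_diff: "a \<in> ell2 \<Longrightarrow> b \<in> ell2 \<Longrightarrow> (\<lambda>n. a n - b n) \<in> ell2"
  using ell2_add_bound(1)[OF _ ell2_uminus, of a b] by simp

lemma ell2_separable:
  obtains Q where "countable Q" "Q \<subseteq> ell2"
    "\<And>x e. x \<in> ell2 \<Longrightarrow> e > 0 \<Longrightarrow> \<exists>q\<in>Q. (\<Sum>n. (cmod (x n - q n))\<^sup>2) < e"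
proof -
  obtain D :: "complex set" where D: "countable D"
    "\<And>X. open X \<Longrightarrow> X \<noteq> {} \<Longrightarrow> \<exists>d\<in>D. d \<in> X"
    by (rule countable_dense_setE) blast
  define fs where "fs l = (\<lambda>i. if i < length l then l ! i else (0::complex))" for l
  have fs_ell2: "fs l \<in> ell2" for l
    unfolding ell2_def fs_def by (auto split: if_splits intro!: summable_finite[of "{..<length l}"] split: if_splits)
  show ?thesis
  proof (rule that)
    show "countable (fs ` lists D)" using D by auto
    show "fs ` lists D \<subseteq> ell2" using fs_ell2 by auto
  next
    fix x :: "nat \<Rightarrow> complex" and e :: real
    assume x: "x \<in> ell2" and e: "e > 0"
    have sx: "summable (\<lambda>n. (cmod (x n))\<^sup>2)" using x by (simp add: ell2_def)
    obtain N where N: "(\<Sum>n. (cmod (x (n + N)))\<^sup>2) < e / 2"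
    proof -
      have "\<exists>N. \<forall>n\<ge>N. norm (\<Sum>i. (cmod (x (i + n)))\<^sup>2) < e / 2"
        using suminf_exist_split[OF _ sx, of "e/2"] e by simp
      then obtain N where "norm (\<Sum>i. (cmod (x (i + N)))\<^sup>2) < e / 2" by blast
      then have "(\<Sum>n. (cmod (x (n + N)))\<^sup>2) < e / 2" by (simp add: abs_less_iff)
      then show thesis by (rule that)
    qed
    define r where "r = sqrt (e / (2 * (real N + 1)))"
    have r: "r > 0" "r\<^sup>2 = e / (2 * (real N + 1))" using e by (auto simp: r_def)
    have "\<exists>d\<in>D. d \<in> ball (x i) r" for i using D(2)[of "ball (x i) r"] r by auto
    then have "\<forall>i. \<exists>d. d \<in> D \<and> d \<in> ball (x i) r" by blast
    from choice[OF this] obtain d where d: "\<And>i. d i \<in> D" "\<And>i. d i \<in> ball (x i) r" by blast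
    define q where "q = fs (map d [0..<N])"
    have q_in: "q \<in> fs ` lists D" unfolding q_def by (intro imageI) (use d in auto)
    have q1: "q i = d i" if "i < N" for i using that by (simp add: q_def fs_def)
    have q2: "q (i + N) = 0" for i by (simp add: q_def fs_def)
    have "(\<lambda>n. x n - q n) \<in> ell2" using x fs_ell2 by (auto simp: q_def intro: ell2_diff)
    then have "(\<Sum>n. (cmod (x n - q n))\<^sup>2) =
        (\<Sum>n. (cmod (x (n + N) - q (n + N)))\<^sup>2) + (\<Sum>n<N. (cmod (x n - q n))\<^sup>2)"
      unfolding ell2_def by (intro suminf_split_initial_segment) auto
    also have "(\<Sum>n<N. (cmod (x n - q n))\<^sup>2) \<le> (\<Sum>n<N. r\<^sup>2)"
      using d(2) by (intro sum_mono power_mono) (auto simp: q1 dist_norm intro: less_imp_le)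
    also have "(\<Sum>n<N. r\<^sup>2) \<le> e / 2"
      using e by (simp add: r(2) field_simps)
    also have "(\<Sum>n. (cmod (x (n + N) - q (n + N)))\<^sup>2) < e / 2" using N by (simp add: q2)
    finally show "\<exists>q\<in>fs ` lists D. (\<Sum>n. (cmod (x n - q n))\<^sup>2) < e" using q_in by auto
  qed
qed

lemma sets_gaussian: "sets (gaussian t) = sigma_sets ell2 {U. ell2_open U}"
proof -
  let ?P = "PiM UNIV (\<lambda>_. borel) :: (nat \<Rightarrow> complex) measure"
  let ?B = "sigma ell2 {U. ell2_open U}"
  have sub: "{U. ell2_open U} \<subseteq> Pow ell2" by (auto simp: ell2_open_def)
  have setsB: "sets ?B = sigma_sets ell2 {U. ell2_open U}" "space ?B = ell2"
    using sub by auto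
  have setsG: "sets (gaussian t) = sets (restrict_space ?P ell2)"
    unfolding gaussian_def
    by (intro sets_restrict_space_cong sets_PiM_cong) (auto simp: gaussian_complex_def)
  have "sets (restrict_space ?P ell2) \<subseteq> sets ?B"
  proof -
    have coord: "(\<lambda>z. z i) \<in> borel_measurable ?B" for i
    proof (rule borel_measurableI)
      fix S :: "complex set" assume S: "open S"
      have "ell2_open ((\<lambda>z. z i) -` S \<inter> ell2)" unfolding ell2_open_def
      proof (intro conjI ballI)
        fix x assume x: "x \<in> (\<lambda>z. z i) -` S \<inter> ell2"
        then obtain e where e: "e > 0" "ball (x i) e \<subseteq> S"
          using S by (auto simp: open_contains_ball)
        have "y i \<in> S" if y: "y \<in> ell2" "ell2_norm (\<lambda>n. y n - x n) < e" for y
        proof -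
          have s: "summable (\<lambda>n. (cmod (y n - x n))\<^sup>2)"
            using ell2_diff[of y x] x y by (auto simp: ell2_def)
          have "(cmod (y i - x i))\<^sup>2 \<le> (\<Sum>n. (cmod (y n - x n))\<^sup>2)"
            using sum_le_suminf[OF s, of "{i}"] by auto
          also have "\<dots> < e\<^sup>2" using y(2) ell2_norm_less_iff[OF e(1) s] by simp
          finally have "cmod (y i - x i) < e" using e(1) power_less_imp_less_base[of _ 2 e] by simp
          then have "y i \<in> ball (x i) e" by (simp add: dist_norm norm_minus_commute)
          then show ?thesis using e(2) by blast
        qed
        then show "\<exists>e>0. \<forall>y\<in>ell2. ell2_norm (\<lambda>n. y n - x n) < e \<longrightarrow>
            y \<in> (\<lambda>z. z i) -` S \<inter> ell2" using e by auto
      qed auto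
      then show "(\<lambda>z. z i) -` S \<inter> space ?B \<in> sets ?B" using setsB by auto
    qed
    have "(\<lambda>z. z) \<in> measurable ?B ?P"
      by (rule measurable_PiM_single') (use coord in auto)
    then have "(\<lambda>z. z) \<in> measurable ?B (restrict_space ?P ell2)"
      by (intro measurable_restrict_space2) (auto simp: setsB)
    then have m: "(\<lambda>z. z) -` A \<inter> space ?B \<in> sets ?B" if "A \<in> sets (restrict_space ?P ell2)" for A
      using that by (rule measurable_sets)
    show ?thesis
    proof
      fix A assume A: "A \<in> sets (restrict_space ?P ell2)"
      then have "A \<subseteq> ell2" using sets.sets_into_space[OF A] by (auto simp: space_restrict_space)
      then have "(\<lambda>z. z) -` A \<inter> space ?B = A" using setsB by auto
      then show "A \<in> sets ?B" using m[OF A] by simp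
    qed
  qed
  moreover have "sets ?B \<subseteq> sets (restrict_space ?P ell2)"
  proof -
    obtain Q where Q: "countable Q" "Q \<subseteq> ell2"
      "\<And>x e. x \<in> ell2 \<Longrightarrow> e > 0 \<Longrightarrow> \<exists>q\<in>Q. (\<Sum>n. (cmod (x n - q n))\<^sup>2) < e"
      by (rule ell2_separable) blast
    define N where "N = (\<lambda>x y :: nat \<Rightarrow> complex. \<Sum>n. (cmod (x n - y n))\<^sup>2)"
    define B where "B = (\<lambda>(q :: nat \<Rightarrow> complex, k :: nat). ell2 \<inter> {y. N y q < 1 / (real k + 1)})"
    have N_sym: "N x y = N y x" for x y unfolding N_def by (simp add: norm_minus_commute)
    have N_tri: "N x z \<le> 2 * N x y + 2 * N y z" if "x \<in> ell2" "y \<in> ell2" "z \<in> ell2" for x y z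
      using ell2_add_bound(2)[OF ell2_diff[OF that(1,2)] ell2_diff[OF that(2,3)]]
      by (simp add: N_def)
    have B_meas: "B p \<in> sets (restrict_space ?P ell2)" for p
    proof -
      obtain q k where p: "p = (q, k)" by (cases p)
      have "(\<lambda>y. N y q) \<in> borel_measurable ?P"
        unfolding N_def by measurable
      then have "{y \<in> space ?P. N y q < 1 / (real k + 1)} \<in> sets ?P" by measurable
      then show ?thesis unfolding p B_def
        by (auto simp: sets_restrict_space space_PiM)
    qed
    have "U \<in> sets (restrict_space ?P ell2)" if U: "ell2_open U" for U
    proof -
      define I where "I = {p \<in> Q \<times> UNIV. B p \<subseteq> U}"
      have "countable I" unfolding I_def using Q(1) by (intro countable_Collect) auto
      then have "(\<Union>p\<in>I. B p) \<in> sets (restrict_space ?P ell2)"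
        using B_meas by (intro sets.countable_UN') auto
      moreover have "(\<Union>p\<in>I. B p) = U"
      proof (intro equalityI subsetI)
        fix x assume x: "x \<in> U"
        then have xl: "x \<in> ell2" using U by (auto simp: ell2_open_def)
        obtain e where e: "e > 0"
          "\<And>y. y \<in> ell2 \<Longrightarrow> ell2_norm (\<lambda>n. y n - x n) < e \<Longrightarrow> y \<in> U"
          using U x unfolding ell2_open_def by blast
        have "e\<^sup>2 / 4 > 0" using e(1) by simp
        then obtain k where "1 / real (Suc k) < e\<^sup>2 / 4" by (rule nat_approx_posE)
        then have k: "1 / (real k + 1) < e\<^sup>2 / 4" by (simp add: add.commute)
        obtain q where q: "q \<in> Q" "N x q < 1 / (real k + 1)"
          using Q(3)[OF xl, of "1 / (real k + 1)"] by (auto simp: N_def)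
        have ql: "q \<in> ell2" using q Q by auto
        have "B (q, k) \<subseteq> U"
        proof
          fix y assume "y \<in> B (q, k)"
          then have y: "y \<in> ell2" "N y q < 1 / (real k + 1)" by (auto simp: B_def)
          have "N y x < e\<^sup>2" using N_tri[OF y(1) ql xl] y(2) q(2) N_sym[of q x] k by linarith
          then show "y \<in> U" using e y(1) ell2_diff[OF y(1) xl]
            by (simp add: N_def ell2_norm_less_iff ell2_def)
        qed
        then show "x \<in> (\<Union>p\<in>I. B p)" using q xl by (auto simp: I_def B_def)
      qed (auto simp: I_def)
      ultimately show ?thesis by simp
    qed
    then have "{U. ell2_open U} \<subseteq> sets (restrict_space ?P ell2)" by auto
    moreover have "space (restrict_space ?P ell2) = ell2"
      by (simp add: space_restrict_space space_PiM)
    ultimately show ?thesis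
      using sets.sigma_sets_subset[of "{U. ell2_open U}" "restrict_space ?P ell2"] setsB by simp
  qed
  ultimately show ?thesis using setsG setsB by simp
qed


section \<open>The Fock space and its ambient space of square integrable functions\<close>

text \<open>
  Elements of \<open>L\<^sup>2\<close> and \<open>L\<^sup>\<infinity>\<close> are handled through representatives: square integrable,
  respectively essentially bounded, measurable functions, with the usual seminorms. All sets of
  functions and of operators that matter below are saturated with respect to almost everywhere
  equality.
\<close>

type_synonym hfun = "(nat \<Rightarrow> complex) \<Rightarrow> complex"

definition L2 :: "(nat \<Rightarrow> real) \<Rightarrow> hfun set" where
  "L2 t = {f \<in> borel_measurable (gaussian t). integrable (gaussian t) (\<lambda>w. (cmod (f w))\<^sup>2)}"

definition L2_ip :: "(nat \<Rightarrow> real) \<Rightarrow> hfun \<Rightarrow> hfun \<Rightarrow> complex" where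
  "L2_ip t f g = (\<integral>w. f w * cnj (g w) \<partial>gaussian t)"

definition L2_norm :: "(nat \<Rightarrow> real) \<Rightarrow> hfun \<Rightarrow> real" where
  "L2_norm t f = sqrt (\<integral>w. (cmod (f w))\<^sup>2 \<partial>gaussian t)"

definition monomial :: "(nat \<Rightarrow> nat) \<Rightarrow> hfun" where
  "monomial \<alpha> w = (\<Prod>i | \<alpha> i \<noteq> 0. w i ^ \<alpha> i)"

definition analytic_polys :: "hfun set" where
  "analytic_polys = {(\<lambda>w. \<Sum>\<alpha>\<in>A. c \<alpha> * monomial \<alpha> w) | A c.
     finite A \<and> (\<forall>\<alpha>\<in>A. finite {i. \<alpha> i \<noteq> 0})}"

definition Fock :: "(nat \<Rightarrow> real) \<Rightarrow> hfun set" where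
  "Fock t = {f \<in> L2 t. \<forall>e>0. \<exists>p\<in>analytic_polys. L2_norm t (\<lambda>w. f w - p w) < e}"

definition Fock_proj :: "(nat \<Rightarrow> real) \<Rightarrow> hfun \<Rightarrow> hfun" where
  "Fock_proj t f = (SOME h. h \<in> Fock t \<and> (\<forall>g\<in>Fock t. L2_ip t (\<lambda>w. f w - h w) g = 0))"

definition toeplitz :: "(nat \<Rightarrow> real) \<Rightarrow> hfun \<Rightarrow> hfun \<Rightarrow> hfun" where
  "toeplitz t \<phi> g = Fock_proj t (\<lambda>w. \<phi> w * g w)"


section \<open>Generated C*-algebras\<close>

text \<open>
  The ambient C*-algebra is a record, so that the same notion of a generated C*-algebra serves for
  the bounded operators on the Fock space and for the essentially bounded functions. The generated
  algebra is not required to contain a unit.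
\<close>

record 'a cstar_ops =
  elems :: "'a set"
  plus_op :: "'a \<Rightarrow> 'a \<Rightarrow> 'a"
  scale_op :: "complex \<Rightarrow> 'a \<Rightarrow> 'a"
  times_op :: "'a \<Rightarrow> 'a \<Rightarrow> 'a"
  star_op :: "'a \<Rightarrow> 'a"
  norm_op :: "'a \<Rightarrow> real"

definition cstar_subalgebra :: "'a cstar_ops \<Rightarrow> 'a set \<Rightarrow> bool" where
  "cstar_subalgebra C B \<longleftrightarrow> B \<subseteq> elems C \<and> B \<noteq> {} \<and>
     (\<forall>a\<in>B. \<forall>b\<in>B. plus_op C a b \<in> B \<and> times_op C a b \<in> B) \<and>
     (\<forall>c. \<forall>a\<in>B. scale_op C c a \<in> B) \<and>
     (\<forall>a\<in>B. star_op C a \<in> B) \<and>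
     (\<forall>a\<in>elems C. (\<forall>e>0. \<exists>b\<in>B. norm_op C (plus_op C a (scale_op C (-1) b)) < e) \<longrightarrow> a \<in> B)"

definition cstar_generated :: "'a cstar_ops \<Rightarrow> 'a set \<Rightarrow> 'a set" where
  "cstar_generated C S = {a \<in> elems C. \<forall>B. cstar_subalgebra C B \<and> S \<subseteq> B \<longrightarrow> a \<in> B}"

definition Linf :: "(nat \<Rightarrow> real) \<Rightarrow> hfun cstar_ops" where
  "Linf t = \<lparr>
     elems = {f \<in> borel_measurable (gaussian t). \<exists>K. AE w in gaussian t. cmod (f w) \<le> K},
     plus_op = (\<lambda>f g w. f w + g w),
     scale_op = (\<lambda>c f w. c * f w),
     times_op = (\<lambda>f g w. f w * g w),
     star_op = (\<lambda>f w. cnj (f w)),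
     norm_op = (\<lambda>f. real_of_ereal (esssup (gaussian t) (\<lambda>w. ereal (cmod (f w))))) \<rparr>"

text \<open>
  A bounded operator is represented by a map on representatives, of which only the restriction to
  the Fock space matters; linearity holds almost everywhere, and together with boundedness it
  makes the map respect almost everywhere equality. The norm-closedness required in
  \<open>cstar_subalgebra\<close> identifies maps that agree almost everywhere on the Fock space. The adjoint
  is obtained from the Riesz representation theorem.
\<close>

definition bounded_operators :: "(nat \<Rightarrow> real) \<Rightarrow> (hfun \<Rightarrow> hfun) set" where
  "bounded_operators t = {A.
     (\<forall>f\<in>Fock t. A f \<in> Fock t) \<and>
     (\<forall>f\<in>Fock t. \<forall>g\<in>Fock t. AE w in gaussian t. A (\<lambda>x. f x + g x) w = A f w + A g w) \<and>
     (\<forall>c. \<forall>f\<in>Fock t. AE w in gaussian t. A (\<lambda>x. c * f x) w = c * A f w) \<and>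
     (\<exists>K. \<forall>f\<in>Fock t. L2_norm t (A f) \<le> K * L2_norm t f)}"

definition Fock_operators :: "(nat \<Rightarrow> real) \<Rightarrow> (hfun \<Rightarrow> hfun) cstar_ops" where
  "Fock_operators t = \<lparr>
     elems = bounded_operators t,
     plus_op = (\<lambda>A B f w. A f w + B f w),
     scale_op = (\<lambda>c A f w. c * A f w),
     times_op = (\<lambda>A B f. A (B f)),
     star_op = (\<lambda>A g. SOME h. h \<in> Fock t \<and> (\<forall>f\<in>Fock t. L2_ip t (A f) g = L2_ip t f h)),
     norm_op = (\<lambda>A. SUP f\<in>{f \<in> Fock t. L2_norm t f \<le> 1}. L2_norm t (A f)) \<rparr>"

definition toeplitz_algebra :: "(nat \<Rightarrow> real) \<Rightarrow> hfun set \<Rightarrow> (hfun \<Rightarrow> hfun) set" where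
  "toeplitz_algebra t S = cstar_generated (Fock_operators t) (toeplitz t ` S)"


section \<open>Extension by continuity\<close>

text \<open>
  The \<open>L\<^sup>2\<close>-limit of \<open>F y\<close> as \<open>y\<close> ranges over \<open>D\<close> and \<open>d y\<close>, the distance of \<open>y\<close> to the point
  at which the extension is evaluated, tends to \<open>0\<close>. It is unique up to almost everywhere equality.
\<close>

definition L2_extend :: "(nat \<Rightarrow> real) \<Rightarrow> 'a set \<Rightarrow> ('a \<Rightarrow> real) \<Rightarrow> ('a \<Rightarrow> hfun) \<Rightarrow> hfun" where
  "L2_extend t D d F = (SOME h. h \<in> L2 t \<and>
     (\<forall>e>0. \<exists>r>0. \<forall>y\<in>D. d y < r \<longrightarrow> L2_norm t (\<lambda>w. F y w - h w) < e))"

definition half_dist :: "(nat \<Rightarrow> real) \<Rightarrow> (nat \<Rightarrow> complex) \<Rightarrow> (nat \<Rightarrow> complex) \<Rightarrow> real" where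
  "half_dist t z y = norm_half t (\<lambda>n. y n - z n)"

definition ip_half_ext :: "(nat \<Rightarrow> real) \<Rightarrow> (nat \<Rightarrow> complex) \<Rightarrow> hfun" where
  "ip_half_ext t z = L2_extend t (H_one t) (half_dist t z) (\<lambda>y w. ip_half t w y)"

definition sigma_fun :: "(nat \<Rightarrow> real) \<Rightarrow> (nat \<Rightarrow> complex) \<Rightarrow> (nat \<Rightarrow> complex) \<Rightarrow> real" where
  "sigma_fun t z w = Im (ip_half_ext t z w)"


section \<open>Weyl operators and resolvents\<close>

text \<open>
  The Weyl operators are defined by the explicit formula on analytic polynomials for \<open>z\<close> in
  \<open>H_one t\<close>, then extended to the Fock space, and finally, in the strong sense, to \<open>z\<close> in
  \<open>H_half t\<close>.
\<close>

definition weyl_poly :: "(nat \<Rightarrow> real) \<Rightarrow> (nat \<Rightarrow> complex) \<Rightarrow> hfun \<Rightarrow> hfun" where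
  "weyl_poly t z p w =
     exp (ip_half t w z - complex_of_real ((norm_half t z)\<^sup>2 / 2)) * p (\<lambda>n. w n - z n)"

definition weyl_one :: "(nat \<Rightarrow> real) \<Rightarrow> (nat \<Rightarrow> complex) \<Rightarrow> hfun \<Rightarrow> hfun" where
  "weyl_one t z g =
     L2_extend t analytic_polys (\<lambda>p. L2_norm t (\<lambda>w. p w - g w)) (weyl_poly t z)"

definition weyl :: "(nat \<Rightarrow> real) \<Rightarrow> (nat \<Rightarrow> complex) \<Rightarrow> hfun \<Rightarrow> hfun" where
  "weyl t z g = L2_extend t (H_one t) (half_dist t z) (\<lambda>y. weyl_one t y g)"

text \<open>
  \<open>weyl_phi t z g h\<close> says that \<open>g\<close> is in the domain of the self-adjoint operator \<open>\<phi>(z)\<close> and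
  \<open>\<phi>(z) g = h\<close>, where \<open>\<i> \<phi>(z)\<close> is the generator of the group \<open>s \<mapsto> W (s z)\<close>.
\<close>

definition weyl_phi :: "(nat \<Rightarrow> real) \<Rightarrow> (nat \<Rightarrow> complex) \<Rightarrow> hfun \<Rightarrow> hfun \<Rightarrow> bool" where
  "weyl_phi t z g h \<longleftrightarrow> g \<in> Fock t \<and> h \<in> Fock t \<and>
     ((\<lambda>s::real. L2_norm t (\<lambda>w.
         (weyl t (\<lambda>n. complex_of_real s * z n) g w - g w) / complex_of_real s - \<i> * h w))
       \<longlongrightarrow> 0) (at 0)"

text \<open>The resolvent \<open>(\<phi>(z) - \<i> \<lambda>)\<inverse>\<close>, applied to \<open>h\<close>, is the \<open>g\<close> with \<open>\<phi>(z) g = h + \<i> \<lambda> g\<close>.\<close>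

definition resolvent :: "(nat \<Rightarrow> real) \<Rightarrow> complex \<Rightarrow> (nat \<Rightarrow> complex) \<Rightarrow> hfun \<Rightarrow> hfun" where
  "resolvent t l z h = (SOME g. weyl_phi t z g (\<lambda>w. h w + \<i> * l * g w))"

definition resolvent_algebra :: "(nat \<Rightarrow> real) \<Rightarrow> (hfun \<Rightarrow> hfun) set" where
  "resolvent_algebra t =
     cstar_generated (Fock_operators t) {resolvent t l z | l z. Re l \<noteq> 0 \<and> z \<in> H_half t}"

definition classical_resolvent_algebra :: "(nat \<Rightarrow> real) \<Rightarrow> hfun set" where
  "classical_resolvent_algebra t =
     cstar_generated (Linf t)
       {(\<lambda>w. inverse (l - 2 * \<i> * complex_of_real (sigma_fun t z w))) | l z.
          Re l \<noteq> 0 \<and> z \<in> H_half t}"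

end

theory Submission
  imports Defs
begin

text \<open>
  A Weyl operator is a Toeplitz operator with a bounded symbol up to a scalar:
  \<open>W\<^sub>z = exp (\<parallel>z\<parallel>\<^sup>2 / 2) T\<close> with symbol \<open>exp (2 \<i> \<sigma>(\<cdot>, z))\<close>, as one sees on the coherent states
  \<open>exp \<langle>\<cdot>, a\<rangle>\<close>, which span a dense subspace and are mapped to multiples of each other. The resolvent
  is a Laplace transform of \<open>s \<mapsto> W\<^bsub>sz\<^esub>\<close>; truncated at \<open>s = L\<close> it is a Toeplitz operator whose symbol
  \<open>F\<^sub>L(\<sigma>(\<cdot>, z))\<close> has
  \<open>F\<^sub>L(y) = \<integral>\<^sub>0\<^sup>L exp (- k s + s\<^sup>2 \<parallel>z\<parallel>\<^sup>2 / 2) exp (\<i> s y) ds\<close>, up to constants. The truncation is needed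
  because the Gaussian factor is not integrable over the half line, but on the operator side the
  truncation error is only \<open>exp (- Re k L) / Re k\<close>, so the resolvent is a norm limit of these
  Toeplitz operators. Finally \<open>F\<^sub>L\<close> is continuous and vanishes at infinity, hence by the
  Stone-Weierstrass theorem \<open>F\<^sub>L(\<sigma>(\<cdot>, z))\<close> belongs to the algebra generated by the classical resolvents.
\<close>

text \<open>The operators are given by nested choices (\<open>Fock_proj\<close>,
  \<open>L2_extend\<close>, \<open>resolvent\<close>), so even their linearity holds only almost
  everywhere and has to be derived. The Weyl operators are therefore not followed through their
  extensions: the Toeplitz formula is taken as a definition \<open>U z\<close> for all
  \<open>z\<close> in \<open>H_half t\<close> at once, and only afterwards compared with
  \<open>weyl t z\<close>. The formula by itself bounds \<open>U z\<close> by the exponential of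
  half the squared norm of \<open>z\<close>; contractivity comes from the coherent states, and it is
  this much better bound that makes the truncation error small. Operator-valued integrals are
  avoided: each integral is a scalar one, of the inner product of a moved vector with a test vector
  \<open>q\<close>, and estimates uniform in \<open>q\<close> give norm estimates. As
  \<open>resolvent\<close> is defined by the generator equation, the limit of the truncated Laplace
  integrals must also be shown to solve it, in norm and not only weakly; before that the choice in
  \<open>resolvent\<close> is not known to satisfy anything. That the symbols vanish at infinity
  follows from one integration by parts on the finite interval.\<close>

section \<open>Exponential integrals and moments of Gaussian measures on the plane\<close>

lemma lborel_complex_eq:
  "lborel = distr (lborel \<Otimes>\<^sub>M lborel) borel (\<lambda>(x, y). Complex x y)"
proof (rule lborel_eqI)
  have m[measurable]: "(\<lambda>(x, y). Complex x y) \<in> borel_measurable (lborel \<Otimes>\<^sub>M lborel)"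
    by (simp add: Complex_eq split_beta)
  fix l u :: complex assume lu: "\<And>b. b \<in> Basis \<Longrightarrow> l \<bullet> b \<le> u \<bullet> b"
  have le: "Re l \<le> Re u" "Im l \<le> Im u"
    using lu[of 1] lu[of \<i>] by (auto simp: Basis_complex_def inner_complex_def)
  have "(\<lambda>(x, y). Complex x y) -` box l u \<inter> space (lborel \<Otimes>\<^sub>M lborel) = {Re l<..<Re u} \<times> {Im l<..<Im u}"
    by (auto simp: box_def Basis_complex_def inner_complex_def space_pair_measure)
  then show "emeasure (distr (lborel \<Otimes>\<^sub>M lborel) borel (\<lambda>(x, y). Complex x y)) (box l u) =
      ennreal (\<Prod>b\<in>Basis. (u - l) \<bullet> b)"
    using le by (simp add: emeasure_distr lborel.emeasure_pair_measure_Times Basis_complex_def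
      inner_complex_def ennreal_mult)
qed simp

text \<open>Completing the square turns the real part of the exponent into a shift of the mean; what
  is left is the characteristic function of the standard normal distribution at the rescaled
  imaginary part.\<close>

lemma normal_density_exp_integral:
  fixes \<alpha> :: complex
  assumes \<sigma>: "\<sigma> > 0"
  shows "has_bochner_integral lborel (\<lambda>x. normal_density 0 \<sigma> x *\<^sub>R exp (\<alpha> * of_real x))
    (exp (\<alpha>\<^sup>2 * of_real (\<sigma>\<^sup>2) / 2))"
proof -
  define a b where "a = Re \<alpha>" and "b = Im \<alpha>"
  have \<alpha>: "\<alpha> = of_real a + \<i> * of_real b" by (simp add: a_def b_def complex_eq)
  let ?g = "\<lambda>x. normal_density (a * \<sigma>\<^sup>2) \<sigma> x *\<^sub>R exp (\<i> * of_real (b * x))"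
  have shift: "normal_density 0 \<sigma> x *\<^sub>R exp (\<alpha> * of_real x)
      = of_real (exp (a\<^sup>2 * \<sigma>\<^sup>2 / 2)) * ?g x" for x
  proof -
    have "- x\<^sup>2 / (2 * \<sigma>\<^sup>2) + a * x = a\<^sup>2 * \<sigma>\<^sup>2 / 2 + - (x - a * \<sigma>\<^sup>2)\<^sup>2 / (2 * \<sigma>\<^sup>2)"
      using \<sigma> by (simp add: field_simps power2_eq_square)
    then have "exp (- x\<^sup>2 / (2 * \<sigma>\<^sup>2)) * exp (a * x) =
        exp (a\<^sup>2 * \<sigma>\<^sup>2 / 2) * exp (- (x - a * \<sigma>\<^sup>2)\<^sup>2 / (2 * \<sigma>\<^sup>2))"
      by (simp flip: exp_add)
    then have "normal_density 0 \<sigma> x * exp (a * x) = exp (a\<^sup>2 * \<sigma>\<^sup>2 / 2) * normal_density (a * \<sigma>\<^sup>2) \<sigma> x"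
      unfolding normal_density_def by (simp add: field_simps)
    moreover have "exp (\<alpha> * of_real x) = of_real (exp (a * x)) * exp (\<i> * of_real (b * x))"
      by (simp add: \<alpha> algebra_simps exp_add flip: exp_of_real)
    ultimately show ?thesis
      by (simp add: scaleR_conv_of_real flip: of_real_mult)
  qed
  have int: "integrable lborel ?g"
    by (rule Bochner_Integration.integrable_bound[OF integrable_normal_density[OF \<sigma>, of "a * \<sigma>\<^sup>2"]])
      auto
  have std: "normal_density (a * \<sigma>\<^sup>2) \<sigma> (a * \<sigma>\<^sup>2 + \<sigma> * u) = std_normal_density u / \<sigma>" for u
    using \<sigma> by (simp add: normal_density_def real_sqrt_mult power_mult_distrib)
  have "(\<integral>x. ?g x \<partial>lborel) = \<bar>\<sigma>\<bar> *\<^sub>R (\<integral>u. ?g (a * \<sigma>\<^sup>2 + \<sigma> * u) \<partial>lborel)"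
    using \<sigma> by (intro lborel_integral_real_affine) auto
  also have "(\<lambda>u. ?g (a * \<sigma>\<^sup>2 + \<sigma> * u)) = (\<lambda>u. (exp (\<i> * of_real (a * b * \<sigma>\<^sup>2)) / of_real \<sigma>) *
      (std_normal_density u *\<^sub>R exp (\<i> * of_real (b * \<sigma> * u))))"
    unfolding std using \<sigma> by (auto simp: scaleR_conv_of_real algebra_simps exp_add)
  also have "\<bar>\<sigma>\<bar> *\<^sub>R (\<integral>u. \<dots> u \<partial>lborel) = exp (\<i> * of_real (a * b * \<sigma>\<^sup>2)) *
      (\<integral>u. std_normal_density u *\<^sub>R exp (\<i> * of_real (b * \<sigma> * u)) \<partial>lborel)"
    using \<sigma> by (simp add: scaleR_conv_of_real)
  also have "(\<integral>u. std_normal_density u *\<^sub>R exp (\<i> * of_real (b * \<sigma> * u)) \<partial>lborel)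
      = char std_normal_distribution (b * \<sigma>)"
    unfolding char_def by (subst integral_density) auto
  also have "\<dots> = of_real (exp (- (b * \<sigma>)\<^sup>2 / 2))" by (simp add: char_std_normal_distribution)
  finally have val: "(\<integral>x. ?g x \<partial>lborel) =
      exp (\<i> * of_real (a * b * \<sigma>\<^sup>2)) * of_real (exp (- (b * \<sigma>)\<^sup>2 / 2))" .
  have "has_bochner_integral lborel (\<lambda>x. of_real (exp (a\<^sup>2 * \<sigma>\<^sup>2 / 2)) * ?g x)
     (of_real (exp (a\<^sup>2 * \<sigma>\<^sup>2 / 2)) * (exp (\<i> * of_real (a * b * \<sigma>\<^sup>2)) * of_real (exp (- (b * \<sigma>)\<^sup>2 / 2))))"
    using int val by (intro has_bochner_integral_mult_right) (auto simp: has_bochner_integral_iff)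
  also have "of_real (exp (a\<^sup>2 * \<sigma>\<^sup>2 / 2)) * (exp (\<i> * of_real (a * b * \<sigma>\<^sup>2)) * of_real (exp (- (b * \<sigma>)\<^sup>2 / 2)))
      = exp (\<alpha>\<^sup>2 * of_real (\<sigma>\<^sup>2) / 2)"
    unfolding \<alpha> exp_of_real[symmetric] exp_add[symmetric]
    by (rule arg_cong[where f=exp]) (simp add: field_simps power2_eq_square)
  finally show ?thesis unfolding shift .
qed

lemma integrable_product_lborel:
  fixes f g :: "real \<Rightarrow> complex"
  assumes f: "integrable lborel f" and g: "integrable lborel g"
  shows "integrable (lborel \<Otimes>\<^sub>M lborel) (\<lambda>(x, y). f x * g y)"
proof (rule lborel_pair.Fubini_integrable)
  have [measurable]: "f \<in> borel_measurable borel" "g \<in> borel_measurable borel"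
    using f g by auto
  show "(\<lambda>(x, y). f x * g y) \<in> borel_measurable (lborel \<Otimes>\<^sub>M lborel)" by measurable
  show "integrable lborel (\<lambda>x. \<integral>y. norm (case (x, y) of (x, y) \<Rightarrow> f x * g y) \<partial>lborel)"
    using f by (auto simp: norm_mult intro!: integrable_mult_left integrable_norm)
  show "AE x in lborel. integrable lborel (\<lambda>y. case (x, y) of (x, y) \<Rightarrow> f x * g y)"
    using g by auto
qed

lemma has_bochner_integral_product_lborel:
  fixes f g :: "real \<Rightarrow> complex"
  assumes f: "has_bochner_integral lborel f a" and g: "has_bochner_integral lborel g b"
  shows "has_bochner_integral (lborel \<Otimes>\<^sub>M lborel) (\<lambda>(x, y). f x * g y) (a * b)"
proof -
  have i: "integrable (lborel \<Otimes>\<^sub>M lborel) (\<lambda>(x, y). f x * g y)"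
    using f g by (intro integrable_product_lborel) (auto simp: has_bochner_integral_iff)
  have "integral\<^sup>L (lborel \<Otimes>\<^sub>M lborel) (\<lambda>(x, y). f x * g y) = (\<integral>x. (\<integral>y. f x * g y \<partial>lborel) \<partial>lborel)"
    using lborel_pair.integral_fst'[OF i] by simp
  then show ?thesis using i f g by (simp add: has_bochner_integral_iff)
qed

text \<open>The coefficients of \<open>Re w\<close> and \<open>Im w\<close> are independent complex
  numbers, so that exponents combining \<open>w\<close> and its conjugate with unrelated
  coefficients are covered. These are the integrands of inner products of coherent states.\<close>

lemma gaussian_complex_exp:
  fixes \<alpha> \<beta> :: complex
  assumes s: "s > 0"
  shows "has_bochner_integral (gaussian_complex s) (\<lambda>w. exp (\<alpha> * of_real (Re w) + \<beta> * of_real (Im w)))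
    (exp ((\<alpha>\<^sup>2 + \<beta>\<^sup>2) * of_real s / 4))"
proof -
  \<comment> \<open>The density of the plane with parameter \<open>s\<close> is a product of two
    real normal densities of variance \<open>s / 2\<close>.\<close>
  define \<sigma> where "\<sigma> = sqrt (s / 2)"
  have \<sigma>: "\<sigma> > 0" "\<sigma>\<^sup>2 = s / 2" using s by (auto simp: \<sigma>_def)
  let ?n = "normal_density 0 \<sigma>"
  have dens: "exp (- (cmod w)\<^sup>2 / s) / (pi * s) = ?n (Re w) * ?n (Im w)" for w
    using s unfolding normal_density_def \<sigma> cmod_power2
    by (simp add: exp_add[symmetric] field_simps power2_eq_square flip: exp_minus)
  let ?f = "\<lambda>x. ?n x *\<^sub>R exp (\<alpha> * of_real x)" and ?g = "\<lambda>y. ?n y *\<^sub>R exp (\<beta> * of_real y)"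
  note F = normal_density_exp_integral[OF \<sigma>(1), of \<alpha>] and G = normal_density_exp_integral[OF \<sigma>(1), of \<beta>]
  have mf: "(\<lambda>w. exp (\<alpha> * of_real (Re w) + \<beta> * of_real (Im w))) \<in> borel_measurable borel"
    by measurable
  have mC[measurable]: "(\<lambda>(x, y). Complex x y) \<in> borel_measurable (lborel \<Otimes>\<^sub>M lborel)"
    by (simp add: Complex_eq split_beta)
  let ?h = "\<lambda>w. (?n (Re w) * ?n (Im w)) *\<^sub>R exp (\<alpha> * of_real (Re w) + \<beta> * of_real (Im w))"
  have mh[measurable]: "?h \<in> borel_measurable borel" by measurable
  have split: "(\<lambda>p. ?h ((\<lambda>(x, y). Complex x y) p)) = (\<lambda>(x, y). ?f x * ?g y)"
    by (auto simp: fun_eq_iff exp_add scaleR_conv_of_real)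
  have fp: "has_bochner_integral (lborel \<Otimes>\<^sub>M lborel) (\<lambda>(x, y). ?f x * ?g y)
     (exp (\<alpha>\<^sup>2 * of_real (\<sigma>\<^sup>2) / 2) * exp (\<beta>\<^sup>2 * of_real (\<sigma>\<^sup>2) / 2))"
    by (rule has_bochner_integral_product_lborel[OF F G])
  have "has_bochner_integral lborel ?h
     (exp (\<alpha>\<^sup>2 * of_real (\<sigma>\<^sup>2) / 2) * exp (\<beta>\<^sup>2 * of_real (\<sigma>\<^sup>2) / 2))"
    unfolding lborel_complex_eq using fp
    by (simp only: has_bochner_integral_iff integrable_distr_eq[OF mC mh] integral_distr[OF mC mh] split)
  moreover have "exp (\<alpha>\<^sup>2 * of_real (\<sigma>\<^sup>2) / 2) * exp (\<beta>\<^sup>2 * of_real (\<sigma>\<^sup>2) / 2) = exp ((\<alpha>\<^sup>2 + \<beta>\<^sup>2) * of_real s / 4)"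
    unfolding \<sigma> exp_add[symmetric] by (rule arg_cong[where f=exp]) (simp add: field_simps)
  ultimately show ?thesis
    unfolding gaussian_complex_def has_bochner_integral_iff dens
    by (auto simp: integrable_density integral_density)
qed

lemma sets_gaussian_complex [measurable_cong, simp]: "sets (gaussian_complex s) = sets borel"
  by (simp add: gaussian_complex_def)

lemma space_gaussian_complex [simp]: "space (gaussian_complex s) = UNIV"
  by (simp add: gaussian_complex_def)

lemma prob_space_gaussian_complex: "s > 0 \<Longrightarrow> prob_space (gaussian_complex s)"
proof
  assume s: "s > 0"
  have "has_bochner_integral (gaussian_complex s) (\<lambda>_. 1::complex) 1"
    using gaussian_complex_exp[OF s, of 0 0] by simp
  then have i: "integrable (gaussian_complex s) (\<lambda>_. 1::complex)" "(\<integral>_. 1 \<partial>gaussian_complex s) = (1::complex)"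
    by (auto simp: has_bochner_integral_iff)
  from i(1) have "emeasure (gaussian_complex s) (space (gaussian_complex s)) < \<infinity>"
    by (auto simp: integrable_iff_bounded)
  with i(2) show "emeasure (gaussian_complex s) (space (gaussian_complex s)) = 1"
    by (auto simp: emeasure_eq_ennreal_measure scaleR_conv_of_real)
qed

text \<open>Second moments are estimated through this inequality from the exponential integrals,
  which are known in closed form.\<close>

lemma square_le_exp: "x\<^sup>2 \<le> 2 * (exp x + exp (- x))" for x :: real
proof -
  have "x\<^sup>2 \<le> 2 * exp \<bar>x\<bar>" using exp_lower_Taylor_quadratic[of "\<bar>x\<bar>"] by auto
  also have "exp \<bar>x\<bar> \<le> exp x + exp (- x)" by (cases "x \<ge> 0") auto
  finally show ?thesis by simp
qed

text \<open>The bound is linear in \<open>s\<close>, so its sum over the coordinates is finite when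
  \<open>t\<close> is summable; this is how the product measure is seen to live on
  \<open>ell2\<close>.\<close>

lemma gaussian_complex_second_moment:
  assumes s: "s > 0"
  shows "(\<integral>\<^sup>+w. ennreal ((cmod w)\<^sup>2) \<partial>gaussian_complex s) \<le> ennreal (8 * exp 1 * s)"
proof -
  \<comment> \<open>With this scaling each of the four exponential integrals equals
    \<open>exp (1/4)\<close>, whatever \<open>s\<close> is.\<close>
  define c where "c = 1 / sqrt s"
  have c: "c\<^sup>2 = 1 / s" using s by (simp add: c_def power_divide)
  have moment: "has_bochner_integral (gaussian_complex s) (\<lambda>w. exp (a * Re w + b * Im w)) (exp ((a\<^sup>2 + b\<^sup>2) * s / 4))"
    for a b
  proof -
    have "Re (exp (of_real a * of_real (Re w) + of_real b * of_real (Im w))) = exp (a * Re w + b * Im w)" for w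
      by (simp add: exp_of_real flip: of_real_mult of_real_add)
    moreover have "Re (exp (((of_real a)\<^sup>2 + (of_real b)\<^sup>2) * of_real s / 4)) = exp ((a\<^sup>2 + b\<^sup>2) * s / 4)"
    proof -
      have "((of_real a)\<^sup>2 + (of_real b)\<^sup>2) * of_real s / (4::complex) = of_real ((a\<^sup>2 + b\<^sup>2) * s / 4)" by simp
      then show ?thesis by (metis Re_complex_of_real exp_of_real)
    qed
    ultimately show ?thesis
      using has_bochner_integral_bounded_linear[OF bounded_linear_Re gaussian_complex_exp[OF s, of "of_real a" "of_real b"]]
      by simp
  qed
  define h where "h w = 2 * s * (exp (c * Re w + 0 * Im w) + exp ((-c) * Re w + 0 * Im w)
      + (exp (0 * Re w + c * Im w) + exp (0 * Re w + (-c) * Im w)))" for w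
  have h: "has_bochner_integral (gaussian_complex s) h (2 * s * (exp (1/4) + exp (1/4) + (exp (1/4) + exp (1/4))))"
    unfolding h_def using s moment[of c 0] moment[of "-c" 0] moment[of 0 c] moment[of 0 "-c"]
    by (intro has_bochner_integral_mult_right has_bochner_integral_add) (simp_all add: c)
  have le: "(cmod w)\<^sup>2 \<le> h w" for w
  proof -
    have "x\<^sup>2 \<le> 2 * s * (exp (c * x) + exp (- c * x))" for x
    proof -
      have "x\<^sup>2 = s * (c * x)\<^sup>2" using s by (simp add: power_mult_distrib c)
      also have "\<dots> \<le> s * (2 * (exp (c * x) + exp (- (c * x))))" using s square_le_exp by (intro mult_left_mono) auto
      finally show ?thesis by (simp add: algebra_simps)
    qed
    from this[of "Re w"] this[of "Im w"] show ?thesis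
      unfolding cmod_power2 h_def by (simp add: algebra_simps)
  qed
  have "(\<integral>\<^sup>+w. ennreal ((cmod w)\<^sup>2) \<partial>gaussian_complex s) \<le> (\<integral>\<^sup>+w. ennreal (h w) \<partial>gaussian_complex s)"
    by (intro nn_integral_mono ennreal_leI le)
  also have "\<dots> = ennreal (8 * s * exp (1/4))"
    using h order_trans[OF zero_le_power2 le]
    by (subst nn_integral_eq_integral) (auto simp: has_bochner_integral_iff mult_ac)
  also have "\<dots> \<le> ennreal (8 * exp 1 * s)"
    using s by (intro ennreal_leI) (simp add: mult_ac)
  finally show ?thesis .
qed

section \<open>The Gaussian measure on \<open>ell2\<close> and its exponential integrals\<close>

text \<open>For these sequences the pairing \<open>ip_half t w a\<close> is a finite sum for every
  \<open>w\<close> whatsoever; truncations of a general sequence belong to this class and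
  approximate it.\<close>

definition fin_supp :: "(nat \<Rightarrow> complex) set" where
  "fin_supp = {a. finite {i. a i \<noteq> 0}}"

lemma ip_half_fin_supp:
  assumes "finite A" "\<And>i. i \<notin> A \<Longrightarrow> z i = 0 \<or> w i = 0"
  shows "ip_half t z w = (\<Sum>i\<in>A. z i * cnj (w i) / complex_of_real (t i))"
  unfolding ip_half_def using assms by (intro suminf_finite) auto

locale gauss =
  fixes t :: "nat \<Rightarrow> real"
  assumes t_pos: "t k > 0" and t_summable: "summable t"
begin

abbreviation "\<mu> \<equiv> gaussian t"
abbreviation "P \<equiv> PiM UNIV (\<lambda>k. gaussian_complex (t k))"

sublocale P: product_prob_space "\<lambda>k. gaussian_complex (t k)" UNIV
  by (rule product_prob_spaceI) (simp add: prob_space_gaussian_complex t_pos)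

lemma ell2_eq: "ell2 = {w. (\<Sum>n. ennreal ((cmod (w n))\<^sup>2)) < \<infinity>}"
  by (auto simp: ell2_def suminf_ennreal2 less_top[symmetric] intro: summable_suminf_not_top)

lemma space_P: "space P = UNIV"
  by (simp add: space_PiM)

lemma ell2_sets: "ell2 \<in> sets P"
proof -
  have "{w \<in> space P. (\<Sum>n. ennreal ((cmod (w n))\<^sup>2)) < \<infinity>} \<in> sets P"
    by measurable
  then show ?thesis by (simp add: ell2_eq space_P)
qed

text \<open>The squared norm has finite expectation, hence is finite almost everywhere.\<close>

lemma AE_ell2: "AE w in P. w \<in> ell2"
proof -
  have "(\<integral>\<^sup>+w. (\<Sum>n. ennreal ((cmod (w n))\<^sup>2)) \<partial>P) = (\<Sum>n. \<integral>\<^sup>+w. ennreal ((cmod (w n))\<^sup>2) \<partial>P)"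
    by (intro nn_integral_suminf) measurable
  also have "\<dots> \<le> (\<Sum>n. ennreal (8 * exp 1 * t n))"
  proof (intro suminf_le)
    fix n
    have "(\<integral>\<^sup>+w. ennreal ((cmod (w n))\<^sup>2) \<partial>P) = (\<integral>\<^sup>+x. ennreal ((cmod x)\<^sup>2) \<partial>distr P (gaussian_complex (t n)) (\<lambda>w. w n))"
      by (subst nn_integral_distr) auto
    also have "\<dots> = (\<integral>\<^sup>+x. ennreal ((cmod x)\<^sup>2) \<partial>gaussian_complex (t n))"
      by (subst P.PiM_component) auto
    also have "\<dots> \<le> ennreal (8 * exp 1 * t n)" by (intro gaussian_complex_second_moment t_pos)
    finally show "(\<integral>\<^sup>+w. ennreal ((cmod (w n))\<^sup>2) \<partial>P) \<le> ennreal (8 * exp 1 * t n)" .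
  qed auto
  also have "\<dots> < \<infinity>"
    using t_pos t_summable by (subst suminf_ennreal2) (auto intro!: less_imp_le summable_mult)
  finally have "(\<integral>\<^sup>+w. (\<Sum>n. ennreal ((cmod (w n))\<^sup>2)) \<partial>P) \<noteq> \<infinity>" by simp
  then have "AE w in P. (\<Sum>n. ennreal ((cmod (w n))\<^sup>2)) \<noteq> \<infinity>"
    by (intro nn_integral_PInf_AE) measurable
  then show ?thesis by (auto simp: ell2_eq less_top)
qed

sublocale prob_space \<mu>
proof
  have "emeasure P ell2 = 1"
    using AE_ell2 ell2_sets by (intro P.P.emeasure_eq_1_AE) auto
  then show "emeasure \<mu> (space \<mu>) = 1"
    unfolding gaussian_def using ell2_sets
    by (simp add: emeasure_restrict_space space_restrict_space space_P)
qed

lemma measurable_coord [measurable]: "(\<lambda>w. w i) \<in> borel_measurable \<mu>"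
  unfolding gaussian_def by (rule measurable_restrict_space1) measurable

text \<open>Since \<open>ell2\<close> has full measure, restricting to it changes no integral;
  computations may be done in the full product space.\<close>

lemma has_bochner_integral_gaussian:
  fixes f :: hfun
  assumes "has_bochner_integral P f x"
  shows "has_bochner_integral \<mu> f x"
proof -
  have f: "integrable P f" "integral\<^sup>L P f = x" using assms by (auto simp: has_bochner_integral_iff)
  have ae: "AE w in P. indicator ell2 w *\<^sub>R f w = f w"
    using AE_ell2 by eventually_elim auto
  have i: "integrable P (\<lambda>w. indicator ell2 w *\<^sub>R f w)"
    using f ell2_sets by (intro integrable_mult_indicator) auto
  have "integral\<^sup>L P (\<lambda>w. indicator ell2 w *\<^sub>R f w) = x"
    using f ae i by (subst integral_cong_AE[where g=f]) auto
  with i show ?thesis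
    using ell2_sets by (simp add: has_bochner_integral_iff gaussian_def integrable_restrict_space
      integral_restrict_space space_P)
qed

lemma has_bochner_integral_prod:
  fixes f :: "nat \<Rightarrow> complex \<Rightarrow> complex"
  assumes "finite A" "\<And>i. i \<in> A \<Longrightarrow> has_bochner_integral (gaussian_complex (t i)) (f i) (x i)"
  shows "has_bochner_integral \<mu> (\<lambda>w. \<Prod>i\<in>A. f i (w i)) (\<Prod>i\<in>A. x i)"
proof (rule has_bochner_integral_gaussian)
  let ?PA = "PiM A (\<lambda>k. gaussian_complex (t k))"
  have fi: "integrable (gaussian_complex (t i)) (f i)" "integral\<^sup>L (gaussian_complex (t i)) (f i) = x i"
    if "i \<in> A" for i
    using assms(2)[OF that] by (auto simp: has_bochner_integral_iff)
  have i: "integrable ?PA (\<lambda>w. \<Prod>i\<in>A. f i (w i))"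
    using assms(1) fi by (intro P.product_integrable_prod) auto
  have e: "integral\<^sup>L ?PA (\<lambda>w. \<Prod>i\<in>A. f i (w i)) = (\<Prod>i\<in>A. x i)"
    using assms(1) fi by (subst P.product_integral_prod) auto
  have d: "distr P ?PA (\<lambda>x. restrict x A) = ?PA"
    using assms(1) by (intro P.distr_PiM_restrict_finite) auto
  have r: "(\<lambda>x. restrict x A) \<in> measurable P ?PA" by (intro measurable_restrict_subset) auto
  have eq: "(\<lambda>w. \<Prod>i\<in>A. f i (restrict w A i)) = (\<lambda>w. \<Prod>i\<in>A. f i (w i))"
    by (intro ext prod.cong) auto
  have "integrable P (\<lambda>w. \<Prod>i\<in>A. f i (w i))"
    using integrable_distr[OF r, of "\<lambda>w. \<Prod>i\<in>A. f i (w i)"] i unfolding d eq by simp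
  moreover have "integral\<^sup>L P (\<lambda>w. \<Prod>i\<in>A. f i (w i)) = (\<Prod>i\<in>A. x i)"
    using integral_distr[OF r, of "\<lambda>w. \<Prod>i\<in>A. f i (w i)"] i e borel_measurable_integrable[OF i] unfolding d eq by simp
  ultimately show "has_bochner_integral P (\<lambda>w. \<Prod>i\<in>A. f i (w i)) (\<Prod>i\<in>A. x i)"
    by (simp add: has_bochner_integral_iff)
qed

text \<open>The integrand is a product over the joint support of \<open>a\<close> and
  \<open>b\<close>, so the integral factors. The value is the reproducing kernel: it is the inner
  product of the coherent states at \<open>a\<close> and at \<open>b\<close>.\<close>

lemma gaussian_exp_integral:
  assumes "a \<in> fin_supp" "b \<in> fin_supp"
  shows "has_bochner_integral \<mu> (\<lambda>w. exp (ip_half t w a + cnj (ip_half t w b))) (exp (ip_half t b a))"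
proof -
  define A where "A = {i. a i \<noteq> 0} \<union> {i. b i \<noteq> 0}"
  have A: "finite A" using assms by (auto simp: A_def fin_supp_def)
  define f where "f i x = exp ((x * cnj (a i) + cnj x * b i) / complex_of_real (t i))" for i x
  have "has_bochner_integral \<mu> (\<lambda>w. \<Prod>i\<in>A. f i (w i)) (\<Prod>i\<in>A. exp (b i * cnj (a i) / t i))"
  proof (rule has_bochner_integral_prod[OF A])
    fix i
    \<comment> \<open>Writing \<open>x\<close> and \<open>cnj x\<close> through real and imaginary
      parts gives these coefficients; the difference of the two squares then collapses to four times
      the mixed product.\<close>
    let ?\<alpha> = "(cnj (a i) + b i) / t i" and ?\<beta> = "\<i> * (cnj (a i) - b i) / t i"
    have "?\<alpha> * of_real (Re x) + ?\<beta> * of_real (Im x) = (x * cnj (a i) + cnj x * b i) / complex_of_real (t i)" for x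
      using t_pos[of i] by (simp add: complex_eq_iff field_simps)
    moreover have "(?\<alpha>\<^sup>2 + ?\<beta>\<^sup>2) * of_real (t i) / 4 = b i * cnj (a i) / t i"
      using t_pos[of i] by (simp add: field_simps power2_eq_square)
    ultimately show "has_bochner_integral (gaussian_complex (t i)) (f i) (exp (b i * cnj (a i) / t i))"
      using gaussian_complex_exp[OF t_pos[of i], of ?\<alpha> ?\<beta>] by (simp add: f_def[abs_def])
  qed
  moreover have "(\<Prod>i\<in>A. f i (w i)) = exp (ip_half t w a + cnj (ip_half t w b))" for w
  proof -
    have 1: "ip_half t w a = (\<Sum>i\<in>A. w i * cnj (a i) / complex_of_real (t i))"
      by (rule ip_half_fin_supp[OF A]) (auto simp: A_def)
    have 2: "ip_half t w b = (\<Sum>i\<in>A. w i * cnj (b i) / complex_of_real (t i))"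
      by (rule ip_half_fin_supp[OF A]) (auto simp: A_def)
    show ?thesis unfolding f_def exp_sum[OF A, symmetric] 1 2
      by (simp add: add_divide_distrib sum.distrib)
  qed
  moreover have "(\<Prod>i\<in>A. exp (b i * cnj (a i) / t i)) = exp (ip_half t b a)"
    unfolding exp_sum[OF A, symmetric] by (subst ip_half_fin_supp[OF A]) (auto simp: A_def)
  ultimately show ?thesis by simp
qed

end

section \<open>Hilbert space theory of square integrable functions, on representatives\<close>

lemma borel_measurable_cnj [measurable]: "cnj \<in> borel_measurable borel"
  by (intro borel_measurable_continuous_onI continuous_intros)

context gauss
begin

abbreviation "N \<equiv> L2_norm t"
abbreviation "ip \<equiv> L2_ip t"

lemma L2_measurable: "f \<in> L2 t \<Longrightarrow> f \<in> borel_measurable \<mu>"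
  by (simp add: L2_def)

lemma L2_square_integrable: "f \<in> L2 t \<Longrightarrow> integrable \<mu> (\<lambda>w. (cmod (f w))\<^sup>2)"
  by (simp add: L2_def)

lemma L2_I:
  assumes "f \<in> borel_measurable \<mu>" "integrable \<mu> D" "AE w in \<mu>. (cmod (f w))\<^sup>2 \<le> D w"
  shows "f \<in> L2 t"
proof -
  have [measurable]: "f \<in> borel_measurable \<mu>" by fact
  have "integrable \<mu> (\<lambda>w. (cmod (f w))\<^sup>2)"
    by (rule Bochner_Integration.integrable_bound[OF assms(2)], measurable) (use assms(3) in auto)
  then show ?thesis using assms(1) by (simp add: L2_def)
qed

lemma L2_cong_AE:
  assumes "f \<in> L2 t" "g \<in> borel_measurable \<mu>" "AE w in \<mu>. f w = g w"
  shows "g \<in> L2 t"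
proof (rule L2_I[OF assms(2) L2_square_integrable[OF assms(1)]])
  show "AE w in \<mu>. (cmod (g w))\<^sup>2 \<le> (cmod (f w))\<^sup>2" using assms(3) by eventually_elim auto
qed

lemma L2_add:
  assumes "f \<in> L2 t" "g \<in> L2 t"
  shows "(\<lambda>w. f w + g w) \<in> L2 t"
proof (rule L2_I[where D="\<lambda>w. 2 * (cmod (f w))\<^sup>2 + 2 * (cmod (g w))\<^sup>2"])
  show "(\<lambda>w. f w + g w) \<in> borel_measurable \<mu>"
    by (rule borel_measurable_add[OF L2_measurable L2_measurable]) fact+
  show "integrable \<mu> (\<lambda>w. 2 * (cmod (f w))\<^sup>2 + 2 * (cmod (g w))\<^sup>2)"
    using L2_square_integrable[OF assms(1)] L2_square_integrable[OF assms(2)] by simp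
qed (simp add: cmod_add_sq_le)

lemma L2_mult_bounded:
  assumes "f \<in> L2 t" "\<phi> \<in> borel_measurable \<mu>" "AE w in \<mu>. cmod (\<phi> w) \<le> K"
  shows "(\<lambda>w. \<phi> w * f w) \<in> L2 t"
proof (rule L2_I[where D="\<lambda>w. K\<^sup>2 * (cmod (f w))\<^sup>2"])
  show "(\<lambda>w. \<phi> w * f w) \<in> borel_measurable \<mu>"
    using assms(2) L2_measurable[OF assms(1)] by simp
  show "AE w in \<mu>. (cmod (\<phi> w * f w))\<^sup>2 \<le> K\<^sup>2 * (cmod (f w))\<^sup>2"
    using assms(3) by eventually_elim (auto simp: norm_mult power_mult_distrib intro!: mult_right_mono power_mono)
qed (use assms L2_square_integrable in auto)

lemma L2_scale: "f \<in> L2 t \<Longrightarrow> (\<lambda>w. c * f w) \<in> L2 t"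
  by (rule L2_mult_bounded[where K="cmod c"]) auto

lemma L2_diff: "f \<in> L2 t \<Longrightarrow> g \<in> L2 t \<Longrightarrow> (\<lambda>w. f w - g w) \<in> L2 t"
  using L2_add[of f "\<lambda>w. -1 * g w"] L2_scale[of g "-1"] by simp

lemma L2_zero: "(\<lambda>w. 0) \<in> L2 t"
  by (simp add: L2_def)

lemma L2_ip_integrable:
  assumes "f \<in> L2 t" "g \<in> L2 t"
  shows "integrable \<mu> (\<lambda>w. f w * cnj (g w))"
proof (rule Bochner_Integration.integrable_bound)
  show "integrable \<mu> (\<lambda>w. (cmod (f w))\<^sup>2 + (cmod (g w))\<^sup>2)"
    using assms by (auto intro: L2_square_integrable)
  show "AE w in \<mu>. norm (f w * cnj (g w)) \<le> norm ((cmod (f w))\<^sup>2 + (cmod (g w))\<^sup>2)"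
  proof (intro AE_I2)
    fix w
    have "cmod (f w) * cmod (g w) \<le> (cmod (f w))\<^sup>2 + (cmod (g w))\<^sup>2"
      using sum_squares_bound[of "cmod (f w)" "cmod (g w)"]
        mult_nonneg_nonneg[OF norm_ge_zero norm_ge_zero, of "f w" "g w"] by linarith
    then show "norm (f w * cnj (g w)) \<le> norm ((cmod (f w))\<^sup>2 + (cmod (g w))\<^sup>2)"
      by (simp add: norm_mult)
  qed
  have [measurable]: "f \<in> borel_measurable \<mu>" "g \<in> borel_measurable \<mu>"
    using assms by (auto intro: L2_measurable)
  show "(\<lambda>w. f w * cnj (g w)) \<in> borel_measurable \<mu>" by measurable
qed

lemma ip_add_left: "f \<in> L2 t \<Longrightarrow> g \<in> L2 t \<Longrightarrow> h \<in> L2 t \<Longrightarrow> ip (\<lambda>w. f w + g w) h = ip f h + ip g h"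
  unfolding L2_ip_def by (simp add: ring_distribs L2_ip_integrable)

lemma ip_diff_left: "f \<in> L2 t \<Longrightarrow> g \<in> L2 t \<Longrightarrow> h \<in> L2 t \<Longrightarrow> ip (\<lambda>w. f w - g w) h = ip f h - ip g h"
  unfolding L2_ip_def by (simp add: ring_distribs L2_ip_integrable)

lemma ip_scale_left: "ip (\<lambda>w. c * f w) h = c * ip f h"
  unfolding L2_ip_def by (simp add: mult.assoc)

lemma ip_cnj: "cnj (ip f g) = ip g f"
proof -
  have "ip g f = (\<integral>w. cnj (f w * cnj (g w)) \<partial>\<mu>)" by (simp add: L2_ip_def mult.commute)
  then show ?thesis by (simp only: Bochner_Integration.integral_cnj L2_ip_def)
qed

lemma ip_add_right: "f \<in> L2 t \<Longrightarrow> g \<in> L2 t \<Longrightarrow> h \<in> L2 t \<Longrightarrow> ip h (\<lambda>w. f w + g w) = ip h f + ip h g"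
  using ip_add_left[of f g h] by (metis complex_cnj_add ip_cnj)

lemma ip_diff_right: "f \<in> L2 t \<Longrightarrow> g \<in> L2 t \<Longrightarrow> h \<in> L2 t \<Longrightarrow> ip h (\<lambda>w. f w - g w) = ip h f - ip h g"
  using ip_diff_left[of f g h] by (metis complex_cnj_diff ip_cnj)

lemma ip_scale_right: "ip f (\<lambda>w. c * h w) = cnj c * ip f h"
  by (metis complex_cnj_mult ip_cnj ip_scale_left)

lemma N_nonneg: "N f \<ge> 0"
  unfolding L2_norm_def by (intro real_sqrt_ge_zero integral_nonneg_AE) auto

lemma N_power2: "(N f)\<^sup>2 = (\<integral>w. (cmod (f w))\<^sup>2 \<partial>\<mu>)"
  unfolding L2_norm_def by (intro real_sqrt_pow2 integral_nonneg_AE) auto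

lemma ip_self: "ip f f = of_real ((N f)\<^sup>2)"
proof -
  have "ip f f = (\<integral>w. of_real ((cmod (f w))\<^sup>2) \<partial>\<mu>)"
    unfolding L2_ip_def by (simp only: complex_norm_square)
  then show ?thesis by (simp only: N_power2 integral_complex_of_real)
qed

lemma N_scale: "N (\<lambda>w. c * f w) = cmod c * N f"
  unfolding L2_norm_def by (simp add: norm_mult power_mult_distrib real_sqrt_mult)

lemma ip_cong_AE:
  assumes "f \<in> L2 t" "f' \<in> L2 t" "g \<in> L2 t" "g' \<in> L2 t" "AE w in \<mu>. f w = f' w" "AE w in \<mu>. g w = g' w"
  shows "ip f g = ip f' g'"
  unfolding L2_ip_def
proof (rule integral_cong_AE)
  show "AE w in \<mu>. f w * cnj (g w) = f' w * cnj (g' w)" using assms(5,6) by eventually_elim simp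
qed (use assms in \<open>auto intro!: borel_measurable_integrable L2_ip_integrable\<close>)

lemma N_cong_AE:
  assumes "f \<in> borel_measurable \<mu>" "g \<in> borel_measurable \<mu>" "AE w in \<mu>. f w = g w"
  shows "N f = N g"
proof -
  have [measurable]: "f \<in> borel_measurable \<mu>" "g \<in> borel_measurable \<mu>" by fact+
  have "(\<integral>w. (cmod (f w))\<^sup>2 \<partial>\<mu>) = (\<integral>w. (cmod (g w))\<^sup>2 \<partial>\<mu>)"
    by (rule integral_cong_AE, measurable) (use assms(3) in auto)
  then show ?thesis by (simp add: L2_norm_def)
qed

lemma N_mult_bounded:
  assumes f: "f \<in> L2 t" and \<phi>: "\<phi> \<in> borel_measurable \<mu>" "AE w in \<mu>. cmod (\<phi> w) \<le> K" and K: "K \<ge> 0"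
  shows "N (\<lambda>w. \<phi> w * f w) \<le> K * N f"
proof -
  have "(\<integral>w. (cmod (\<phi> w * f w))\<^sup>2 \<partial>\<mu>) \<le> (\<integral>w. K\<^sup>2 * (cmod (f w))\<^sup>2 \<partial>\<mu>)"
  proof (rule integral_mono_AE)
    show "AE w in \<mu>. (cmod (\<phi> w * f w))\<^sup>2 \<le> K\<^sup>2 * (cmod (f w))\<^sup>2"
      using \<phi>(2) by eventually_elim (auto simp: norm_mult power_mult_distrib intro!: mult_right_mono power_mono)
  qed (use L2_square_integrable[OF f] L2_square_integrable[OF L2_mult_bounded[OF f \<phi>]] in auto)
  also have "\<dots> = (K * N f)\<^sup>2" by (simp add: power_mult_distrib N_power2)
  finally show ?thesis unfolding N_power2[symmetric]
    by (rule power2_le_imp_le) (simp add: K N_nonneg)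
qed

lemma N_eq_0_AE:
  assumes "f \<in> L2 t" "N f = 0"
  shows "AE w in \<mu>. f w = 0"
proof -
  have "(\<integral>w. (cmod (f w))\<^sup>2 \<partial>\<mu>) = 0" using N_power2[of f] assms(2) by simp
  then have "AE w in \<mu>. (cmod (f w))\<^sup>2 = 0"
    using integral_nonneg_eq_0_iff_AE[OF L2_square_integrable[OF assms(1)]] by auto
  then show ?thesis by eventually_elim simp
qed

text \<open>This single expansion serves for the Cauchy-Schwarz and triangle inequalities, for the
  parallelogram law and orthogonality in the projection theorem, and for distances of coherent
  states.\<close>

lemma N_add_scale:
  assumes "f \<in> L2 t" "g \<in> L2 t"
  shows "(N (\<lambda>w. f w + c * g w))\<^sup>2 = (N f)\<^sup>2 + 2 * Re (cnj c * ip f g) + (cmod c)\<^sup>2 * (N g)\<^sup>2"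
proof -
  have "of_real ((N (\<lambda>w. f w + c * g w))\<^sup>2) = ip (\<lambda>w. f w + c * g w) (\<lambda>w. f w + c * g w)"
    by (simp only: ip_self)
  also have "\<dots> = ip f f + cnj c * ip f g + c * ip g f + c * (cnj c * ip g g)"
    using assms by (simp add: ip_add_left ip_add_right ip_scale_left ip_scale_right L2_add L2_scale ring_distribs)
  finally have e: "of_real ((N (\<lambda>w. f w + c * g w))\<^sup>2) = ip f f + cnj c * ip f g + c * ip g f + c * (cnj c * ip g g)" .
  have "(N (\<lambda>w. f w + c * g w))\<^sup>2 = Re (ip f f + cnj c * ip f g + c * ip g f + c * (cnj c * ip g g))"
    unfolding e[symmetric] by (simp only: Re_complex_of_real)
  moreover have "Re (c * ip g f) = Re (cnj c * ip f g)" by (simp add: ip_cnj[of f g, symmetric])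
  moreover have "Re (c * (cnj c * ip g g)) = (cmod c)\<^sup>2 * (N g)\<^sup>2"
  proof -
    have "c * (cnj c * ip g g) = of_real ((cmod c)\<^sup>2 * (N g)\<^sup>2)"
      unfolding ip_self of_real_mult complex_norm_square by (simp only: mult.assoc)
    then show ?thesis by (simp only: Re_complex_of_real)
  qed
  moreover have "Re (ip f f) = (N f)\<^sup>2" unfolding ip_self by (rule Re_complex_of_real)
  ultimately show ?thesis unfolding plus_complex.simps by linarith
qed

lemma Cauchy_Schwarz:
  assumes "f \<in> L2 t" "g \<in> L2 t"
  shows "cmod (ip f g) \<le> N f * N g"
proof (cases "N g = 0")
  case True
  have "AE w in \<mu>. g w = 0" by (rule N_eq_0_AE[OF assms(2) True])
  then have "ip f g = ip f (\<lambda>w. 0)" using assms by (intro ip_cong_AE) (auto simp: L2_zero)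
  then show ?thesis using True by (simp add: L2_ip_def)
next
  case False
  then have pos: "N g > 0" using N_nonneg[of g] by simp
  \<comment> \<open>The coefficient minimising the norm of \<open>f + c g\<close>.\<close>
  define c where "c = - ip f g / of_real ((N g)\<^sup>2)"
  have "Re (cnj c * ip f g) = - (cmod (ip f g))\<^sup>2 / (N g)\<^sup>2"
  proof -
    have "cnj c * ip f g = - (cnj (ip f g) * ip f g) / of_real ((N g)\<^sup>2)" by (simp add: c_def)
    also have "\<dots> = of_real (- (cmod (ip f g))\<^sup>2 / (N g)\<^sup>2)"
      by (simp only: of_real_divide of_real_minus complex_norm_square mult.commute)
    finally show ?thesis by (simp only: Re_complex_of_real)
  qed
  moreover have "(cmod c)\<^sup>2 * (N g)\<^sup>2 = (cmod (ip f g))\<^sup>2 / (N g)\<^sup>2"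
  proof -
    have "cmod c = cmod (ip f g) / (N g)\<^sup>2" by (simp add: c_def norm_divide norm_power)
    then show ?thesis using pos by (simp add: field_simps power2_eq_square)
  qed
  moreover have "0 \<le> (N (\<lambda>w. f w + c * g w))\<^sup>2" by simp
  ultimately have "(cmod (ip f g))\<^sup>2 / (N g)\<^sup>2 \<le> (N f)\<^sup>2"
    unfolding N_add_scale[OF assms] by simp
  then have "(cmod (ip f g))\<^sup>2 \<le> (N f * N g)\<^sup>2"
    using pos by (simp add: field_simps power_mult_distrib)
  then show ?thesis by (rule power2_le_imp_le) (simp add: N_nonneg)
qed

lemma N_triangle:
  assumes "f \<in> L2 t" "g \<in> L2 t"
  shows "N (\<lambda>w. f w + g w) \<le> N f + N g"
proof -
  have "(N (\<lambda>w. f w + 1 * g w))\<^sup>2 \<le> (N f + N g)\<^sup>2"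
    unfolding N_add_scale[OF assms] using Cauchy_Schwarz[OF assms] complex_Re_le_cmod[of "ip f g"]
    by (simp add: power2_sum)
  from power2_le_imp_le[OF this] show ?thesis by (simp add: N_nonneg)
qed

lemma N_minus_commute: "N (\<lambda>w. f w - g w) = N (\<lambda>w. g w - f w)"
  unfolding L2_norm_def by (simp add: norm_minus_commute)

lemma N_triangle_diff:
  assumes "f \<in> L2 t" "g \<in> L2 t" "h \<in> L2 t"
  shows "N (\<lambda>w. f w - h w) \<le> N (\<lambda>w. f w - g w) + N (\<lambda>w. g w - h w)"
  using N_triangle[OF L2_diff[OF assms(1,2)] L2_diff[OF assms(2,3)]] by simp

lemma N_le_add_diff:
  assumes "f \<in> L2 t" "g \<in> L2 t"
  shows "N f \<le> N g + N (\<lambda>w. f w - g w)"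
  using N_triangle[OF assms(2) L2_diff[OF assms]] by simp

lemma L2_one: "(\<lambda>w. 1) \<in> L2 t" by (simp add: L2_def)

lemma N_one: "N (\<lambda>w. 1) = 1" by (simp add: L2_norm_def prob_space)

lemma L1_le_N:
  assumes "f \<in> L2 t"
  shows "integrable \<mu> (\<lambda>w. cmod (f w))" "(\<integral>w. cmod (f w) \<partial>\<mu>) \<le> N f"
proof -
  have [measurable]: "f \<in> borel_measurable \<mu>" using assms by (rule L2_measurable)
  have m: "(\<lambda>w. of_real (cmod (f w))) \<in> L2 t"
  proof (rule L2_I[OF _ L2_square_integrable[OF assms]])
    show "(\<lambda>w. complex_of_real (cmod (f w))) \<in> borel_measurable \<mu>" by measurable
  qed simp
  have eq: "N (\<lambda>w. of_real (cmod (f w))) = N f" by (simp add: L2_norm_def)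
  have "integrable \<mu> (\<lambda>w. complex_of_real (cmod (f w)))" using L2_ip_integrable[OF m L2_one] by simp
  from integrable_Re[OF this] show i: "integrable \<mu> (\<lambda>w. cmod (f w))" by simp
  have "ip (\<lambda>w. of_real (cmod (f w))) (\<lambda>w. 1) = of_real (\<integral>w. cmod (f w) \<partial>\<mu>)"
    by (simp add: L2_ip_def)
  then show "(\<integral>w. cmod (f w) \<partial>\<mu>) \<le> N f"
    using Cauchy_Schwarz[OF m L2_one] unfolding eq N_one by simp
qed

lemma N_dominated_convergence:
  assumes [measurable]: "\<And>n. f n \<in> borel_measurable \<mu>" "g \<in> borel_measurable \<mu>"
    and D: "integrable \<mu> D" "\<And>n. AE w in \<mu>. (cmod (f n w - g w))\<^sup>2 \<le> D w"
    and lim: "AE w in \<mu>. (\<lambda>n. f n w) \<longlonglongrightarrow> g w"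
  shows "(\<lambda>n. N (\<lambda>w. f n w - g w)) \<longlonglongrightarrow> 0"
proof -
  have "(\<lambda>n. \<integral>w. (cmod (f n w - g w))\<^sup>2 \<partial>\<mu>) \<longlonglongrightarrow> (\<integral>w. 0 \<partial>\<mu>)"
  proof (rule integral_dominated_convergence[OF _ _ D(1)])
    show "AE w in \<mu>. (\<lambda>n. (cmod (f n w - g w))\<^sup>2) \<longlonglongrightarrow> 0"
      using lim
    proof eventually_elim
      case (elim w)
      have "(\<lambda>n. f n w - g w) \<longlonglongrightarrow> 0" using elim by (simp add: LIM_zero_iff)
      then have "(\<lambda>n. (cmod (f n w - g w))\<^sup>2) \<longlonglongrightarrow> (cmod 0)\<^sup>2" by (intro tendsto_intros)
      then show ?case by simp
    qed
    show "AE w in \<mu>. norm ((cmod (f n w - g w))\<^sup>2) \<le> D w" for n using D(2)[of n] by simp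
  qed measurable
  from tendsto_real_sqrt[OF this] show ?thesis unfolding L2_norm_def by simp
qed

lemma L2_limit_AE_subseq:
  assumes f: "\<And>n. f n \<in> L2 t" and g: "g \<in> L2 t" and lim: "(\<lambda>n. N (\<lambda>w. f n w - g w)) \<longlonglongrightarrow> 0"
  shows "\<exists>r::nat\<Rightarrow>nat. strict_mono r \<and> (AE w in \<mu>. (\<lambda>n. f (r n) w) \<longlonglongrightarrow> g w)"
proof -
  have L: "(\<lambda>w. f n w - g w) \<in> L2 t" for n using L2_diff f g by blast
  have "\<exists>r::nat\<Rightarrow>nat. strict_mono r \<and> (AE w in \<mu>. (\<lambda>n. (\<lambda>n w. cmod (f n w - g w)) (r n) w) \<longlonglongrightarrow> 0)"
  proof (rule tendsto_L1_AE_subseq)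
    show "integrable \<mu> (\<lambda>w. cmod (f n w - g w))" for n by (rule L1_le_N(1)[OF L])
    show "(\<lambda>n. \<integral>w. norm (cmod (f n w - g w)) \<partial>\<mu>) \<longlonglongrightarrow> 0"
      by (rule tendsto_sandwich[OF _ _ tendsto_const lim]) (auto simp: L1_le_N[OF L])
  qed
  then show ?thesis by (simp add: tendsto_norm_zero_iff LIM_zero_iff)
qed

text \<open>Limits obtained abstractly, from completeness or from boundedness of an operator, are
  identified with explicit functions by this comparison with a pointwise limit.\<close>

lemma L2_limit_unique_AE:
  assumes f: "\<And>n. f n \<in> L2 t" and g: "g \<in> L2 t" and lim: "(\<lambda>n. N (\<lambda>w. f n w - g w)) \<longlonglongrightarrow> 0"
    and h: "AE w in \<mu>. (\<lambda>n. f n w) \<longlonglongrightarrow> h w"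
  shows "AE w in \<mu>. g w = h w"
proof -
  obtain r :: "nat \<Rightarrow> nat" where r: "strict_mono r" "AE w in \<mu>. (\<lambda>n. f (r n) w) \<longlonglongrightarrow> g w"
    using L2_limit_AE_subseq[OF f g lim] by blast
  from r(2) h show ?thesis
  proof eventually_elim
    case (elim w)
    then show ?case using LIMSEQ_subseq_LIMSEQ[OF elim(2) r(1)] by (simp add: o_def LIMSEQ_unique)
  qed
qed

lemma L2_complete:
  assumes f: "\<And>n. f n \<in> L2 t"
    and Cauchy: "\<And>e. e > 0 \<Longrightarrow> \<exists>M. \<forall>m\<ge>M. \<forall>n\<ge>M. N (\<lambda>w. f m w - f n w) < e"
  shows "\<exists>g\<in>L2 t. (\<lambda>n. N (\<lambda>w. f n w - g w)) \<longlonglongrightarrow> 0"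
proof -
  have [measurable]: "\<And>n. f n \<in> borel_measurable \<mu>" using f L2_measurable by blast
  have "\<exists>M. \<forall>m\<ge>M. \<forall>n\<ge>M. N (\<lambda>w. f m w - f n w) < (1/2)^k" for k using Cauchy by simp
  then obtain R where R: "\<And>k m n. m \<ge> R k \<Longrightarrow> n \<ge> R k \<Longrightarrow> N (\<lambda>w. f m w - f n w) < (1/2)^k" by metis
  \<comment> \<open>Adding up all earlier thresholds makes \<open>r\<close> monotone and at least
    \<open>R k\<close>; the summand \<open>k\<close> makes it tend to infinity.\<close>
  define r where "r k = k + (\<Sum>j\<le>k. R j)" for k :: nat
  have r: "r k \<ge> R k" "r (Suc k) \<ge> r k" "r k \<ge> k" for k
    using member_le_sum[of k "{..k}" R] by (auto simp: r_def trans_le_add2)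
  define g where "g k = f (r k)" for k
  have g: "g k \<in> L2 t" for k using f by (simp add: g_def)
  have [measurable]: "\<And>n. g n \<in> borel_measurable \<mu>" using g L2_measurable by blast
  have gL: "(\<lambda>w. g (Suc k) w - g k w) \<in> L2 t" for k using L2_diff g by blast
  have gN: "N (\<lambda>w. g (Suc k) w - g k w) \<le> (1/2)^k" for k
    using R[OF order_trans[OF r(1) r(2)] r(1)] by (auto simp: g_def less_imp_le)
  have "(\<integral>\<^sup>+w. (\<Sum>k. ennreal (cmod (g (Suc k) w - g k w))) \<partial>\<mu>) =
      (\<Sum>k. \<integral>\<^sup>+w. ennreal (cmod (g (Suc k) w - g k w)) \<partial>\<mu>)"
    by (intro nn_integral_suminf) measurable
  also have "\<dots> \<le> (\<Sum>k. ennreal ((1/2)^k))"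
  proof (intro suminf_le)
    fix k
    have "(\<integral>\<^sup>+w. ennreal (cmod (g (Suc k) w - g k w)) \<partial>\<mu>) = ennreal (\<integral>w. cmod (g (Suc k) w - g k w) \<partial>\<mu>)"
      using L1_le_N[OF gL] by (intro nn_integral_eq_integral) auto
    also have "\<dots> \<le> ennreal ((1/2)^k)" using L1_le_N(2)[OF gL[of k]] gN[of k] by (intro ennreal_leI) auto
    finally show "(\<integral>\<^sup>+w. ennreal (cmod (g (Suc k) w - g k w)) \<partial>\<mu>) \<le> ennreal ((1/2)^k)" .
  qed auto
  also have "\<dots> < \<infinity>" by (subst suminf_ennreal2) auto
  finally have "(\<integral>\<^sup>+w. (\<Sum>k. ennreal (cmod (g (Suc k) w - g k w))) \<partial>\<mu>) \<noteq> \<infinity>" by simp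
  then have "AE w in \<mu>. (\<Sum>k. ennreal (cmod (g (Suc k) w - g k w))) \<noteq> \<infinity>"
    by (intro nn_integral_PInf_AE) measurable
  then have conv: "AE w in \<mu>. convergent (\<lambda>k. g k w)"
  proof eventually_elim
    case (elim w)
    then have "summable (\<lambda>k. cmod (g (Suc k) w - g k w))" by (intro summable_suminf_not_top) auto
    then have "summable (\<lambda>k. g (Suc k) w - g k w)" by (rule summable_norm_cancel)
    then have "convergent (\<lambda>n. \<Sum>k<n. g (Suc k) w - g k w)" by (simp add: summable_iff_convergent)
    then have "convergent (\<lambda>n. g n w - g 0 w)" by (simp only: sum_lessThan_telescope[of "\<lambda>k. g k w"])
    then have "convergent (\<lambda>n. (g n w - g 0 w) + g 0 w)" by (intro convergent_add convergent_const)
    then show ?case by simp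
  qed
  define h where "h w = lim (\<lambda>k. g k w)" for w
  have hm[measurable]: "h \<in> borel_measurable \<mu>" unfolding h_def by measurable
  have lim: "AE w in \<mu>. (\<lambda>k. g k w) \<longlonglongrightarrow> h w"
    using conv by eventually_elim (simp add: h_def convergent_LIMSEQ_iff)
  \<comment> \<open>Fatou's lemma along the subsequence controls every late member of the original
    sequence, so no separate passage back from the subsequence is required.\<close>
  have fatou: "(\<integral>\<^sup>+w. ennreal ((cmod (f n w - h w))\<^sup>2) \<partial>\<mu>) \<le> ennreal (e\<^sup>2)"
    if M: "\<forall>m\<ge>M. \<forall>n\<ge>M. N (\<lambda>w. f m w - f n w) < e" and n: "n \<ge> M" for M n e
  proof -
    have "(\<integral>\<^sup>+w. ennreal ((cmod (f n w - h w))\<^sup>2) \<partial>\<mu>) =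
        (\<integral>\<^sup>+w. liminf (\<lambda>k. ennreal ((cmod (f n w - g k w))\<^sup>2)) \<partial>\<mu>)"
    proof (rule nn_integral_cong_AE)
      show "AE w in \<mu>. ennreal ((cmod (f n w - h w))\<^sup>2) = liminf (\<lambda>k. ennreal ((cmod (f n w - g k w))\<^sup>2))"
        using lim
      proof eventually_elim
        case (elim w)
        have "(\<lambda>k. ennreal ((cmod (f n w - g k w))\<^sup>2)) \<longlonglongrightarrow> ennreal ((cmod (f n w - h w))\<^sup>2)"
          using elim by (intro tendsto_intros tendsto_ennrealI)
        then show ?case by (rule lim_imp_Liminf[OF trivial_limit_sequentially, symmetric])
      qed
    qed
    also have "\<dots> \<le> liminf (\<lambda>k. \<integral>\<^sup>+w. ennreal ((cmod (f n w - g k w))\<^sup>2) \<partial>\<mu>)"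
      by (intro nn_integral_liminf) measurable
    also have "\<dots> \<le> ennreal (e\<^sup>2)"
    proof (rule Liminf_le)
      have "\<forall>\<^sub>F k in sequentially. k \<ge> M" by (rule eventually_ge_at_top)
      then show "\<forall>\<^sub>F k in sequentially. (\<integral>\<^sup>+w. ennreal ((cmod (f n w - g k w))\<^sup>2) \<partial>\<mu>) \<le> ennreal (e\<^sup>2)"
      proof eventually_elim
        case (elim k)
        have "(\<integral>\<^sup>+w. ennreal ((cmod (f n w - g k w))\<^sup>2) \<partial>\<mu>) = ennreal ((N (\<lambda>w. f n w - g k w))\<^sup>2)"
          unfolding N_power2 using L2_square_integrable[OF L2_diff[OF f g]]
          by (intro nn_integral_eq_integral) auto
        moreover have "N (\<lambda>w. f n w - g k w) < e"
          using M n elim r(3)[of k] by (auto simp: g_def)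
        ultimately show ?case
          using N_nonneg[of "\<lambda>w. f n w - g k w"] by (simp add: ennreal_leI power_mono)
      qed
    qed simp
    finally show ?thesis .
  qed
  have hn: "(\<lambda>w. f n w - h w) \<in> L2 t \<and> N (\<lambda>w. f n w - h w) \<le> e"
    if "e > 0" and M: "\<forall>m\<ge>M. \<forall>n\<ge>M. N (\<lambda>w. f m w - f n w) < e" "n \<ge> M" for M n e
  proof -
    note le = fatou[OF M]
    have i: "integrable \<mu> (\<lambda>w. (cmod (f n w - h w))\<^sup>2)"
    proof (rule integrableI_bounded)
      have "(\<integral>\<^sup>+w. ennreal (norm ((cmod (f n w - h w))\<^sup>2)) \<partial>\<mu>) \<le> ennreal (e\<^sup>2)" using le by simp
      then show "(\<integral>\<^sup>+w. ennreal (norm ((cmod (f n w - h w))\<^sup>2)) \<partial>\<mu>) < \<infinity>"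
        by (rule le_less_trans) simp
    qed measurable
    have "ennreal ((N (\<lambda>w. f n w - h w))\<^sup>2) \<le> ennreal (e\<^sup>2)"
      using nn_integral_eq_integral[OF i] le by (simp add: N_power2)
    then have "(N (\<lambda>w. f n w - h w))\<^sup>2 \<le> e\<^sup>2" using that(1) by (simp add: ennreal_le_iff)
    then have "N (\<lambda>w. f n w - h w) \<le> e" by (rule power2_le_imp_le) (rule less_imp_le[OF \<open>e > 0\<close>])
    moreover have "(\<lambda>w. f n w - h w) \<in> borel_measurable \<mu>" by measurable
    ultimately show ?thesis using i by (simp add: L2_def)
  qed
  obtain M where M: "\<forall>m\<ge>M. \<forall>n\<ge>M. N (\<lambda>w. f m w - f n w) < 1"
    using Cauchy[OF zero_less_one] by blast
  have "h \<in> L2 t"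
    using L2_diff[OF f[of M] conjunct1[OF hn[OF zero_less_one M order_refl]]] by simp
  moreover have "(\<lambda>n. N (\<lambda>w. f n w - h w)) \<longlonglongrightarrow> 0"
  proof (rule LIMSEQ_I)
    fix e :: real assume "e > 0"
    then obtain M where M: "\<forall>m\<ge>M. \<forall>n\<ge>M. N (\<lambda>w. f m w - f n w) < e/2"
      using Cauchy[OF half_gt_zero] by blast
    have "N (\<lambda>w. f n w - h w) \<le> e/2" if "n \<ge> M" for n by (rule conjunct2[OF hn[OF half_gt_zero[OF \<open>e > 0\<close>] M that]])
    then have "N (\<lambda>w. f n w - h w) < e" if "n \<ge> M" for n
      by (rule le_less_trans) (use that \<open>e > 0\<close> in simp_all)
    then have "norm (N (\<lambda>w. f n w - h w) - 0) < e" if "n \<ge> M" for n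
      using that by (simp add: N_nonneg)
    then show "\<exists>no. \<forall>n\<ge>no. norm (N (\<lambda>w. f n w - h w) - 0) < e"
      by (intro exI[of _ M] allI impI)
  qed
  ultimately show ?thesis by blast
qed

text \<open>Closedness is phrased as approximability in the seminorm, so such a set also contains
  every \<open>L2 t\<close> function that is almost everywhere equal to one of its members.\<close>

definition closed_subspace :: "hfun set \<Rightarrow> bool" where
  "closed_subspace V \<longleftrightarrow> V \<subseteq> L2 t \<and> V \<noteq> {} \<and> (\<forall>f\<in>V. \<forall>g\<in>V. (\<lambda>w. f w + g w) \<in> V) \<and>
    (\<forall>c. \<forall>f\<in>V. (\<lambda>w. c * f w) \<in> V) \<and>
    (\<forall>f\<in>L2 t. (\<forall>e>0. \<exists>v\<in>V. N (\<lambda>w. f w - v w) < e) \<longrightarrow> f \<in> V)"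

text \<open>A minimising sequence is Cauchy by the parallelogram law, because midpoints stay in
  \<open>V\<close> and so have distance at least \<open>d\<close> from \<open>f\<close>. Its limit
  attains the distance, and minimality forces orthogonality.\<close>

lemma projection_exists:
  assumes V: "closed_subspace V" and f: "f \<in> L2 t"
  shows "\<exists>h\<in>V. \<forall>g\<in>V. ip (\<lambda>w. f w - h w) g = 0"
proof -
  have VL: "v \<in> L2 t" if "v \<in> V" for v using V that by (auto simp: closed_subspace_def)
  have Vadd: "(\<lambda>w. u w + v w) \<in> V" if "u \<in> V" "v \<in> V" for u v using V that by (auto simp: closed_subspace_def)
  have Vsc: "(\<lambda>w. c * v w) \<in> V" if "v \<in> V" for v c using V that by (auto simp: closed_subspace_def)
  define d where "d = (INF v\<in>V. N (\<lambda>w. f w - v w))"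
  have ne: "V \<noteq> {}" using V by (simp add: closed_subspace_def)
  have bb: "bdd_below ((\<lambda>v. N (\<lambda>w. f w - v w)) ` V)" by (intro bdd_belowI[of _ 0]) (auto simp: N_nonneg)
  have d_le: "d \<le> N (\<lambda>w. f w - v w)" if "v \<in> V" for v unfolding d_def by (rule cINF_lower[OF bb that])
  have d0: "d \<ge> 0" unfolding d_def by (rule cINF_greatest[OF ne]) (simp add: N_nonneg)
  have "\<exists>v\<in>V. N (\<lambda>w. f w - v w) < d + 1 / (real n + 1)" for n
    using cINF_less_iff[OF ne bb, of "d + 1 / (real n + 1)"] by (simp add: d_def)
  then obtain v where v: "\<And>n. v n \<in> V" "\<And>n. N (\<lambda>w. f w - v n w) < d + 1 / (real n + 1)" by metis
  have par: "(N (\<lambda>w. v m w - v n w))\<^sup>2 \<le> 2 * (d + 1 / (real m + 1))\<^sup>2 + 2 * (d + 1 / (real n + 1))\<^sup>2 - 4 * d\<^sup>2" for m n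
  proof -
    let ?a = "\<lambda>w. f w - v m w" and ?b = "\<lambda>w. f w - v n w"
    have ab: "?a \<in> L2 t" "?b \<in> L2 t" using v f VL L2_diff by auto
    let ?u = "\<lambda>w. (1/2) * (v m w + v n w)"
    have u: "?u \<in> V" using Vsc[OF Vadd[OF v(1)[of m] v(1)[of n]]] .
    have e1: "(\<lambda>w. ?a w + (-1) * ?b w) = (\<lambda>w. v n w - v m w)" by auto
    have e2: "(\<lambda>w. ?a w + 1 * ?b w) = (\<lambda>w. 2 * (f w - ?u w))" by (auto simp: field_simps)
    have "(N (\<lambda>w. v n w - v m w))\<^sup>2 + (2 * N (\<lambda>w. f w - ?u w))\<^sup>2 = 2 * (N ?a)\<^sup>2 + 2 * (N ?b)\<^sup>2"
      using N_add_scale[OF ab, of "-1"] N_add_scale[OF ab, of 1] unfolding e1 e2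
      using N_scale[of 2 "\<lambda>w. f w - ?u w"] by simp
    moreover have "d\<^sup>2 \<le> (N (\<lambda>w. f w - ?u w))\<^sup>2" using d_le[OF u] d0 by (intro power_mono) auto
    moreover have "(N ?a)\<^sup>2 \<le> (d + 1 / (real m + 1))\<^sup>2" "(N ?b)\<^sup>2 \<le> (d + 1 / (real n + 1))\<^sup>2"
      by (rule power_mono[OF less_imp_le[OF v(2)] N_nonneg])+
    moreover have "N (\<lambda>w. v m w - v n w) = N (\<lambda>w. v n w - v m w)" by (rule N_minus_commute)
    ultimately show ?thesis by (simp add: power_mult_distrib)
  qed
  have "\<exists>h\<in>L2 t. (\<lambda>n. N (\<lambda>w. v n w - h w)) \<longlonglongrightarrow> 0"
  proof (rule L2_complete)
    show "v n \<in> L2 t" for n using v VL by auto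
    fix e :: real assume e: "e > 0"
    have "(\<lambda>n. 1 / (real n + 1)) \<longlonglongrightarrow> 0"
      using LIMSEQ_inverse_real_of_nat by (simp add: inverse_eq_divide add.commute)
    then have "(\<lambda>n. 2 * (d + 1 / (real n + 1))\<^sup>2) \<longlonglongrightarrow> 2 * (d + 0)\<^sup>2"
      by (intro tendsto_intros)
    then have "\<forall>\<^sub>F n in sequentially. 2 * (d + 1 / (real n + 1))\<^sup>2 < 2 * d\<^sup>2 + e\<^sup>2 / 2"
      by (rule order_tendstoD) (use e in simp)
    then obtain M where M: "\<And>n. n \<ge> M \<Longrightarrow> 2 * (d + 1 / (real n + 1))\<^sup>2 < 2 * d\<^sup>2 + e\<^sup>2 / 2"
      by (auto simp: eventually_sequentially)
    have "N (\<lambda>w. v m w - v n w) < e" if "m \<ge> M" "n \<ge> M" for m n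
    proof -
      have "(N (\<lambda>w. v m w - v n w))\<^sup>2 < e\<^sup>2" using par[of m n] M[OF that(1)] M[OF that(2)] by linarith
      then show ?thesis by (rule power_less_imp_less_base) (rule less_imp_le[OF e])
    qed
    then show "\<exists>M. \<forall>m\<ge>M. \<forall>n\<ge>M. N (\<lambda>w. v m w - v n w) < e" by blast
  qed
  then obtain h where h: "h \<in> L2 t" "(\<lambda>n. N (\<lambda>w. v n w - h w)) \<longlonglongrightarrow> 0" by blast
  have hV: "h \<in> V"
  proof -
    have "\<exists>v\<in>V. N (\<lambda>w. h w - v w) < e" if "e > 0" for e
    proof -
      from order_tendstoD(2)[OF h(2) that] obtain n where "N (\<lambda>w. v n w - h w) < e"
        by (auto simp: eventually_sequentially)
      then show ?thesis using v(1)[of n] N_minus_commute[of "v n" h] by auto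
    qed
    then show ?thesis using V h(1) by (auto simp: closed_subspace_def)
  qed
  have Nd: "N (\<lambda>w. f w - h w) \<le> d"
  proof (rule LIMSEQ_le_const)
    have "(\<lambda>n. 1 / (real n + 1)) \<longlonglongrightarrow> 0"
      using LIMSEQ_inverse_real_of_nat by (simp add: inverse_eq_divide add.commute)
    then have "(\<lambda>n. (d + 1 / (real n + 1)) + N (\<lambda>w. v n w - h w)) \<longlonglongrightarrow> (d + 0) + 0"
      by (intro tendsto_intros h(2))
    then show "(\<lambda>n. (d + 1 / (real n + 1)) + N (\<lambda>w. v n w - h w)) \<longlonglongrightarrow> d" by simp
    show "\<exists>M. \<forall>n\<ge>M. N (\<lambda>w. f w - h w) \<le> (d + 1 / (real n + 1)) + N (\<lambda>w. v n w - h w)"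
    proof (intro exI allI impI)
      fix n show "N (\<lambda>w. f w - h w) \<le> (d + 1 / (real n + 1)) + N (\<lambda>w. v n w - h w)"
        using N_triangle_diff[OF f VL[OF v(1)[of n]] h(1)] v(2)[of n] by linarith
    qed
  qed
  have "ip (\<lambda>w. f w - h w) g = 0" if g: "g \<in> V" for g
  proof (cases "N g = 0")
    case True
    then show ?thesis using Cauchy_Schwarz[OF L2_diff[OF f h(1)] VL[OF g]] by simp
  next
    case False
    then have pos: "(N g)\<^sup>2 > 0" by simp
    let ?k = "\<lambda>w. f w - h w"
    \<comment> \<open>The best correction of \<open>h\<close> in the direction \<open>g\<close>; it
      would lower the distance strictly unless the inner product is zero.\<close>
    define c where "c = - ip ?k g / of_real ((N g)\<^sup>2)"
    have k: "?k \<in> L2 t" using L2_diff[OF f h(1)] .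
    have mem: "(\<lambda>w. h w + (- c) * g w) \<in> V" using Vadd[OF hV Vsc[OF g]] .
    have "N ?k \<le> N (\<lambda>w. ?k w + c * g w)"
      using Nd d_le[OF mem] by (simp add: algebra_simps)
    then have "(N ?k)\<^sup>2 \<le> (N (\<lambda>w. ?k w + c * g w))\<^sup>2" by (intro power_mono N_nonneg)
    moreover have "Re (cnj c * ip ?k g) = - (cmod (ip ?k g))\<^sup>2 / (N g)\<^sup>2"
  proof -
    have "cnj c * ip ?k g = - (cnj (ip ?k g) * ip ?k g) / of_real ((N g)\<^sup>2)" by (simp add: c_def)
    also have "\<dots> = of_real (- (cmod (ip ?k g))\<^sup>2 / (N g)\<^sup>2)"
      by (simp only: of_real_divide of_real_minus complex_norm_square mult.commute)
    finally show ?thesis by (simp only: Re_complex_of_real)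
  qed
    moreover have "(cmod c)\<^sup>2 * (N g)\<^sup>2 = (cmod (ip ?k g))\<^sup>2 / (N g)\<^sup>2"
    proof -
    have "cmod c = cmod (ip ?k g) / (N g)\<^sup>2" by (simp add: c_def norm_divide norm_power)
    then show ?thesis using pos by (simp add: field_simps power2_eq_square)
  qed
    ultimately have "(cmod (ip ?k g))\<^sup>2 / (N g)\<^sup>2 \<le> 0"
      unfolding N_add_scale[OF k VL[OF g]] by simp
    then have "(cmod (ip ?k g))\<^sup>2 \<le> 0" using pos by (simp add: divide_le_0_iff)
    then show ?thesis by simp
  qed
  then show ?thesis using hV by blast
qed

end

section \<open>Algebra of analytic polynomials and exponential growth bounds\<close>

lemma poly_monomial: "finite {i. \<alpha> i \<noteq> 0} \<Longrightarrow> monomial \<alpha> \<in> analytic_polys"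
  unfolding analytic_polys_def
  by (intro CollectI exI[of _ "{\<alpha>}"] exI[of _ "\<lambda>_. 1"]) auto

lemma poly_add:
  assumes "p \<in> analytic_polys" "q \<in> analytic_polys"
  shows "(\<lambda>w. p w + q w) \<in> analytic_polys"
proof -
  obtain A c where A: "p = (\<lambda>w. \<Sum>\<alpha>\<in>A. c \<alpha> * monomial \<alpha> w)" "finite A" "\<forall>\<alpha>\<in>A. finite {i. \<alpha> i \<noteq> 0}"
    using assms(1) by (auto simp: analytic_polys_def)
  obtain B d where B: "q = (\<lambda>w. \<Sum>\<alpha>\<in>B. d \<alpha> * monomial \<alpha> w)" "finite B" "\<forall>\<alpha>\<in>B. finite {i. \<alpha> i \<noteq> 0}"
    using assms(2) by (auto simp: analytic_polys_def)
  define e where "e \<alpha> = (if \<alpha> \<in> A then c \<alpha> else 0) + (if \<alpha> \<in> B then d \<alpha> else 0)" for \<alpha>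
  have "p w + q w = (\<Sum>\<alpha>\<in>A \<union> B. e \<alpha> * monomial \<alpha> w)" for w
  proof -
    have "p w = (\<Sum>\<alpha>\<in>A \<union> B. (if \<alpha> \<in> A then c \<alpha> else 0) * monomial \<alpha> w)"
      unfolding A(1) using A(2) B(2) by (intro sum.mono_neutral_cong_left) auto
    moreover have "q w = (\<Sum>\<alpha>\<in>A \<union> B. (if \<alpha> \<in> B then d \<alpha> else 0) * monomial \<alpha> w)"
      unfolding B(1) using A(2) B(2) by (intro sum.mono_neutral_cong_left) auto
    ultimately show ?thesis by (simp add: e_def ring_distribs sum.distrib)
  qed
  then show ?thesis using A B unfolding analytic_polys_def
    by (intro CollectI exI[of _ "A \<union> B"] exI[of _ e]) auto
qed

lemma poly_scale:
  assumes "p \<in> analytic_polys"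
  shows "(\<lambda>w. k * p w) \<in> analytic_polys"
proof -
  obtain A c where A: "p = (\<lambda>w. \<Sum>\<alpha>\<in>A. c \<alpha> * monomial \<alpha> w)" "finite A" "\<forall>\<alpha>\<in>A. finite {i. \<alpha> i \<noteq> 0}"
    using assms(1) by (auto simp: analytic_polys_def)
  then show ?thesis unfolding analytic_polys_def
    by (intro CollectI exI[of _ A] exI[of _ "\<lambda>\<alpha>. k * c \<alpha>"]) (auto simp: sum_distrib_left mult.assoc)
qed

lemma poly_zero: "(\<lambda>w. 0) \<in> analytic_polys"
  unfolding analytic_polys_def by (intro CollectI exI[of _ "{}"] exI[of _ "\<lambda>_. 0"]) auto

lemma poly_induct [consumes 1, case_names zero add scale monomial]:
  assumes "p \<in> analytic_polys" "Q (\<lambda>w. 0)"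
    "\<And>p q. Q p \<Longrightarrow> Q q \<Longrightarrow> Q (\<lambda>w. p w + q w)" "\<And>c p. Q p \<Longrightarrow> Q (\<lambda>w. c * p w)"
    "\<And>\<alpha>. finite {i. \<alpha> i \<noteq> 0} \<Longrightarrow> Q (monomial \<alpha>)"
  shows "Q p"
proof -
  obtain A c where A: "p = (\<lambda>w. \<Sum>\<alpha>\<in>A. c \<alpha> * monomial \<alpha> w)" "finite A" "\<forall>\<alpha>\<in>A. finite {i. \<alpha> i \<noteq> 0}"
    using assms(1) by (auto simp: analytic_polys_def)
  have "Q (\<lambda>w. \<Sum>\<alpha>\<in>A. c \<alpha> * monomial \<alpha> w)"
    using A(2,3)
  proof (induction A)
    case (insert \<alpha> A)
    then show ?case using assms(3)[OF assms(4)[OF assms(5)[of \<alpha>], of "c \<alpha>"] insert.IH] by auto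
  qed (simp add: assms(2))
  then show ?thesis using A by simp
qed

lemma monomial_mult:
  assumes "finite {i. \<alpha> i \<noteq> 0}" "finite {i. \<beta> i \<noteq> 0}"
  shows "monomial \<alpha> w * monomial \<beta> w = monomial (\<lambda>i. \<alpha> i + \<beta> i) w"
proof -
  let ?S = "{i. \<alpha> i \<noteq> 0} \<union> {i. \<beta> i \<noteq> 0}"
  have S: "finite ?S" using assms by auto
  have m: "monomial \<gamma> w = (\<Prod>i\<in>?S. w i ^ \<gamma> i)" if "{i. \<gamma> i \<noteq> 0} \<subseteq> ?S" for \<gamma>
    unfolding monomial_def using S that by (intro prod.mono_neutral_left) auto
  have "monomial \<alpha> w = (\<Prod>i\<in>?S. w i ^ \<alpha> i)" "monomial \<beta> w = (\<Prod>i\<in>?S. w i ^ \<beta> i)"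
    "monomial (\<lambda>i. \<alpha> i + \<beta> i) w = (\<Prod>i\<in>?S. w i ^ (\<alpha> i + \<beta> i))" by (intro m; auto)+
  then show ?thesis by (simp only: prod.distrib power_add)
qed

lemma poly_mult:
  assumes "p \<in> analytic_polys" "q \<in> analytic_polys"
  shows "(\<lambda>w. p w * q w) \<in> analytic_polys"
  using assms(1)
proof (induction rule: poly_induct)
  case zero then show ?case by (simp add: poly_zero)
next
  case (add p q') then show ?case using poly_add by (simp add: ring_distribs)
next
  case (scale c p) then show ?case using poly_scale[OF scale, of c] by (simp add: mult.assoc)
next
  case (monomial \<alpha>)
  show ?case using assms(2)
  proof (induction rule: poly_induct)
    case zero then show ?case by (simp add: poly_zero)
  next
    case (add p q') then show ?case using poly_add by (simp add: ring_distribs)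
  next
    case (scale c p) then show ?case using poly_scale[OF scale, of c] by (simp add: mult_ac)
  next
    case (monomial \<beta>)
    have "finite {i. \<alpha> i + \<beta> i \<noteq> 0}"
      by (rule finite_subset[of _ "{i. \<alpha> i \<noteq> 0} \<union> {i. \<beta> i \<noteq> 0}"])
        (use monomial \<open>finite {i. \<alpha> i \<noteq> 0}\<close> in auto)
    then show ?case
      using poly_monomial[of "\<lambda>i. \<alpha> i + \<beta> i"] monomial_mult[OF \<open>finite {i. \<alpha> i \<noteq> 0}\<close> monomial] by simp
  qed
qed

lemma poly_const: "(\<lambda>w. c) \<in> analytic_polys"
  using poly_scale[OF poly_monomial[of "\<lambda>_. 0"], of c] by (simp add: monomial_def)

lemma poly_coord: "(\<lambda>w. w i) \<in> analytic_polys"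
proof -
  have "{j. (if j = i then 1 else 0 :: nat) \<noteq> 0} = {i}" by auto
  then show ?thesis
    using poly_monomial[of "\<lambda>j. if j = i then 1 else 0"] by (simp add: monomial_def[abs_def])
qed

lemma poly_sum: "finite A \<Longrightarrow> (\<And>i. i \<in> A \<Longrightarrow> p i \<in> analytic_polys) \<Longrightarrow> (\<lambda>w. \<Sum>i\<in>A. p i w) \<in> analytic_polys"
  by (induction rule: finite_induct) (auto simp: poly_zero intro: poly_add)

lemma poly_power: "p \<in> analytic_polys \<Longrightarrow> (\<lambda>w. p w ^ k) \<in> analytic_polys"
  by (induction k) (auto intro: poly_const poly_mult)

text \<open>Uniformity in \<open>n\<close> provides a single square-integrable majorant for dominated convergence.\<close>

definition growth :: "(nat \<Rightarrow> hfun) \<Rightarrow> bool" where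
  "growth f \<longleftrightarrow> (\<exists>I K. finite I \<and> K \<ge> 0 \<and> (\<forall>n w. cmod (f n w) \<le> K * exp (K * (\<Sum>i\<in>I. cmod (w i)))))"

lemma growth_weaken:
  assumes "finite I" "finite J" "I \<subseteq> J" "0 \<le> K" "K \<le> L"
  shows "K * exp (K * (\<Sum>i\<in>I. cmod (w i))) \<le> L * exp (L * (\<Sum>i\<in>J. cmod (w i)))"
  using assms by (intro mult_mono exp_le_cancel_iff[THEN iffD2] sum_mono2) (auto intro: sum_nonneg)

lemma growth_common:
  assumes "growth f" "growth g"
  obtains I K where "finite I" "K \<ge> 0" "\<And>n w. cmod (f n w) \<le> K * exp (K * (\<Sum>i\<in>I. cmod (w i)))"
    "\<And>n w. cmod (g n w) \<le> K * exp (K * (\<Sum>i\<in>I. cmod (w i)))"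
proof -
  obtain I K where f: "finite I" "K \<ge> 0" "\<And>n w. cmod (f n w) \<le> K * exp (K * (\<Sum>i\<in>I. cmod (w i)))"
    using assms(1) unfolding growth_def by blast
  obtain J L where g: "finite J" "L \<ge> 0" "\<And>n w. cmod (g n w) \<le> L * exp (L * (\<Sum>i\<in>J. cmod (w i)))"
    using assms(2) unfolding growth_def by blast
  show ?thesis
  proof (rule that[of "I \<union> J" "max K L"])
    show "cmod (f n w) \<le> max K L * exp (max K L * (\<Sum>i\<in>I \<union> J. cmod (w i)))" for n w
      by (rule order_trans[OF f(3) growth_weaken]) (use f g in auto)
    show "cmod (g n w) \<le> max K L * exp (max K L * (\<Sum>i\<in>I \<union> J. cmod (w i)))" for n w
      by (rule order_trans[OF g(3) growth_weaken]) (use f g in auto)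
  qed (use f g in auto)
qed

lemma growth_add: "growth f \<Longrightarrow> growth g \<Longrightarrow> growth (\<lambda>n w. f n w + g n w)"
proof (erule (1) growth_common)
  fix I K assume I: "finite I" "K \<ge> 0" "\<And>n w. cmod (f n w) \<le> K * exp (K * (\<Sum>i\<in>I. cmod (w i)))"
    "\<And>n w. cmod (g n w) \<le> K * exp (K * (\<Sum>i\<in>I. cmod (w i)))"
  have "cmod (f n w + g n w) \<le> (2 * K) * exp ((2 * K) * (\<Sum>i\<in>I. cmod (w i)))" for n w
  proof -
    have "cmod (f n w + g n w) \<le> (2 * K) * exp (K * (\<Sum>i\<in>I. cmod (w i)))"
      using norm_triangle_ineq[of "f n w" "g n w"] I(3)[of n w] I(4)[of n w] by simp
    also have "\<dots> \<le> (2 * K) * exp ((2 * K) * (\<Sum>i\<in>I. cmod (w i)))"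
      using I(2) by (intro mult_left_mono exp_le_cancel_iff[THEN iffD2] mult_right_mono sum_nonneg) auto
    finally show ?thesis .
  qed
  then show ?thesis unfolding growth_def using I(1,2) by (intro exI[of _ I] exI[of _ "2 * K"]) auto
qed

lemma growth_mult: "growth f \<Longrightarrow> growth g \<Longrightarrow> growth (\<lambda>n w. f n w * g n w)"
proof (erule (1) growth_common)
  fix I K assume I: "finite I" "K \<ge> 0" "\<And>n w. cmod (f n w) \<le> K * exp (K * (\<Sum>i\<in>I. cmod (w i)))"
    "\<And>n w. cmod (g n w) \<le> K * exp (K * (\<Sum>i\<in>I. cmod (w i)))"
  \<comment> \<open>One constant has to serve both as prefactor, where \<open>K * K\<close> arises,
    and in the exponent, where \<open>2 * K\<close> arises; their sum dominates both.\<close>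
  have "cmod (f n w * g n w) \<le> (K * K + 2 * K) * exp ((K * K + 2 * K) * (\<Sum>i\<in>I. cmod (w i)))" for n w
  proof -
    have "cmod (f n w * g n w) \<le> (K * exp (K * (\<Sum>i\<in>I. cmod (w i)))) * (K * exp (K * (\<Sum>i\<in>I. cmod (w i))))"
      unfolding norm_mult using I by (intro mult_mono) auto
    also have "\<dots> = (K * K) * exp ((2 * K) * (\<Sum>i\<in>I. cmod (w i)))"
      by (simp add: exp_add[symmetric] algebra_simps)
    also have "\<dots> \<le> (K * K + 2 * K) * exp ((K * K + 2 * K) * (\<Sum>i\<in>I. cmod (w i)))"
      using I(2) by (intro mult_mono exp_le_cancel_iff[THEN iffD2] mult_right_mono sum_nonneg) auto
    finally show ?thesis .
  qed
  then show ?thesis unfolding growth_def using I(1,2) by (intro exI[of _ I] exI[of _ "K * K + 2 * K"]) auto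
qed

lemma growth_const: "growth (\<lambda>n w. c)"
  unfolding growth_def by (intro exI[of _ "{}"] exI[of _ "cmod c"]) auto

lemma growth_le: "growth f \<Longrightarrow> (\<And>n w. cmod (g n w) \<le> cmod (f n w)) \<Longrightarrow> growth g"
  unfolding growth_def by (meson order_trans)

lemma growth_coord_exp: "c \<ge> 0 \<Longrightarrow> growth (\<lambda>n w. of_real (exp (c * cmod (w i))))"
  unfolding growth_def
proof (intro exI[of _ "{i}"] exI[of _ "max 1 c"] conjI allI)
  fix w :: "nat \<Rightarrow> complex" and n :: nat assume c: "c \<ge> 0"
  have "exp (c * cmod (w i)) \<le> exp (max 1 c * cmod (w i))" by (simp add: mult_right_mono)
  also have "\<dots> \<le> max 1 c * exp (max 1 c * cmod (w i))" by simp
  finally show "cmod (of_real (exp (c * cmod (w i)))) \<le> max 1 c * exp (max 1 c * (\<Sum>i\<in>{i}. cmod (w i)))"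
    by simp
qed auto

section \<open>The Fock space and the density of the coherent states\<close>

context gauss
begin

text \<open>The unnormalised coherent state at \<open>a\<close>, that is the reproducing kernel
  function; it is used for finitely supported \<open>a\<close>, where the exponent is an analytic
  polynomial in \<open>w\<close>.\<close>

definition E :: "(nat \<Rightarrow> complex) \<Rightarrow> hfun" where
  "E a w = exp (ip_half t w a)"

text \<open>The modulus is at most the sum of the absolute values of the real and imaginary parts,
  and the exponential of an absolute value is at most the sum of the exponentials with both signs.
  This leaves four integrable exponentials of linear functions.\<close>

lemma integrable_exp_norm_coord:
  assumes "K \<ge> 0"
  shows "integrable \<mu> (\<lambda>w. exp (K * cmod (w i)))"
proof -
  have int: "integrable \<mu> (\<lambda>w. exp (p * Re (w i) + q * Im (w i)))" for p q
  proof -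
    \<comment> \<open>The factor \<open>t i / 2\<close> cancels the weight and the doubling that
      comes from adding the conjugate.\<close>
    define a where "a = (\<lambda>j. if j = i then complex_of_real (t i / 2) * Complex p q else 0)"
    have "{j. a j \<noteq> 0} \<subseteq> {i}" by (auto simp: a_def)
    then have a: "a \<in> fin_supp" by (auto simp: fin_supp_def intro: finite_subset)
    have "ip_half t w a = w i * cnj (Complex p q) / 2" for w
      by (subst ip_half_fin_supp[of "{i}"]) (use t_pos[of i] in \<open>auto simp: a_def\<close>)
    then have "ip_half t w a + cnj (ip_half t w a) = of_real (p * Re (w i) + q * Im (w i))" for w
      by (simp add: complex_eq_iff field_simps)
    then have "integrable \<mu> (\<lambda>w. exp (complex_of_real (p * Re (w i) + q * Im (w i))))"
      using gaussian_exp_integral[OF a a] by (simp add: has_bochner_integral_iff)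
    from integrable_Re[OF this] show ?thesis unfolding exp_of_real by simp
  qed
  show ?thesis
  proof (rule Bochner_Integration.integrable_bound)
    show "integrable \<mu> (\<lambda>w. (exp (K * Re (w i) + K * Im (w i)) + exp (K * Re (w i) + (-K) * Im (w i)))
       + (exp ((-K) * Re (w i) + K * Im (w i)) + exp ((-K) * Re (w i) + (-K) * Im (w i))))"
      by (intro Bochner_Integration.integrable_add int)
    show "AE w in \<mu>. norm (exp (K * cmod (w i))) \<le> norm ((exp (K * Re (w i) + K * Im (w i)) + exp (K * Re (w i) + (-K) * Im (w i)))
       + (exp ((-K) * Re (w i) + K * Im (w i)) + exp ((-K) * Re (w i) + (-K) * Im (w i))))"
    proof (intro AE_I2)
      fix w :: "nat \<Rightarrow> complex"
      let ?x = "Re (w i)" and ?y = "Im (w i)"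
      have abs: "exp (K * \<bar>s\<bar>) \<le> exp (K * s) + exp (- K * s)" for s by (cases "s \<ge> 0") auto
      have "exp (K * cmod (w i)) \<le> exp (K * \<bar>?x\<bar>) * exp (K * \<bar>?y\<bar>)"
        using mult_left_mono[OF cmod_le[of "w i"] assms] by (simp add: exp_add[symmetric] ring_distribs)
      also have "\<dots> \<le> (exp (K * ?x) + exp (- K * ?x)) * (exp (K * ?y) + exp (- K * ?y))"
        by (intro mult_mono abs) (auto intro: add_nonneg_nonneg)
      also have "\<dots> = (exp (K * Re (w i) + K * Im (w i)) + exp (K * Re (w i) + (-K) * Im (w i)))
       + (exp ((-K) * Re (w i) + K * Im (w i)) + exp ((-K) * Re (w i) + (-K) * Im (w i)))"
        by (simp only: exp_add distrib_left distrib_right ac_simps)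
      finally show "norm (exp (K * cmod (w i))) \<le> norm ((exp (K * Re (w i) + K * Im (w i)) + exp (K * Re (w i) + (-K) * Im (w i)))
       + (exp ((-K) * Re (w i) + K * Im (w i)) + exp ((-K) * Re (w i) + (-K) * Im (w i))))"
        unfolding real_norm_def abs_exp_cancel by (rule order_trans[OF _ abs_ge_self])
    qed
  qed measurable
qed

text \<open>A sum over \<open>I\<close> is at most \<open>card I\<close> times its largest term,
  which reduces the exponential to those of single coordinates. The constant 1 in the majorant
  covers empty \<open>I\<close>.\<close>

lemma integrable_exp_growth:
  assumes I: "finite I" and K: "K \<ge> 0"
  shows "integrable \<mu> (\<lambda>w. exp (K * (\<Sum>i\<in>I. cmod (w i))))"
proof (rule Bochner_Integration.integrable_bound)
  show "integrable \<mu> (\<lambda>w. 1 + (\<Sum>i\<in>I. exp ((K * card I) * cmod (w i))))"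
    using K by (intro Bochner_Integration.integrable_add Bochner_Integration.integrable_sum integrable_exp_norm_coord) auto
  show "AE w in \<mu>. norm (exp (K * (\<Sum>i\<in>I. cmod (w i)))) \<le> norm (1 + (\<Sum>i\<in>I. exp ((K * card I) * cmod (w i))))"
  proof (intro AE_I2)
    fix w :: "nat \<Rightarrow> complex"
    have nn: "0 \<le> (\<Sum>i\<in>I. exp ((K * card I) * cmod (w i)))" by (intro sum_nonneg) auto
    have "exp (K * (\<Sum>i\<in>I. cmod (w i))) \<le> 1 + (\<Sum>i\<in>I. exp ((K * card I) * cmod (w i)))"
    proof (cases "I = {}")
      case False
      define m where "m = Max ((\<lambda>i. cmod (w i)) ` I)"
      have "m \<in> (\<lambda>i. cmod (w i)) ` I" unfolding m_def using I False by (intro Max_in) auto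
      then obtain j where j: "j \<in> I" "m = cmod (w j)" by blast
      have "(\<Sum>i\<in>I. cmod (w i)) \<le> of_nat (card I) * cmod (w j)"
        using I by (intro sum_bounded_above) (auto simp: j(2)[symmetric] m_def)
      then have "exp (K * (\<Sum>i\<in>I. cmod (w i))) \<le> exp ((K * card I) * cmod (w j))"
        using mult_left_mono[OF _ K] by (simp add: mult.assoc)
      also have "\<dots> \<le> (\<Sum>i\<in>I. exp ((K * card I) * cmod (w i)))"
        using I j(1) by (intro member_le_sum) auto
      finally show ?thesis by simp
    qed simp
    then show "norm (exp (K * (\<Sum>i\<in>I. cmod (w i)))) \<le> norm (1 + (\<Sum>i\<in>I. exp ((K * card I) * cmod (w i))))"
      using nn by simp
  qed
qed measurable

lemma growth_L2:
  assumes "growth (\<lambda>n. f)" "f \<in> borel_measurable \<mu>"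
  shows "f \<in> L2 t"
proof -
  obtain I K where I: "finite I" "K \<ge> 0" "\<And>w. cmod (f w) \<le> K * exp (K * (\<Sum>i\<in>I. cmod (w i)))"
    using assms(1) unfolding growth_def by blast
  show ?thesis
  proof (rule L2_I[OF assms(2)])
    show "integrable \<mu> (\<lambda>w. K\<^sup>2 * exp (2 * K * (\<Sum>i\<in>I. cmod (w i))))"
      using I by (intro integrable_mult_right integrable_exp_growth) auto
    show "AE w in \<mu>. (cmod (f w))\<^sup>2 \<le> K\<^sup>2 * exp (2 * K * (\<Sum>i\<in>I. cmod (w i)))"
    proof (intro AE_I2)
      fix w
      have "(cmod (f w))\<^sup>2 \<le> (K * exp (K * (\<Sum>i\<in>I. cmod (w i))))\<^sup>2" using I by (intro power_mono) auto
      then show "(cmod (f w))\<^sup>2 \<le> K\<^sup>2 * exp (2 * K * (\<Sum>i\<in>I. cmod (w i)))"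
        by (simp add: power_mult_distrib exp_double[symmetric] mult.assoc)
    qed
  qed
qed

lemma growth_limit:
  assumes g: "growth f" "growth (\<lambda>n. h)" and m: "\<And>n. f n \<in> borel_measurable \<mu>" "h \<in> borel_measurable \<mu>"
    and lim: "\<And>w. w \<in> ell2 \<Longrightarrow> (\<lambda>n. f n w) \<longlonglongrightarrow> h w"
  shows "(\<lambda>n. N (\<lambda>w. f n w - h w)) \<longlonglongrightarrow> 0"
proof -
  have "growth (\<lambda>n w. f n w + (-1) * h w)" by (intro growth_add growth_mult growth_const g)
  then obtain I K where I: "finite I" "K \<ge> 0"
    "\<And>n w. cmod (f n w + (-1) * h w) \<le> K * exp (K * (\<Sum>i\<in>I. cmod (w i)))"
    unfolding growth_def by blast
  show ?thesis
  proof (rule N_dominated_convergence[OF m])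
    show "integrable \<mu> (\<lambda>w. K\<^sup>2 * exp (2 * K * (\<Sum>i\<in>I. cmod (w i))))"
      using I by (intro integrable_mult_right integrable_exp_growth) auto
    show "AE w in \<mu>. (cmod (f n w - h w))\<^sup>2 \<le> K\<^sup>2 * exp (2 * K * (\<Sum>i\<in>I. cmod (w i)))" for n
    proof (intro AE_I2)
      fix w
      have "(cmod (f n w - h w))\<^sup>2 \<le> (K * exp (K * (\<Sum>i\<in>I. cmod (w i))))\<^sup>2"
        using I(3)[of n w] by (intro power_mono) auto
      then show "(cmod (f n w - h w))\<^sup>2 \<le> K\<^sup>2 * exp (2 * K * (\<Sum>i\<in>I. cmod (w i)))"
        by (simp add: power_mult_distrib exp_double[symmetric] mult.assoc)
    qed
    show "AE w in \<mu>. (\<lambda>n. f n w) \<longlonglongrightarrow> h w"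
      using lim by (intro AE_I2) (simp add: space_gaussian)
  qed
qed

lemma poly_growth_measurable:
  assumes "p \<in> analytic_polys"
  shows "growth (\<lambda>n. p) \<and> p \<in> borel_measurable \<mu>"
  using assms
proof (induction rule: poly_induct)
  case (monomial \<alpha>)
  have "growth (\<lambda>n w. \<Prod>i\<in>A. w i ^ \<alpha> i)" if "finite A" for A
    using that
  proof (induction A)
    case (insert j A)
    have c: "growth (\<lambda>n w. w j)"
      by (rule growth_le[OF growth_coord_exp[of 1 j]]) (auto intro: order_trans[OF _ exp_ge_add_one_self])
    have "growth (\<lambda>n w. w j ^ k)" for k
      by (induction k) (auto intro: growth_const growth_mult c)
    with insert show ?case by (auto intro: growth_mult)
  qed (simp add: growth_const)
  then show ?case using monomial by (auto simp: monomial_def[abs_def])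
qed (auto intro: growth_add growth_mult growth_const)

lemma poly_L2: "p \<in> analytic_polys \<Longrightarrow> p \<in> L2 t"
  using poly_growth_measurable growth_L2 by blast

lemma Fock_L2: "f \<in> Fock t \<Longrightarrow> f \<in> L2 t"
  by (simp add: Fock_def)

lemma poly_Fock: "p \<in> analytic_polys \<Longrightarrow> p \<in> Fock t"
  unfolding Fock_def using poly_L2 by (auto intro!: bexI[of _ p] simp: L2_norm_def)

lemma Fock_poly_approx: "f \<in> Fock t \<Longrightarrow> e > 0 \<Longrightarrow> \<exists>p\<in>analytic_polys. N (\<lambda>w. f w - p w) < e"
  unfolding Fock_def by blast

lemma Fock_closed: "f \<in> L2 t \<Longrightarrow> (\<And>e. e > 0 \<Longrightarrow> \<exists>v\<in>Fock t. N (\<lambda>w. f w - v w) < e) \<Longrightarrow> f \<in> Fock t"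
proof -
  assume f: "f \<in> L2 t" and H: "\<And>e. e > 0 \<Longrightarrow> \<exists>v\<in>Fock t. N (\<lambda>w. f w - v w) < e"
  have "\<exists>p\<in>analytic_polys. N (\<lambda>w. f w - p w) < e" if e: "e > 0" for e
  proof -
    obtain v where v: "v \<in> Fock t" "N (\<lambda>w. f w - v w) < e/2" using H[OF half_gt_zero[OF e]] by blast
    obtain p where p: "p \<in> analytic_polys" "N (\<lambda>w. v w - p w) < e/2"
      using Fock_poly_approx[OF v(1) half_gt_zero[OF e]] by blast
    have "N (\<lambda>w. f w - p w) < e"
      using N_triangle_diff[OF f Fock_L2[OF v(1)] poly_L2[OF p(1)]] v(2) p(2) by simp
    then show ?thesis using p(1) by blast
  qed
  then show ?thesis using f by (simp add: Fock_def)
qed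

lemma Fock_limit:
  assumes "\<And>n. v n \<in> Fock t" "f \<in> L2 t" "(\<lambda>n. N (\<lambda>w. v n w - f w)) \<longlonglongrightarrow> 0"
  shows "f \<in> Fock t"
proof (rule Fock_closed[OF assms(2)])
  fix e :: real assume "e > 0"
  from order_tendstoD(2)[OF assms(3) this] obtain n where "N (\<lambda>w. v n w - f w) < e"
    by (auto simp: eventually_sequentially)
  then have "N (\<lambda>w. f w - v n w) < e" using N_minus_commute[of f "v n"] by (rule ord_eq_less_trans[rotated])
  then show "\<exists>v\<in>Fock t. N (\<lambda>w. f w - v w) < e" using assms(1) by (rule bexI)
qed

lemma Fock_add:
  assumes f: "f \<in> Fock t" and g: "g \<in> Fock t"
  shows "(\<lambda>w. f w + g w) \<in> Fock t"
proof (rule Fock_closed[OF L2_add[OF Fock_L2[OF f] Fock_L2[OF g]]])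
  fix e :: real assume e: "e > 0"
  obtain p where p: "p \<in> analytic_polys" "N (\<lambda>w. f w - p w) < e/2" using Fock_poly_approx[OF f half_gt_zero[OF e]] by blast
  obtain q where q: "q \<in> analytic_polys" "N (\<lambda>w. g w - q w) < e/2" using Fock_poly_approx[OF g half_gt_zero[OF e]] by blast
  have "N (\<lambda>w. (f w + g w) - (p w + q w)) < e"
    using N_triangle[OF L2_diff[OF Fock_L2[OF f] poly_L2[OF p(1)]] L2_diff[OF Fock_L2[OF g] poly_L2[OF q(1)]]] p q
    by (simp add: algebra_simps)
  then show "\<exists>v\<in>Fock t. N (\<lambda>w. (f w + g w) - v w) < e"
    using poly_Fock[OF poly_add[OF p(1) q(1)]] by (rule bexI)
qed

lemma Fock_scale:
  assumes f: "f \<in> Fock t"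
  shows "(\<lambda>w. c * f w) \<in> Fock t"
proof (cases "c = 0")
  case True then show ?thesis using poly_Fock[OF poly_zero] by simp
next
  case False
  show ?thesis
  proof (rule Fock_closed[OF L2_scale[OF Fock_L2[OF f]]])
    fix e :: real assume e: "e > 0"
    then have "e / cmod c > 0" using False by simp
    then obtain p where p: "p \<in> analytic_polys" "N (\<lambda>w. f w - p w) < e / cmod c"
      using Fock_poly_approx[OF f] by blast
    have "N (\<lambda>w. c * f w - c * p w) = cmod c * N (\<lambda>w. f w - p w)"
      unfolding N_scale[symmetric] by (simp add: algebra_simps)
    also have "\<dots> < e" using p(2) False by (simp add: field_simps)
    finally have "N (\<lambda>w. c * f w - c * p w) < e" .
    then show "\<exists>v\<in>Fock t. N (\<lambda>w. c * f w - v w) < e"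
      using poly_Fock[OF poly_scale[OF p(1), of c]] by (rule bexI)
  qed
qed

lemma Fock_diff: "f \<in> Fock t \<Longrightarrow> g \<in> Fock t \<Longrightarrow> (\<lambda>w. f w - g w) \<in> Fock t"
  using Fock_add[of f "\<lambda>w. -1 * g w"] Fock_scale[of g "-1"] by simp

lemma Fock_zero: "(\<lambda>w. 0) \<in> Fock t"
  using poly_Fock[OF poly_zero] .

lemma closed_subspace_Fock: "closed_subspace (Fock t)"
  unfolding closed_subspace_def
proof (intro conjI ballI allI impI)
  show "Fock t \<noteq> {}" using Fock_zero by (metis empty_iff)
  show "f \<in> Fock t" if "f \<in> L2 t" "\<forall>e>0. \<exists>v\<in>Fock t. N (\<lambda>w. f w - v w) < e" for f
    using that(2) by (intro Fock_closed[OF that(1)]) simp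
qed (auto intro: Fock_L2 Fock_add Fock_scale)

lemma Fock_cong_AE: "f \<in> Fock t \<Longrightarrow> g \<in> borel_measurable \<mu> \<Longrightarrow> AE w in \<mu>. f w = g w \<Longrightarrow> g \<in> Fock t"
proof -
  assume f: "f \<in> Fock t" and g: "g \<in> borel_measurable \<mu>" and ae: "AE w in \<mu>. f w = g w"
  have L: "g \<in> L2 t" using L2_cong_AE[OF Fock_L2[OF f] g ae] .
  have "N (\<lambda>w. g w - f w) = N (\<lambda>w. 0)"
    by (rule N_cong_AE) (use g Fock_L2[OF f, THEN L2_measurable] ae in auto)
  then show ?thesis using L f by (intro Fock_closed[OF L]) (auto intro!: bexI[of _ f] simp: L2_norm_def)
qed

subsection \<open>Exponentials of linear functionals\<close>

lemma ip_half_poly: "a \<in> fin_supp \<Longrightarrow> (\<lambda>w. ip_half t w a) \<in> analytic_polys"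
proof -
  assume "a \<in> fin_supp"
  then have A: "finite {i. a i \<noteq> 0}" by (simp add: fin_supp_def)
  have "(\<lambda>w. ip_half t w a) = (\<lambda>w. \<Sum>i | a i \<noteq> 0. (cnj (a i) / t i) * w i)"
    by (subst ip_half_fin_supp[OF A]) (auto simp: mult_ac)
  moreover have "(\<lambda>w. \<Sum>i | a i \<noteq> 0. (cnj (a i) / t i) * w i) \<in> analytic_polys"
    by (rule poly_sum[OF A]) (rule poly_scale[OF poly_coord])
  ultimately show ?thesis by simp
qed

lemma growth_exp_norm:
  assumes "a \<in> fin_supp"
  shows "growth (\<lambda>n w. of_real (exp (cmod (ip_half t w a))))"
proof -
  have A: "finite {i. a i \<noteq> 0}" using assms by (simp add: fin_supp_def)
  have g: "growth (\<lambda>n w. \<Prod>i\<in>B. of_real (exp (cmod (a i) / t i * cmod (w i))))" if "finite B" for B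
    using that
  proof (induction B)
    case (insert j B)
    then show ?case using t_pos[of j] growth_coord_exp[of "cmod (a j) / t j" j]
      by (simp add: growth_mult del: times_divide_eq_left times_divide_eq_right)
  qed (simp add: growth_const)
  show ?thesis
  proof (rule growth_le[OF g[OF A]])
    fix w :: "nat \<Rightarrow> complex"
    have "cmod (ip_half t w a) \<le> (\<Sum>i | a i \<noteq> 0. cmod (w i * cnj (a i) / t i))"
      by (subst ip_half_fin_supp[OF A]) (auto intro: norm_sum)
    also have "\<dots> = (\<Sum>i | a i \<noteq> 0. cmod (a i) / t i * cmod (w i))"
      using t_pos by (intro sum.cong) (auto simp: norm_mult norm_divide less_imp_le)
    finally show "cmod (of_real (exp (cmod (ip_half t w a)))) \<le>
        cmod (\<Prod>i | a i \<noteq> 0. of_real (exp (cmod (a i) / t i * cmod (w i))))"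
      using A by (simp add: exp_sum[OF A, symmetric] prod_norm[symmetric])
  qed
qed

lemma growth_E: "a \<in> fin_supp \<Longrightarrow> growth (\<lambda>n. E a)"
  by (rule growth_le[OF growth_exp_norm]) (auto simp: E_def norm_exp complex_Re_le_cmod)

lemma measurable_ip_half: "a \<in> fin_supp \<Longrightarrow> (\<lambda>w. ip_half t w a) \<in> borel_measurable \<mu>"
  using poly_growth_measurable[OF ip_half_poly] by blast

lemma measurable_E: "a \<in> fin_supp \<Longrightarrow> E a \<in> borel_measurable \<mu>"
proof -
  assume "a \<in> fin_supp"
  then have [measurable]: "(\<lambda>w. ip_half t w a) \<in> borel_measurable \<mu>" by (rule measurable_ip_half)
  show ?thesis unfolding E_def[abs_def] by measurable
qed

lemma E_L2: "a \<in> fin_supp \<Longrightarrow> E a \<in> L2 t"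
  by (intro growth_L2 growth_E measurable_E)

text \<open>The Taylor sums of the exponential are analytic polynomials, and all of them are
  dominated by the exponential of the modulus of the exponent.\<close>

lemma E_Fock:
  assumes a: "a \<in> fin_supp"
  shows "E a \<in> Fock t"
proof -
  define S where "S n w = (\<Sum>k<n. (1 / fact k) * ip_half t w a ^ k)" for n w
  have S: "S n \<in> analytic_polys" for n
    unfolding S_def[abs_def]
    by (rule poly_sum[OF finite_lessThan]) (rule poly_scale[OF poly_power[OF ip_half_poly[OF a]]])
  have g: "growth S"
  proof (rule growth_le[OF growth_exp_norm[OF a]])
    fix n w
    have "cmod (S n w) \<le> (\<Sum>k<n. cmod ((1 / fact k) * ip_half t w a ^ k))" unfolding S_def by (rule norm_sum)
    also have "\<dots> = (\<Sum>k<n. (cmod (ip_half t w a)) ^ k /\<^sub>R fact k)"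
      by (intro sum.cong) (auto simp: norm_mult norm_power norm_divide field_simps)
    also have "\<dots> \<le> exp (cmod (ip_half t w a))"
      unfolding exp_def by (intro sum_le_suminf summable_exp_generic) auto
    finally show "cmod (S n w) \<le> cmod (of_real (exp (cmod (ip_half t w a))))" by simp
  qed
  have "(\<lambda>n. S n w) \<longlonglongrightarrow> E a w" for w
    using exp_converges[of "ip_half t w a"] unfolding sums_def S_def E_def by (simp add: scaleR_conv_of_real divide_inverse)
  then have lim: "(\<lambda>n. N (\<lambda>w. S n w - E a w)) \<longlonglongrightarrow> 0"
    by (rule growth_limit[OF g growth_E[OF a] conjunct2[OF poly_growth_measurable[OF S]] measurable_E[OF a]])
  show ?thesis by (rule Fock_limit[OF poly_Fock[OF S] E_L2[OF a] lim])
qed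

text \<open>The linear span of the coherent states, given inductively so that identities can be
  checked on generators. Because exponents add, it is also closed under products.\<close>

inductive_set Espan :: "hfun set" where
  base: "a \<in> fin_supp \<Longrightarrow> E a \<in> Espan"
| add: "f \<in> Espan \<Longrightarrow> g \<in> Espan \<Longrightarrow> (\<lambda>w. f w + g w) \<in> Espan"
| scale: "f \<in> Espan \<Longrightarrow> (\<lambda>w. c * f w) \<in> Espan"

lemma Espan_Fock: "f \<in> Espan \<Longrightarrow> f \<in> Fock t"
  by (induction rule: Espan.induct) (auto intro: E_Fock Fock_add Fock_scale)

lemma fin_supp_add: "a \<in> fin_supp \<Longrightarrow> b \<in> fin_supp \<Longrightarrow> (\<lambda>i. a i + b i) \<in> fin_supp"
  unfolding fin_supp_def by (auto intro: finite_subset[of _ "{i. a i \<noteq> 0} \<union> {i. b i \<noteq> 0}"])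

lemma ip_half_add_fin_supp:
  assumes "a \<in> fin_supp" "b \<in> fin_supp"
  shows "ip_half t w (\<lambda>i. a i + b i) = ip_half t w a + ip_half t w b"
proof -
  let ?S = "{i. a i \<noteq> 0} \<union> {i. b i \<noteq> 0}"
  have S: "finite ?S" using assms by (auto simp: fin_supp_def)
  have "ip_half t w a = (\<Sum>i\<in>?S. w i * cnj (a i) / t i)" "ip_half t w b = (\<Sum>i\<in>?S. w i * cnj (b i) / t i)"
    "ip_half t w (\<lambda>i. a i + b i) = (\<Sum>i\<in>?S. w i * cnj (a i + b i) / t i)"
    by (rule ip_half_fin_supp[OF S]; auto)+
  then show ?thesis by (simp add: sum.distrib ring_distribs add_divide_distrib)
qed

lemma E_mult: "a \<in> fin_supp \<Longrightarrow> b \<in> fin_supp \<Longrightarrow> E a w * E b w = E (\<lambda>i. a i + b i) w"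
  unfolding E_def by (simp add: ip_half_add_fin_supp exp_add)

lemma Espan_mult:
  assumes "f \<in> Espan" "g \<in> Espan"
  shows "(\<lambda>w. f w * g w) \<in> Espan"
  using assms(1)
proof induction
  case (base a)
  show ?case using assms(2)
  proof induction
    case (base b)
    have "(\<lambda>w. E a w * E b w) = E (\<lambda>i. a i + b i)"
      by (rule ext) (rule E_mult[OF \<open>a \<in> fin_supp\<close> base])
    then show ?case using Espan.base[OF fin_supp_add[OF \<open>a \<in> fin_supp\<close> base]] by simp
  next
    case (add f g) then show ?case using Espan.add by (simp add: ring_distribs)
  next
    case (scale f c) then show ?case using Espan.scale[of "\<lambda>w. E a w * f w" c] by (simp add: mult_ac)
  qed
next
  case (add f g) then show ?case using Espan.add by (simp add: ring_distribs)
next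
  case (scale f c) then show ?case using Espan.scale[of "\<lambda>w. f w * g w" c] by (simp add: mult_ac)
qed

lemma Espan_const: "(\<lambda>w. c) \<in> Espan"
proof -
  have "E (\<lambda>_. 0) = (\<lambda>w. 1)" by (auto simp: E_def ip_half_def)
  then show ?thesis using Espan.scale[OF Espan.base[of "\<lambda>_. 0"], of c] by (simp add: fin_supp_def)
qed

text \<open>A coordinate is the derivative at 0 of an exponential, hence a limit of difference
  quotients lying in \<open>Espan\<close>. Since both \<open>Espan\<close> and the growth condition
  are stable under sums and products, all polynomials follow.\<close>

lemma poly_approx_growth:
  assumes "p \<in> analytic_polys"
  shows "\<exists>L. (\<forall>n. L n \<in> Espan) \<and> growth L \<and> (\<forall>w. (\<lambda>n. L n w) \<longlonglongrightarrow> p w)" (is "?A p")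
proof -
  have mult: "?A (\<lambda>w. p w * q w)" if "?A p" "?A q" for p q
  proof -
    obtain L where L: "\<forall>n. L n \<in> Espan" "growth L" "\<forall>w. (\<lambda>n. L n w) \<longlonglongrightarrow> p w" using \<open>?A p\<close> by auto
    obtain L' where L': "\<forall>n. L' n \<in> Espan" "growth L'" "\<forall>w. (\<lambda>n. L' n w) \<longlonglongrightarrow> q w" using \<open>?A q\<close> by auto
    show ?thesis
    proof (intro exI[of _ "\<lambda>n w. L n w * L' n w"] conjI allI)
      show "(\<lambda>w. L n w * L' n w) \<in> Espan" for n by (rule Espan_mult[OF L(1)[rule_format] L'(1)[rule_format]])
      show "growth (\<lambda>n w. L n w * L' n w)" by (rule growth_mult[OF L(2) L'(2)])
      show "(\<lambda>n. L n w * L' n w) \<longlonglongrightarrow> p w * q w" for w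
        by (rule tendsto_mult[OF L(3)[rule_format] L'(3)[rule_format]])
    qed
  qed
  have add': "?A (\<lambda>w. p w + q w)" if "?A p" "?A q" for p q
  proof -
    obtain L where L: "\<forall>n. L n \<in> Espan" "growth L" "\<forall>w. (\<lambda>n. L n w) \<longlonglongrightarrow> p w" using \<open>?A p\<close> by auto
    obtain L' where L': "\<forall>n. L' n \<in> Espan" "growth L'" "\<forall>w. (\<lambda>n. L' n w) \<longlonglongrightarrow> q w" using \<open>?A q\<close> by auto
    show ?thesis
    proof (intro exI[of _ "\<lambda>n w. L n w + L' n w"] conjI allI)
      show "(\<lambda>w. L n w + L' n w) \<in> Espan" for n by (rule Espan.add[OF L(1)[rule_format] L'(1)[rule_format]])
      show "growth (\<lambda>n w. L n w + L' n w)" by (rule growth_add[OF L(2) L'(2)])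
      show "(\<lambda>n. L n w + L' n w) \<longlonglongrightarrow> p w + q w" for w
        by (rule tendsto_add[OF L(3)[rule_format] L'(3)[rule_format]])
    qed
  qed
  have const: "?A (\<lambda>w. c)" for c
    by (rule exI[of _ "\<lambda>n w. c"]) (simp add: Espan_const growth_const)
  have coord: "?A (\<lambda>w. w i)" for i
  proof -
    define \<epsilon> where "\<epsilon> n = inverse (real (Suc n))" for n
    have \<epsilon>: "\<epsilon> n > 0" "\<epsilon> n \<le> 1" for n by (auto simp: \<epsilon>_def inverse_le_1_iff)
    have \<epsilon>0: "\<epsilon> \<longlonglongrightarrow> 0" unfolding \<epsilon>_def by (rule LIMSEQ_inverse_real_of_nat)
    define L where "L n w = (1 / complex_of_real (\<epsilon> n)) * (exp (complex_of_real (\<epsilon> n) * w i) + (-1))" for n and w :: "nat \<Rightarrow> complex"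
    have "L n \<in> Espan" for n
    proof -
      \<comment> \<open>Chosen so that the pairing with \<open>w\<close> is exactly \<epsilon> times
        the coordinate \<open>w i\<close>.\<close>
      define a where "a = (\<lambda>j. if j = i then complex_of_real (t i * \<epsilon> n) else 0)"
      have "{j. a j \<noteq> 0} \<subseteq> {i}" by (auto simp: a_def)
      then have a: "a \<in> fin_supp" by (auto simp: fin_supp_def intro: finite_subset)
      have "ip_half t w a = complex_of_real (\<epsilon> n) * w i" for w
        by (subst ip_half_fin_supp[of "{i}"]) (use t_pos[of i] in \<open>auto simp: a_def\<close>)
      then have "L n = (\<lambda>w. (1 / complex_of_real (\<epsilon> n)) * (E a w + (-1)))" by (auto simp: L_def E_def)
      then show ?thesis
        using Espan.scale[OF Espan.add[OF Espan.base[OF a] Espan_const[of "-1"]], of "1 / complex_of_real (\<epsilon> n)"]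
        by (simp only:)
    qed
    moreover have "growth L"
    proof (rule growth_le[OF growth_coord_exp[of 2 i]])
      fix n and w :: "nat \<Rightarrow> complex"
      let ?z = "complex_of_real (\<epsilon> n) * w i"
      \<comment> \<open>Taylor's formula of order 0 removes the division by \<epsilon>: the quotient
        is at most the modulus times its exponential, hence at most
        \<open>exp (2 * cmod (w i))\<close> for every \<open>n\<close>.\<close>
      have "cmod (exp ?z - (\<Sum>k\<le>0. ?z ^ k / fact k)) \<le> exp \<bar>Re ?z\<bar> * cmod ?z ^ Suc 0 / fact 0"
        by (rule Taylor_exp)
      then have "cmod (exp ?z - 1) \<le> exp \<bar>Re ?z\<bar> * cmod ?z" by simp
      also have "\<dots> \<le> exp (cmod (w i)) * cmod ?z"
      proof -
        have "\<bar>Re ?z\<bar> \<le> cmod ?z" by (rule abs_Re_le_cmod)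
        also have "\<dots> \<le> cmod (w i)" using \<epsilon>[of n] by (simp add: norm_mult mult_left_le_one_le)
        finally show ?thesis by (intro mult_right_mono) auto
      qed
      finally have "cmod (exp ?z - 1) \<le> exp (cmod (w i)) * cmod ?z" .
      then have "cmod (L n w) \<le> exp (cmod (w i)) * cmod (w i)"
        using \<epsilon>[of n] by (simp add: L_def norm_mult norm_divide field_simps)
      also have "\<dots> \<le> exp (cmod (w i)) * exp (cmod (w i))"
        using exp_ge_add_one_self[of "cmod (w i)"] by (intro mult_left_mono) (linarith, simp)
      also have "\<dots> = exp (2 * cmod (w i))" by (simp add: exp_add[symmetric])
      finally show "cmod (L n w) \<le> cmod (complex_of_real (exp (2 * cmod (w i))))" by simp
    qed simp
    moreover have "(\<lambda>n. L n w) \<longlonglongrightarrow> w i" for w :: "nat \<Rightarrow> complex"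
    proof -
      \<comment> \<open>The approximants are the difference quotients of this function at 0 with
        increments \<epsilon>.\<close>
      have d: "((\<lambda>z. exp (z * w i)) has_field_derivative w i) (at 0)"
        by (auto intro!: derivative_eq_intros)
      have "(\<lambda>n. complex_of_real (\<epsilon> n)) \<longlonglongrightarrow> 0" using tendsto_of_real[OF \<epsilon>0, where 'a=complex] by simp
      then have "filterlim (\<lambda>n. complex_of_real (\<epsilon> n)) (at 0) sequentially"
        using \<epsilon>(1) by (intro filterlim_atI) (auto intro!: always_eventually simp: less_imp_neq[symmetric])
      from filterlim_compose[OF d[unfolded has_field_derivative_iff] this] show ?thesis
        by (simp add: L_def)
    qed
    ultimately show ?thesis by (intro exI[of _ L]) auto
  qed
  show ?thesis using assms
  proof (induction rule: poly_induct)
    case zero show ?case by (rule const)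
  next
    case (add p q) from add' [OF add] show ?case .
  next
    case (scale c p) show ?case by (rule mult[OF const scale])
  next
    case (monomial \<alpha>)
    have "?A (\<lambda>w. \<Prod>i\<in>B. w i ^ \<alpha> i)" if "finite B" for B
      using that
    proof (induction B)
      case (insert j B)
      have "?A (\<lambda>w. w j ^ k)" for k
      proof (induction k)
        case (Suc k) show ?case using mult[OF coord[of j] Suc] by (simp only: power_Suc)
      qed (simp add: const)
      from mult[OF this insert.IH] show ?case by (simp only: prod.insert[OF insert.hyps])
    qed (simp add: const)
    from this[OF monomial] show ?case by (simp only: monomial_def[abs_def])
  qed
qed

text \<open>Convergence at every point is kept along with convergence in norm, because the Weyl
  formula evaluates the approximants at shifted arguments.\<close>

lemma poly_approx:
  assumes "p \<in> analytic_polys"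
  shows "\<exists>L. (\<forall>n. L n \<in> Espan) \<and> (\<forall>w. (\<lambda>n. L n w) \<longlonglongrightarrow> p w) \<and>
    (\<lambda>n. N (\<lambda>w. L n w - p w)) \<longlonglongrightarrow> 0"
proof -
  obtain L where L: "\<And>n. L n \<in> Espan" "growth L" "\<And>w. (\<lambda>n. L n w) \<longlonglongrightarrow> p w"
    using poly_approx_growth[OF assms] by blast
  have "(\<lambda>n. N (\<lambda>w. L n w - p w)) \<longlonglongrightarrow> 0"
    by (rule growth_limit[OF L(2) _ L2_measurable[OF Fock_L2[OF Espan_Fock[OF L(1)]]] _ L(3)])
      (simp_all add: poly_growth_measurable[OF assms])
  with L show ?thesis by (intro exI[of _ L] conjI allI)
qed

lemma Espan_dense:
  assumes "f \<in> Fock t" "e > 0"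
  shows "\<exists>g\<in>Espan. N (\<lambda>w. f w - g w) < e"
proof -
  obtain p where p: "p \<in> analytic_polys" "N (\<lambda>w. f w - p w) < e/2"
    using Fock_poly_approx[OF assms(1) half_gt_zero[OF assms(2)]] by blast
  obtain L where L: "\<And>n. L n \<in> Espan" "\<And>w. (\<lambda>n. L n w) \<longlonglongrightarrow> p w"
    "(\<lambda>n. N (\<lambda>w. L n w - p w)) \<longlonglongrightarrow> 0"
    using poly_approx[OF p(1)] by blast
  from order_tendstoD(2)[OF L(3) half_gt_zero[OF assms(2)]] obtain n where n: "N (\<lambda>w. L n w - p w) < e/2"
    by (auto simp: eventually_sequentially)
  have "N (\<lambda>w. f w - L n w) < e"
    using N_triangle_diff[OF Fock_L2[OF assms(1)] poly_L2[OF p(1)] Espan_Fock[OF L(1)[of n], THEN Fock_L2]]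
      p(2) n N_minus_commute[of p "L n"] by simp
  then show ?thesis using L(1) by (rule bexI)
qed

end

section \<open>The weighted inner product and its norm; truncations\<close>

definition trunc :: "nat \<Rightarrow> (nat \<Rightarrow> complex) \<Rightarrow> nat \<Rightarrow> complex" where
  "trunc n z i = (if i < n then z i else 0)"

lemma trunc_fin_supp: "trunc n z \<in> fin_supp"
  unfolding fin_supp_def trunc_def by (auto intro: finite_subset[of _ "{..<n}"])

lemma trunc_add: "trunc n (\<lambda>i. a i + b i) = (\<lambda>i. trunc n a i + trunc n b i)"
  by (auto simp: trunc_def)

lemma trunc_scale: "trunc n (\<lambda>i. c * a i) = (\<lambda>i. c * trunc n a i)"
  by (auto simp: trunc_def)

context gauss
begin

text \<open>Infinite sums are total, so the algebraic rules for \<open>ip_half\<close> are stated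
  under this condition. It is supplied in three situations: finite support on the right, both
  arguments in \<open>H_half t\<close>, or \<open>ell2\<close> paired with
  \<open>H_one t\<close>.\<close>

definition ip_summable :: "(nat \<Rightarrow> complex) \<Rightarrow> (nat \<Rightarrow> complex) \<Rightarrow> bool" where
  "ip_summable z w \<longleftrightarrow> summable (\<lambda>n. z n * cnj (w n) / complex_of_real (t n))"

lemma ip_half_add_left: "ip_summable a c \<Longrightarrow> ip_summable b c \<Longrightarrow>
    ip_half t (\<lambda>i. a i + b i) c = ip_half t a c + ip_half t b c"
  unfolding ip_half_def ip_summable_def by (subst suminf_add) (auto simp: ring_distribs add_divide_distrib)

lemma ip_half_diff_left: "ip_summable a c \<Longrightarrow> ip_summable b c \<Longrightarrow>
    ip_half t (\<lambda>i. a i - b i) c = ip_half t a c - ip_half t b c"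
  unfolding ip_half_def ip_summable_def by (subst suminf_diff) (auto simp: ring_distribs diff_divide_distrib)

lemma ip_half_add_right: "ip_summable c a \<Longrightarrow> ip_summable c b \<Longrightarrow>
    ip_half t c (\<lambda>i. a i + b i) = ip_half t c a + ip_half t c b"
  unfolding ip_half_def ip_summable_def by (subst suminf_add) (auto simp: ring_distribs add_divide_distrib)

lemma ip_half_diff_right: "ip_summable c a \<Longrightarrow> ip_summable c b \<Longrightarrow>
    ip_half t c (\<lambda>i. a i - b i) = ip_half t c a - ip_half t c b"
  unfolding ip_half_def ip_summable_def by (subst suminf_diff) (auto simp: ring_distribs diff_divide_distrib)

lemma ip_half_scale_right: "ip_summable a b \<Longrightarrow> ip_half t a (\<lambda>i. c * b i) = cnj c * ip_half t a b"
  unfolding ip_half_def ip_summable_def by (subst suminf_mult[symmetric]) (auto simp: mult_ac)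

lemma ip_half_cnj: "ip_summable a b \<Longrightarrow> cnj (ip_half t a b) = ip_half t b a"
  unfolding ip_half_def ip_summable_def
  by (subst bounded_linear.suminf[OF bounded_linear_cnj]) (auto simp: mult_ac)

lemma ip_summable_fin_supp: "b \<in> fin_supp \<Longrightarrow> ip_summable a b"
  unfolding ip_summable_def fin_supp_def by (auto intro!: summable_finite[of "{i. b i \<noteq> 0}"])

text \<open>The sequence \<open>t\<close> tends to zero and is therefore bounded, so weighted square
  summability already implies membership in \<open>ell2\<close>.\<close>

lemma H_half_iff: "z \<in> H_half t \<longleftrightarrow> summable (\<lambda>n. (cmod (z n))\<^sup>2 / t n)"
proof -
  have bnd: "\<exists>T. \<forall>n. t n \<le> T"
  proof -
    have "t \<longlonglongrightarrow> 0" using summable_LIMSEQ_zero[OF t_summable] .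
    then have "Bseq t" by (intro convergent_imp_Bseq) (auto simp: convergent_def)
    then obtain T where "\<And>n. norm (t n) \<le> T" by (auto simp: Bseq_def)
    then show ?thesis by (intro exI[of _ T]) (auto intro: order_trans[OF abs_ge_self])
  qed
  then obtain T where T: "\<And>n. t n \<le> T" by blast
  have "z \<in> ell2" if "summable (\<lambda>n. (cmod (z n))\<^sup>2 / t n)"
    unfolding ell2_def
  proof (rule CollectI, rule summable_comparison_test'[OF summable_mult[OF that, of T], of 0])
    fix n
    have "(cmod (z n))\<^sup>2 = t n * ((cmod (z n))\<^sup>2 / t n)" using t_pos[of n] by simp
    also have "\<dots> \<le> T * ((cmod (z n))\<^sup>2 / t n)"
      using t_pos[of n] T[of n] by (intro mult_right_mono) auto
    finally show "norm ((cmod (z n))\<^sup>2) \<le> T * ((cmod (z n))\<^sup>2 / t n)" by simp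
  qed
  then show ?thesis by (auto simp: H_half_def)
qed

text \<open>The weight \<open>1 / t n\<close> lies below \<open>1 + 1 / (t n)\<close> squared, by
  the inequality between arithmetic and geometric means.\<close>

lemma H_one_subset_H_half: "H_one t \<subseteq> H_half t"
proof
  fix z assume z: "z \<in> H_one t"
  have s: "summable (\<lambda>n. (cmod (z n))\<^sup>2 + (cmod (z n))\<^sup>2 / (t n)\<^sup>2)"
    using z by (intro summable_add) (auto simp: H_one_def ell2_def)
  have "summable (\<lambda>n. (cmod (z n))\<^sup>2 / t n)"
  proof (rule summable_comparison_test'[OF s, of 0])
    fix n
    have "1 / t n \<le> 1 + 1 / (t n)\<^sup>2"
    proof -
      have "1 / t n \<le> 2 * 1 * (1 / t n)" using t_pos[of n] by (simp add: divide_right_mono)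
      also have "\<dots> \<le> 1 + 1 / (t n)\<^sup>2" using sum_squares_bound[of 1 "1 / t n"] by (simp add: power_divide)
      finally show ?thesis .
    qed
    then have "(cmod (z n))\<^sup>2 * (1 / t n) \<le> (cmod (z n))\<^sup>2 * (1 + 1 / (t n)\<^sup>2)"
      by (intro mult_left_mono) auto
    then show "norm ((cmod (z n))\<^sup>2 / t n) \<le> (cmod (z n))\<^sup>2 + (cmod (z n))\<^sup>2 / (t n)\<^sup>2"
      using t_pos[of n] by (simp add: ring_distribs)
  qed
  then show "z \<in> H_half t" by (simp add: H_half_iff)
qed

lemma fin_supp_subset_H_one: "fin_supp \<subseteq> H_one t"
  unfolding H_one_def ell2_def fin_supp_def
  by (auto intro!: summable_finite[of "{i. _ i \<noteq> 0}"])

lemma fin_supp_H_half: "a \<in> fin_supp \<Longrightarrow> a \<in> H_half t"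
  using fin_supp_subset_H_one H_one_subset_H_half by blast

lemma H_half_add:
  assumes "a \<in> H_half t" "b \<in> H_half t"
  shows "(\<lambda>i. a i + b i) \<in> H_half t"
  unfolding H_half_iff
proof (rule summable_comparison_test'[of "\<lambda>n. 2 * ((cmod (a n))\<^sup>2 / t n) + 2 * ((cmod (b n))\<^sup>2 / t n)" 0])
  show "summable (\<lambda>n. 2 * ((cmod (a n))\<^sup>2 / t n) + 2 * ((cmod (b n))\<^sup>2 / t n))"
    using assms by (intro summable_add summable_mult) (auto simp: H_half_iff)
  show "norm ((cmod (a n + b n))\<^sup>2 / t n) \<le> 2 * ((cmod (a n))\<^sup>2 / t n) + 2 * ((cmod (b n))\<^sup>2 / t n)" for n
    using divide_right_mono[OF cmod_add_sq_le[of "a n" "b n"], of "t n"] t_pos[of n]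
    by (simp add: add_divide_distrib)
qed

lemma H_half_scale: "a \<in> H_half t \<Longrightarrow> (\<lambda>i. c * a i) \<in> H_half t"
  unfolding H_half_iff using summable_mult[of "\<lambda>n. (cmod (a n))\<^sup>2 / t n" "(cmod c)\<^sup>2"]
  by (simp add: norm_mult power_mult_distrib)

lemma H_half_diff: "a \<in> H_half t \<Longrightarrow> b \<in> H_half t \<Longrightarrow> (\<lambda>i. a i - b i) \<in> H_half t"
  using H_half_add[of a "\<lambda>i. -1 * b i"] H_half_scale[of b "-1"] by simp

lemma ip_summable_norm_H_half:
  assumes "a \<in> H_half t" "b \<in> H_half t"
  shows "summable (\<lambda>n. cmod (a n * cnj (b n) / complex_of_real (t n)))"
proof (rule summable_comparison_test'[of "\<lambda>n. (cmod (a n))\<^sup>2 / t n + (cmod (b n))\<^sup>2 / t n" 0])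
  show "summable (\<lambda>n. (cmod (a n))\<^sup>2 / t n + (cmod (b n))\<^sup>2 / t n)"
    using assms by (intro summable_add) (auto simp: H_half_iff)
  fix n
  have "cmod (a n) * cmod (b n) \<le> (cmod (a n))\<^sup>2 + (cmod (b n))\<^sup>2"
    using sum_squares_bound[of "cmod (a n)" "cmod (b n)"]
      mult_nonneg_nonneg[OF norm_ge_zero norm_ge_zero, of "a n" "b n"] by linarith
  from divide_right_mono[OF this, of "t n"] show "norm (cmod (a n * cnj (b n) / complex_of_real (t n))) \<le> (cmod (a n))\<^sup>2 / t n + (cmod (b n))\<^sup>2 / t n"
    using t_pos[of n] by (simp add: norm_mult norm_divide add_divide_distrib)
qed

lemma ip_summable_H_half: "a \<in> H_half t \<Longrightarrow> b \<in> H_half t \<Longrightarrow> ip_summable a b"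
  unfolding ip_summable_def by (rule summable_norm_cancel) (rule ip_summable_norm_H_half)

text \<open>The whole weight is given to \<open>b\<close>, which stays square summable after
  division by \<open>t\<close>; therefore the pairing exists at each point of \<open>ell2\<close>,
  not just almost everywhere.\<close>

lemma ip_summable_ell2_H_one:
  assumes "a \<in> ell2" "b \<in> H_one t"
  shows "ip_summable a b"
  unfolding ip_summable_def
proof (rule summable_comparison_test'[of "\<lambda>n. (cmod (a n))\<^sup>2 + (cmod (b n))\<^sup>2 / (t n)\<^sup>2" 0])
  show "summable (\<lambda>n. (cmod (a n))\<^sup>2 + (cmod (b n))\<^sup>2 / (t n)\<^sup>2)"
    using assms by (intro summable_add) (auto simp: H_one_def ell2_def)
  fix n
  have "cmod (a n) * (cmod (b n) / t n) \<le> (cmod (a n))\<^sup>2 + (cmod (b n) / t n)\<^sup>2"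
    using sum_squares_bound[of "cmod (a n)" "cmod (b n) / t n"]
      mult_nonneg_nonneg[OF norm_ge_zero divide_nonneg_pos[OF norm_ge_zero t_pos[of n]], of "a n" "b n"]
    by linarith
  then show "norm (a n * cnj (b n) / complex_of_real (t n)) \<le> (cmod (a n))\<^sup>2 + (cmod (b n))\<^sup>2 / (t n)\<^sup>2"
    using t_pos[of n] by (simp add: norm_mult norm_divide power_divide)
qed

lemma ip_half_self: "a \<in> H_half t \<Longrightarrow> ip_half t a a = of_real (\<Sum>n. (cmod (a n))\<^sup>2 / t n)"
proof -
  assume "a \<in> H_half t"
  then have "summable (\<lambda>n. (cmod (a n))\<^sup>2 / t n)" by (simp add: H_half_iff)
  then have "(\<Sum>n. complex_of_real ((cmod (a n))\<^sup>2 / t n)) = of_real (\<Sum>n. (cmod (a n))\<^sup>2 / t n)"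
    by (rule suminf_of_real[symmetric])
  then show ?thesis unfolding ip_half_def by (simp only: of_real_divide complex_norm_square)
qed

abbreviation "nh \<equiv> norm_half t"

lemma nh_power2: "a \<in> H_half t \<Longrightarrow> (nh a)\<^sup>2 = (\<Sum>n. (cmod (a n))\<^sup>2 / t n)"
  unfolding norm_half_def using t_pos
  by (subst ip_half_self) (auto intro!: suminf_nonneg simp: H_half_iff less_imp_le)

lemma nh_sqrt: "a \<in> H_half t \<Longrightarrow> nh a = sqrt (\<Sum>n. (cmod (a n))\<^sup>2 / t n)"
  unfolding norm_half_def by (subst ip_half_self) auto

lemma ip_half_nh: "a \<in> H_half t \<Longrightarrow> ip_half t a a = of_real ((nh a)\<^sup>2)"
  by (simp only: nh_power2 ip_half_self)

lemma nh_nonneg: "a \<in> H_half t \<Longrightarrow> nh a \<ge> 0"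
  using t_pos by (auto simp: nh_sqrt H_half_iff less_imp_le intro!: suminf_nonneg)

lemma ip_half_Cauchy_Schwarz:
  assumes a: "a \<in> H_half t" and b: "b \<in> H_half t"
  shows "cmod (ip_half t a b) \<le> nh a * nh b"
proof -
  note s = ip_summable_norm_H_half[OF a b]
  have "cmod (ip_half t a b) \<le> (\<Sum>n. cmod (a n * cnj (b n) / complex_of_real (t n)))"
    unfolding ip_half_def by (rule summable_norm[OF s])
  also have "\<dots> \<le> nh a * nh b"
  proof (rule suminf_le_const[OF s])
    fix k
    let ?f = "\<lambda>z n. cmod (z n) / sqrt (t n)"
    have L: "L2_set (?f z) {..<k} \<le> nh z" if z: "z \<in> H_half t" for z
    proof -
      have "(\<Sum>n<k. (?f z n)\<^sup>2) \<le> (\<Sum>n. (cmod (z n))\<^sup>2 / t n)"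
        using z t_pos by (simp add: power_divide less_imp_le) (intro sum_le_suminf, auto simp: H_half_iff less_imp_le)
      then show ?thesis unfolding L2_set_def nh_sqrt[OF z] by (rule real_sqrt_le_mono)
    qed
    have "(\<Sum>n<k. cmod (a n * cnj (b n) / complex_of_real (t n))) = (\<Sum>n<k. \<bar>?f a n\<bar> * \<bar>?f b n\<bar>)"
      using t_pos by (intro sum.cong) (auto simp: norm_mult norm_divide less_imp_le)
    also have "\<dots> \<le> L2_set (?f a) {..<k} * L2_set (?f b) {..<k}" by (rule L2_set_mult_ineq)
    also have "\<dots> \<le> nh a * nh b" using L a b nh_nonneg by (intro mult_mono) auto
    finally show "(\<Sum>n<k. cmod (a n * cnj (b n) / complex_of_real (t n))) \<le> nh a * nh b" .
  qed
  finally show ?thesis .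
qed

lemma nh_triangle:
  assumes a: "a \<in> H_half t" and b: "b \<in> H_half t"
  shows "nh (\<lambda>i. a i + b i) \<le> nh a + nh b"
proof -
  note ab = H_half_add[OF a b] and s = ip_summable_H_half
  have "of_real ((nh (\<lambda>i. a i + b i))\<^sup>2) = ip_half t (\<lambda>i. a i + b i) (\<lambda>i. a i + b i)"
    by (simp only: ip_half_nh[OF ab])
  also have "\<dots> = ip_half t a a + ip_half t a b + (ip_half t b a + ip_half t b b)"
    by (simp add: ip_half_add_left[OF s[OF a ab] s[OF b ab]] ip_half_add_right s a b)
  also have "ip_half t b a = cnj (ip_half t a b)" by (simp add: ip_half_cnj s a b)
  finally have "(nh (\<lambda>i. a i + b i))\<^sup>2 = Re (ip_half t a a + ip_half t a b + (cnj (ip_half t a b) + ip_half t b b))"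
    by (metis Re_complex_of_real)
  also have "\<dots> = (nh a)\<^sup>2 + 2 * Re (ip_half t a b) + (nh b)\<^sup>2"
    by (simp add: ip_half_nh a b)
  also have "\<dots> \<le> (nh a + nh b)\<^sup>2"
    using order_trans[OF complex_Re_le_cmod ip_half_Cauchy_Schwarz[OF a b]] by (simp add: power2_sum)
  finally show ?thesis by (rule power2_le_imp_le) (simp add: nh_nonneg a b)
qed

lemma nh_scale:
  assumes a: "a \<in> H_half t"
  shows "nh (\<lambda>i. c * a i) = cmod c * nh a"
proof -
  have "(\<Sum>n. (cmod (c * a n))\<^sup>2 / t n) = (cmod c)\<^sup>2 * (\<Sum>n. (cmod (a n))\<^sup>2 / t n)"
    using a by (subst suminf_mult[symmetric]) (auto simp: H_half_iff norm_mult power_mult_distrib)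
  then show ?thesis by (simp add: nh_sqrt a H_half_scale real_sqrt_mult)
qed

lemma nh_minus_commute: "nh (\<lambda>i. a i - b i) = nh (\<lambda>i. b i - a i)"
proof -
  have "(a n - b n) * cnj (a n - b n) = (b n - a n) * cnj (b n - a n)" for n by (simp add: algebra_simps)
  then show ?thesis unfolding norm_half_def ip_half_def by simp
qed

lemma nh_triangle_diff:
  assumes "a \<in> H_half t" "b \<in> H_half t" "c \<in> H_half t"
  shows "nh (\<lambda>i. a i - c i) \<le> nh (\<lambda>i. a i - b i) + nh (\<lambda>i. b i - c i)"
  using nh_triangle[OF H_half_diff[OF assms(1,2)] H_half_diff[OF assms(2,3)]] by simp

lemma nh_trunc_limit:
  assumes z: "z \<in> H_half t"
  shows "(\<lambda>n. nh (\<lambda>i. trunc n z i - z i)) \<longlonglongrightarrow> 0"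
proof -
  let ?f = "\<lambda>i. (cmod (z i))\<^sup>2 / t i"
  have s: "summable ?f" using z by (simp add: H_half_iff)
  have "(\<Sum>i. (cmod (trunc n z i - z i))\<^sup>2 / t i) = suminf ?f - (\<Sum>i<n. ?f i)" for n
  proof -
    have "(\<lambda>i. (cmod (trunc n z i - z i))\<^sup>2 / t i) = (\<lambda>i. ?f i - (if i \<in> {..<n} then ?f i else 0))"
      by (auto simp: trunc_def)
    moreover have "(\<lambda>i. if i \<in> {..<n} then ?f i else 0) sums (\<Sum>i<n. ?f i)" by (rule sums_If_finite_set) simp
    ultimately show ?thesis using sums_diff[OF summable_sums[OF s]] by (auto simp: sums_iff)
  qed
  then have "nh (\<lambda>i. trunc n z i - z i) = sqrt (suminf ?f - (\<Sum>i<n. ?f i))" for n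
    by (subst nh_sqrt) (auto intro: H_half_diff z fin_supp_H_half trunc_fin_supp)
  moreover have "(\<lambda>n. sqrt (suminf ?f - (\<Sum>i<n. ?f i))) \<longlonglongrightarrow> sqrt (suminf ?f - suminf ?f)"
    by (intro tendsto_intros summable_LIMSEQ s)
  ultimately show ?thesis by simp
qed

lemma nh_tendsto:
  assumes z: "\<And>n. z n \<in> H_half t" "z' \<in> H_half t" and l: "(\<lambda>n. nh (\<lambda>i. z n i - z' i)) \<longlonglongrightarrow> 0"
  shows "(\<lambda>n. nh (z n)) \<longlonglongrightarrow> nh z'"
proof (rule LIM_zero_cancel, rule Lim_null_comparison[OF _ l], rule always_eventually, rule allI)
  fix n
  have "nh (z n) \<le> nh (\<lambda>i. z n i - z' i) + nh z'"
    using nh_triangle[OF H_half_diff[OF z(1) z(2)] z(2), of n] by simp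
  moreover have "nh z' \<le> nh (\<lambda>i. z n i - z' i) + nh (z n)"
    using nh_triangle[OF H_half_diff[OF z(2) z(1)] z(1), of n n] by (simp add: nh_minus_commute[of z' "z n"])
  ultimately show "norm (nh (z n) - nh z') \<le> nh (\<lambda>i. z n i - z' i)" by (simp add: abs_le_iff)
qed

lemma ip_half_trunc: "ip_half t z (trunc n w) = (\<Sum>i<n. z i * cnj (w i) / complex_of_real (t i))"
  by (subst ip_half_fin_supp[of "{..<n}"]) (auto simp: trunc_def)

lemma ip_half_trunc_limit: "ip_summable z w \<Longrightarrow> (\<lambda>n. ip_half t z (trunc n w)) \<longlonglongrightarrow> ip_half t z w"
  unfolding ip_half_trunc unfolding ip_half_def ip_summable_def by (rule summable_LIMSEQ)

subsection \<open>The random variables\<close>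

abbreviation lin :: "(nat \<Rightarrow> complex) \<Rightarrow> hfun" where
  "lin a \<equiv> (\<lambda>w. ip_half t w a)"

lemma lin_L2_fin_supp: "a \<in> fin_supp \<Longrightarrow> lin a \<in> L2 t"
  by (rule poly_L2[OF ip_half_poly])

lemma exp_Re_lin_integral:
  assumes a: "a \<in> fin_supp"
  shows "has_bochner_integral \<mu> (\<lambda>w. exp (2 * Re (lin a w))) (exp ((nh a)\<^sup>2))"
proof -
  have "lin a w + cnj (lin a w) = of_real (2 * Re (lin a w))" for w by (simp add: complex_eq_iff)
  then have "has_bochner_integral \<mu> (\<lambda>w. complex_of_real (exp (2 * Re (lin a w)))) (of_real (exp ((nh a)\<^sup>2)))"
    using gaussian_exp_integral[OF a a]
    by (simp only: ip_half_nh[OF fin_supp_H_half[OF a]] exp_of_real)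
  from has_bochner_integral_bounded_linear[OF bounded_linear_Re this] show ?thesis by simp
qed

lemma fin_supp_scale: "a \<in> fin_supp \<Longrightarrow> (\<lambda>i. c * a i) \<in> fin_supp"
  unfolding fin_supp_def by (auto intro: finite_subset[of _ "{i. a i \<noteq> 0}"])

lemma fin_supp_diff: "a \<in> fin_supp \<Longrightarrow> b \<in> fin_supp \<Longrightarrow> (\<lambda>i. a i - b i) \<in> fin_supp"
  using fin_supp_add[of a "\<lambda>i. -1 * b i"] fin_supp_scale[of b "-1"] by simp

text \<open>After rescaling to norm one the exponential moments equal \<open>exp 1\<close>, and
  \<open>square_le_exp\<close> converts them into a second moment. The constant 3 bounds the number
  e.\<close>

lemma Re_lin_second_moment:
  assumes a: "a \<in> fin_supp" and pos: "nh a > 0"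
  shows "(\<integral>w. (Re (lin a w))\<^sup>2 \<partial>\<mu>) \<le> 3 * (nh a)\<^sup>2"
proof -
  define r where "r = 1 / nh a"
  have r: "r > 0" using pos by (simp add: r_def)
  have b: "has_bochner_integral \<mu> (\<lambda>w. exp (2 * c * Re (lin a w))) (exp 1)" if c: "c = r \<or> c = -r" for c
  proof -
    have "nh (\<lambda>i. complex_of_real c * a i) = 1"
      using c pos by (auto simp: nh_scale[OF fin_supp_H_half[OF a]] r_def)
    moreover have "Re (lin (\<lambda>i. complex_of_real c * a i) w) = c * Re (lin a w)" for w
      by (simp add: ip_half_scale_right[OF ip_summable_fin_supp[OF a]])
    ultimately show ?thesis
      using exp_Re_lin_integral[OF fin_supp_scale[OF a, of "complex_of_real c"]] by (simp add: mult.assoc)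
  qed
  have B: "has_bochner_integral \<mu> (\<lambda>w. 2 * (exp (2 * r * Re (lin a w)) + exp (2 * (-r) * Re (lin a w)))) (2 * (exp 1 + exp 1))"
    by (intro has_bochner_integral_mult_right has_bochner_integral_add b) auto
  have i: "integrable \<mu> (\<lambda>w. (Re (lin a w))\<^sup>2)"
  proof (rule Bochner_Integration.integrable_bound[OF L2_square_integrable[OF lin_L2_fin_supp[OF a]]])
    show "(\<lambda>w. (Re (lin a w))\<^sup>2) \<in> borel_measurable \<mu>"
      using measurable_ip_half[OF a] by simp
    show "AE w in \<mu>. norm ((Re (lin a w))\<^sup>2) \<le> norm ((cmod (lin a w))\<^sup>2)"
      by (intro AE_I2) (simp add: cmod_power2)
  qed
  have "4 * r\<^sup>2 * (\<integral>w. (Re (lin a w))\<^sup>2 \<partial>\<mu>) = (\<integral>w. (2 * r * Re (lin a w))\<^sup>2 \<partial>\<mu>)"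
    by (simp add: power_mult_distrib)
  also have "\<dots> \<le> (\<integral>w. 2 * (exp (2 * r * Re (lin a w)) + exp (2 * (-r) * Re (lin a w))) \<partial>\<mu>)"
  proof (rule integral_mono)
    show "integrable \<mu> (\<lambda>w. (2 * r * Re (lin a w))\<^sup>2)" using i by (simp add: power_mult_distrib)
    show "(2 * r * Re (lin a w))\<^sup>2 \<le> 2 * (exp (2 * r * Re (lin a w)) + exp (2 * (-r) * Re (lin a w)))" for w
      using square_le_exp[of "2 * r * Re (lin a w)"] by simp
  qed (use B in \<open>simp add: has_bochner_integral_iff\<close>)
  also have "\<dots> = 4 * exp 1" using B by (simp add: has_bochner_integral_iff)
  also have "\<dots> \<le> 4 * 3" using exp_le by simp
  finally show ?thesis using pos by (simp add: r_def field_simps power2_eq_square)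
qed

lemma nh_eq_0:
  assumes a: "a \<in> H_half t" "nh a = 0"
  shows "a i = 0"
proof -
  have "(cmod (a i))\<^sup>2 / t i \<le> (\<Sum>n. (cmod (a n))\<^sup>2 / t n)"
    using sum_le_suminf[of "\<lambda>n. (cmod (a n))\<^sup>2 / t n" "{i}"] a(1) t_pos by (auto simp: H_half_iff less_imp_le)
  also have "\<dots> = 0" using a nh_power2[OF a(1)] by simp
  finally show ?thesis using t_pos[of i] by (simp add: field_simps)
qed

text \<open>The imaginary part of \<open>lin a\<close> is the real part of \<open>lin\<close> at the
  rotated sequence, so the estimate for real parts applies twice, and 3 + 3 is at most the square of
  3. All continuity of the linear functionals in their parameter rests on this bound.\<close>

lemma N_lin_fin_supp:
  assumes a: "a \<in> fin_supp"
  shows "N (lin a) \<le> 3 * nh a"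
proof (cases "nh a = 0")
  case True
  then have "lin a = (\<lambda>w. 0)" using nh_eq_0[OF fin_supp_H_half[OF a]] by (auto simp: ip_half_def)
  then show ?thesis using True by (simp add: L2_norm_def)
next
  case False
  then have pos: "nh a > 0" using nh_nonneg[OF fin_supp_H_half[OF a]] by simp
  let ?b = "\<lambda>i. \<i> * a i"
  have b: "?b \<in> fin_supp" by (rule fin_supp_scale[OF a])
  have nb: "nh ?b = nh a" by (simp add: nh_scale[OF fin_supp_H_half[OF a]])
  have Im: "Re (lin ?b w) = Im (lin a w)" for w
    by (simp add: ip_half_scale_right[OF ip_summable_fin_supp[OF a]])
  have int: "integrable \<mu> (\<lambda>w. (Re (lin c w))\<^sup>2)" if c: "c \<in> fin_supp" for c
  proof (rule Bochner_Integration.integrable_bound[OF L2_square_integrable[OF lin_L2_fin_supp[OF c]]])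
    show "(\<lambda>w. (Re (lin c w))\<^sup>2) \<in> borel_measurable \<mu>"
      using measurable_ip_half[OF c] by simp
    show "AE w in \<mu>. norm ((Re (lin c w))\<^sup>2) \<le> norm ((cmod (lin c w))\<^sup>2)"
      by (intro AE_I2) (simp add: cmod_power2)
  qed
  have "(N (lin a))\<^sup>2 = (\<integral>w. (Re (lin a w))\<^sup>2 + (Re (lin ?b w))\<^sup>2 \<partial>\<mu>)"
    unfolding N_power2 cmod_power2 Im by simp
  also have "\<dots> = (\<integral>w. (Re (lin a w))\<^sup>2 \<partial>\<mu>) + (\<integral>w. (Re (lin ?b w))\<^sup>2 \<partial>\<mu>)"
    by (rule Bochner_Integration.integral_add[OF int[OF a] int[OF b]])
  also have "\<dots> \<le> 3 * (nh a)\<^sup>2 + 3 * (nh a)\<^sup>2"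
    using Re_lin_second_moment[OF a pos] Re_lin_second_moment[OF b] pos unfolding nb by simp
  also have "\<dots> \<le> (3 * nh a)\<^sup>2" by (simp add: power_mult_distrib)
  finally show ?thesis by (rule power2_le_imp_le) (use pos in simp)
qed

lemma lin_diff_fin_supp: "a \<in> fin_supp \<Longrightarrow> b \<in> fin_supp \<Longrightarrow> lin a w - lin b w = lin (\<lambda>i. a i - b i) w"
  by (simp add: ip_half_diff_right ip_summable_fin_supp)

lemma lin_trunc_limit:
  assumes z: "z \<in> H_half t"
  shows "\<exists>g\<in>L2 t. (\<lambda>n. N (\<lambda>w. lin (trunc n z) w - g w)) \<longlonglongrightarrow> 0"
proof (rule L2_complete)
  show "lin (trunc n z) \<in> L2 t" for n by (rule lin_L2_fin_supp[OF trunc_fin_supp])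
  fix e :: real assume e: "e > 0"
  then have "e / 6 > 0" by simp
  from order_tendstoD(2)[OF nh_trunc_limit[OF z] this] obtain M where
    M: "\<And>n. n \<ge> M \<Longrightarrow> nh (\<lambda>i. trunc n z i - z i) < e / 6" by (auto simp: eventually_sequentially)
  have "N (\<lambda>w. lin (trunc m z) w - lin (trunc n z) w) < e" if "m \<ge> M" "n \<ge> M" for m n
  proof -
    note f = trunc_fin_supp
    have "N (\<lambda>w. lin (trunc m z) w - lin (trunc n z) w) = N (lin (\<lambda>i. trunc m z i - trunc n z i))"
      by (simp add: lin_diff_fin_supp f)
    also have "\<dots> \<le> 3 * nh (\<lambda>i. trunc m z i - trunc n z i)" by (rule N_lin_fin_supp[OF fin_supp_diff[OF f f]])
    also have "\<dots> \<le> 3 * (nh (\<lambda>i. trunc m z i - z i) + nh (\<lambda>i. z i - trunc n z i))"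
      using nh_triangle_diff[OF fin_supp_H_half[OF f] z fin_supp_H_half[OF f], of m z n z] by simp
    also have "nh (\<lambda>i. z i - trunc n z i) = nh (\<lambda>i. trunc n z i - z i)" by (rule nh_minus_commute)
    also have "3 * (nh (\<lambda>i. trunc m z i - z i) + \<dots>) < e" using M[OF that(1)] M[OF that(2)] by simp
    finally show ?thesis .
  qed
  then show "\<exists>M. \<forall>m\<ge>M. \<forall>n\<ge>M. N (\<lambda>w. lin (trunc m z) w - lin (trunc n z) w) < e"
    by (intro exI[of _ M] allI impI)
qed

text \<open>The series converges at every point of \<open>ell2\<close>, which identifies the
  abstract limit of the truncations with the function given by the series.\<close>

lemma lin_H_one:
  assumes y: "y \<in> H_one t"
  shows "lin y \<in> L2 t" "(\<lambda>n. N (\<lambda>w. lin (trunc n y) w - lin y w)) \<longlonglongrightarrow> 0"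
proof -
  obtain g where g: "g \<in> L2 t" "(\<lambda>n. N (\<lambda>w. lin (trunc n y) w - g w)) \<longlonglongrightarrow> 0"
    using lin_trunc_limit y H_one_subset_H_half by blast
  have lim: "(\<lambda>n. lin (trunc n y) w) \<longlonglongrightarrow> lin y w" if "w \<in> ell2" for w
    by (rule ip_half_trunc_limit[OF ip_summable_ell2_H_one[OF that y]])
  have m: "lin y \<in> borel_measurable \<mu>"
    by (rule borel_measurable_LIMSEQ_metric[OF measurable_ip_half[OF trunc_fin_supp] lim])
      (simp add: space_gaussian)
  have ae: "AE w in \<mu>. g w = lin y w"
    by (rule L2_limit_unique_AE[OF lin_L2_fin_supp[OF trunc_fin_supp] g])
      (use lim in \<open>auto intro!: AE_I2 simp: space_gaussian\<close>)
  show "lin y \<in> L2 t" by (rule L2_cong_AE[OF g(1) m ae])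
  have "N (\<lambda>w. lin (trunc n y) w - g w) = N (\<lambda>w. lin (trunc n y) w - lin y w)" for n
  proof (rule N_cong_AE)
    show "AE w in \<mu>. lin (trunc n y) w - g w = lin (trunc n y) w - lin y w" using ae by eventually_elim simp
  qed (use m L2_measurable[OF g(1)] measurable_ip_half[OF trunc_fin_supp] in auto)
  then show "(\<lambda>n. N (\<lambda>w. lin (trunc n y) w - lin y w)) \<longlonglongrightarrow> 0" using g(2) by simp
qed

lemma N_lin_H_one_diff:
  assumes y: "y \<in> H_one t" and z: "z \<in> H_half t" and g: "g \<in> L2 t"
    "(\<lambda>n. N (\<lambda>w. lin (trunc n z) w - g w)) \<longlonglongrightarrow> 0"
  shows "N (\<lambda>w. lin y w - g w) \<le> 3 * nh (\<lambda>i. y i - z i)"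
proof (rule LIMSEQ_le_const)
  note f = trunc_fin_supp and yh = subsetD[OF H_one_subset_H_half y]
  let ?B = "\<lambda>n. N (\<lambda>w. lin (trunc n y) w - lin y w) + 3 * (nh (\<lambda>i. trunc n y i - y i) + nh (\<lambda>i. y i - z i) + nh (\<lambda>i. trunc n z i - z i)) + N (\<lambda>w. lin (trunc n z) w - g w)"
  have "?B \<longlonglongrightarrow> 0 + 3 * (0 + nh (\<lambda>i. y i - z i) + 0) + 0"
    by (intro tendsto_intros lin_H_one(2)[OF y] g(2) nh_trunc_limit yh z)
  then show "?B \<longlonglongrightarrow> 3 * nh (\<lambda>i. y i - z i)" by simp
  show "\<exists>M. \<forall>n\<ge>M. N (\<lambda>w. lin y w - g w) \<le> ?B n"
  proof (intro exI allI impI)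
    fix n
    have "N (\<lambda>w. lin y w - g w) \<le> N (\<lambda>w. lin y w - lin (trunc n y) w) + N (\<lambda>w. lin (trunc n y) w - g w)"
      by (rule N_triangle_diff[OF lin_H_one(1)[OF y] lin_L2_fin_supp[OF f] g(1)])
    moreover have "N (\<lambda>w. lin (trunc n y) w - g w) \<le> N (\<lambda>w. lin (trunc n y) w - lin (trunc n z) w) + N (\<lambda>w. lin (trunc n z) w - g w)"
      by (rule N_triangle_diff[OF lin_L2_fin_supp[OF f] lin_L2_fin_supp[OF f] g(1)])
    moreover have "N (\<lambda>w. lin (trunc n y) w - lin (trunc n z) w) \<le> 3 * nh (\<lambda>i. trunc n y i - trunc n z i)"
      using N_lin_fin_supp[OF fin_supp_diff[OF f f], of n y n z] by (simp add: lin_diff_fin_supp f)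
    moreover have "nh (\<lambda>i. trunc n y i - trunc n z i) \<le> nh (\<lambda>i. trunc n y i - y i) + nh (\<lambda>i. y i - trunc n z i)"
      by (rule nh_triangle_diff[OF fin_supp_H_half[OF f] yh fin_supp_H_half[OF f]])
    moreover have "nh (\<lambda>i. y i - trunc n z i) \<le> nh (\<lambda>i. y i - z i) + nh (\<lambda>i. z i - trunc n z i)"
      by (rule nh_triangle_diff[OF yh z fin_supp_H_half[OF f]])
    ultimately show "N (\<lambda>w. lin y w - g w) \<le> ?B n"
      using nh_minus_commute[of z "trunc n z"] N_minus_commute[of "lin y" "lin (trunc n y)"] by argo
  qed
qed

text \<open>Two candidates for the extension are both close to \<open>F y\<close> at some common
  \<open>y\<close>, so they agree almost everywhere. The lemma resolves the choice in all three
  extensions by continuity: of the linear functionals, from polynomials to the Fock space, and from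
  \<open>H_one t\<close> to \<open>H_half t\<close>.\<close>

lemma L2_extend_AE:
  assumes h: "h \<in> L2 t" "\<And>e. e > 0 \<Longrightarrow> \<exists>r>0. \<forall>y\<in>D. d y < r \<longrightarrow> N (\<lambda>w. F y w - h w) < e"
    and F: "\<And>y. y \<in> D \<Longrightarrow> F y \<in> L2 t" and D: "\<And>r. r > 0 \<Longrightarrow> \<exists>y\<in>D. d y < r"
  shows "L2_extend t D d F \<in> L2 t" "AE w in \<mu>. L2_extend t D d F w = h w"
proof -
  define k where "k = L2_extend t D d F"
  have k: "k \<in> L2 t \<and> (\<forall>e>0. \<exists>r>0. \<forall>y\<in>D. d y < r \<longrightarrow> N (\<lambda>w. F y w - k w) < e)"
    unfolding k_def L2_extend_def by (rule someI[of _ h]) (use h in auto)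
  have "N (\<lambda>w. k w - h w) = 0"
  proof (rule ccontr)
    assume "N (\<lambda>w. k w - h w) \<noteq> 0"
    then have e: "N (\<lambda>w. k w - h w) / 2 > 0" using N_nonneg[of "\<lambda>w. k w - h w"] by simp
    obtain r where r: "r > 0" "\<forall>y\<in>D. d y < r \<longrightarrow> N (\<lambda>w. F y w - h w) < N (\<lambda>w. k w - h w) / 2"
      using h(2)[OF e] by auto
    obtain r' where r': "r' > 0" "\<forall>y\<in>D. d y < r' \<longrightarrow> N (\<lambda>w. F y w - k w) < N (\<lambda>w. k w - h w) / 2"
      using k e by blast
    obtain y where y: "y \<in> D" "d y < min r r'" using D[of "min r r'"] r(1) r'(1) by auto
    have "N (\<lambda>w. k w - h w) \<le> N (\<lambda>w. k w - F y w) + N (\<lambda>w. F y w - h w)"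
      by (rule N_triangle_diff) (use k F y h in auto)
    moreover have "N (\<lambda>w. F y w - h w) < N (\<lambda>w. k w - h w) / 2" using r(2) y by simp
    moreover have "N (\<lambda>w. F y w - k w) < N (\<lambda>w. k w - h w) / 2" using r'(2) y by simp
    ultimately show False using N_minus_commute[of k "F y"] by linarith
  qed
  then have "AE w in \<mu>. k w - h w = 0" using k h L2_diff by (intro N_eq_0_AE) auto
  then show "L2_extend t D d F \<in> L2 t" "AE w in \<mu>. L2_extend t D d F w = h w"
    using k unfolding k_def by auto
qed

lemma H_one_dense:
  assumes z: "z \<in> H_half t" and r: "r > 0"
  shows "\<exists>y\<in>H_one t. half_dist t z y < r"
proof -
  from order_tendstoD(2)[OF nh_trunc_limit[OF z] r] obtain n where "nh (\<lambda>i. trunc n z i - z i) < r"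
    by (auto simp: eventually_sequentially)
  then show ?thesis
    using subsetD[OF fin_supp_subset_H_one trunc_fin_supp] unfolding half_dist_def by (rule bexI)
qed

abbreviation "X \<equiv> ip_half_ext t"

lemma X_L2_lin:
  assumes z: "z \<in> H_half t"
  shows "X z \<in> L2 t" "y \<in> H_one t \<Longrightarrow> N (\<lambda>w. lin y w - X z w) \<le> 3 * nh (\<lambda>i. y i - z i)"
proof -
  obtain g where g: "g \<in> L2 t" "(\<lambda>n. N (\<lambda>w. lin (trunc n z) w - g w)) \<longlonglongrightarrow> 0"
    using lin_trunc_limit z by blast
  note B = N_lin_H_one_diff[OF _ z g]
  have c: "\<exists>r>0. \<forall>y\<in>H_one t. half_dist t z y < r \<longrightarrow> N (\<lambda>w. lin y w - g w) < e" if e: "e > 0" for e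
  proof (intro exI[of _ "e/3"] conjI ballI impI)
    fix y assume "y \<in> H_one t" "half_dist t z y < e / 3"
    then show "N (\<lambda>w. lin y w - g w) < e" using B[of y] by (simp add: half_dist_def)
  qed (use e in simp)
  have ext: "X z \<in> L2 t" "AE w in \<mu>. X z w = g w" unfolding ip_half_ext_def
    by (rule L2_extend_AE[OF g(1) c lin_H_one(1) H_one_dense[OF z]]; assumption)+
  from ext(1) show "X z \<in> L2 t" .
  assume y: "y \<in> H_one t"
  have "N (\<lambda>w. lin y w - X z w) = N (\<lambda>w. lin y w - g w)"
  proof (rule N_cong_AE)
    show "AE w in \<mu>. lin y w - X z w = lin y w - g w" using ext(2) by eventually_elim simp
  qed (use L2_measurable[OF lin_H_one(1)[OF y]] L2_measurable[OF ext(1)] L2_measurable[OF g(1)] in auto)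
  then show "N (\<lambda>w. lin y w - X z w) \<le> 3 * nh (\<lambda>i. y i - z i)" using B[OF y] by simp
qed

lemma X_measurable: "z \<in> H_half t \<Longrightarrow> X z \<in> borel_measurable \<mu>"
  by (rule L2_measurable[OF X_L2_lin(1)])

lemma X_trunc_limit:
  assumes z: "z \<in> H_half t"
  shows "(\<lambda>n. N (\<lambda>w. lin (trunc n z) w - X z w)) \<longlonglongrightarrow> 0"
proof (rule tendsto_sandwich[OF _ _ tendsto_const])
  have "(\<lambda>n. 3 * nh (\<lambda>i. trunc n z i - z i)) \<longlonglongrightarrow> 3 * 0" by (intro tendsto_intros nh_trunc_limit z)
  then show "(\<lambda>n. 3 * nh (\<lambda>i. trunc n z i - z i)) \<longlonglongrightarrow> 0" by simp
  show "\<forall>\<^sub>F n in sequentially. N (\<lambda>w. lin (trunc n z) w - X z w) \<le> 3 * nh (\<lambda>i. trunc n z i - z i)"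
    by (intro always_eventually allI X_L2_lin(2)[OF z] subsetD[OF fin_supp_subset_H_one trunc_fin_supp])
qed (simp add: N_nonneg)

lemma X_H_one:
  assumes y: "y \<in> H_one t"
  shows "AE w in \<mu>. X y w = lin y w"
proof -
  note yh = subsetD[OF H_one_subset_H_half y]
  have "nh (\<lambda>i. y i - y i) = 0" by (simp add: norm_half_def ip_half_def)
  then have "N (\<lambda>w. lin y w - X y w) = 0"
    using X_L2_lin(2)[OF yh y] N_nonneg[of "\<lambda>w. lin y w - X y w"] by simp
  then have "AE w in \<mu>. lin y w - X y w = 0"
    by (intro N_eq_0_AE L2_diff lin_H_one(1)[OF y] X_L2_lin(1)[OF yh])
  then show ?thesis by eventually_elim simp
qed

lemma L2_limit_cong_AE:
  assumes f: "\<And>n. f n \<in> L2 t" "g \<in> L2 t" "h \<in> L2 t"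
    and l: "(\<lambda>n. N (\<lambda>w. f n w - g w)) \<longlonglongrightarrow> 0" "(\<lambda>n. N (\<lambda>w. f n w - h w)) \<longlonglongrightarrow> 0"
  shows "AE w in \<mu>. g w = h w"
proof -
  have "N (\<lambda>w. g w - h w) \<le> 0"
  proof (rule LIMSEQ_le_const)
    show "(\<lambda>n. N (\<lambda>w. f n w - g w) + N (\<lambda>w. f n w - h w)) \<longlonglongrightarrow> 0" using tendsto_add[OF l] by simp
    show "\<exists>M. \<forall>n\<ge>M. N (\<lambda>w. g w - h w) \<le> N (\<lambda>w. f n w - g w) + N (\<lambda>w. f n w - h w)"
      using N_triangle_diff[OF f(2,1,3)] N_minus_commute[of g] by auto
  qed
  then have "N (\<lambda>w. g w - h w) = 0" using N_nonneg[of "\<lambda>w. g w - h w"] by simp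
  then have "AE w in \<mu>. g w - h w = 0" by (intro N_eq_0_AE L2_diff f)
  then show ?thesis by eventually_elim simp
qed

lemma N_limit_add:
  assumes f: "\<And>n. f n \<in> L2 t" "\<And>n. f' n \<in> L2 t" "g \<in> L2 t" "g' \<in> L2 t"
    and l: "(\<lambda>n. N (\<lambda>w. f n w - g w)) \<longlonglongrightarrow> 0" "(\<lambda>n. N (\<lambda>w. f' n w - g' w)) \<longlonglongrightarrow> 0"
  shows "(\<lambda>n. N (\<lambda>w. (f n w + f' n w) - (g w + g' w))) \<longlonglongrightarrow> 0"
proof (rule tendsto_sandwich[OF _ _ tendsto_const])
  show "(\<lambda>n. N (\<lambda>w. f n w - g w) + N (\<lambda>w. f' n w - g' w)) \<longlonglongrightarrow> 0" using tendsto_add[OF l] by simp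
  have "N (\<lambda>w. (f n w + f' n w) - (g w + g' w)) \<le> N (\<lambda>w. f n w - g w) + N (\<lambda>w. f' n w - g' w)" for n
    using N_triangle[OF L2_diff[OF f(1) f(3)] L2_diff[OF f(2) f(4)], of n n] by (simp add: algebra_simps)
  then show "\<forall>\<^sub>F n in sequentially. N (\<lambda>w. (f n w + f' n w) - (g w + g' w)) \<le> N (\<lambda>w. f n w - g w) + N (\<lambda>w. f' n w - g' w)"
    by (intro always_eventually allI)
qed (simp add: N_nonneg)

lemma N_limit_scale:
  assumes l: "(\<lambda>n. N (\<lambda>w. f n w - g w)) \<longlonglongrightarrow> 0"
  shows "(\<lambda>n. N (\<lambda>w. c * f n w - c * g w)) \<longlonglongrightarrow> 0"
proof -
  have "N (\<lambda>w. c * f n w - c * g w) = cmod c * N (\<lambda>w. f n w - g w)" for n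
    unfolding N_scale[symmetric] by (simp add: right_diff_distrib)
  then show ?thesis using tendsto_mult_right_zero[OF l] by simp
qed

text \<open>The representative \<open>X z\<close> is chosen separately for each \<open>z\<close>, so
  additivity can be expected only almost everywhere; it is inherited from the truncations, where it
  is exact.\<close>

lemma X_add:
  assumes a: "a \<in> H_half t" and b: "b \<in> H_half t"
  shows "AE w in \<mu>. X (\<lambda>i. a i + b i) w = X a w + X b w"
proof (rule L2_limit_cong_AE)
  show "(\<lambda>n. N (\<lambda>w. lin (trunc n (\<lambda>i. a i + b i)) w - X (\<lambda>i. a i + b i) w)) \<longlonglongrightarrow> 0"
    by (rule X_trunc_limit[OF H_half_add[OF a b]])
  show "(\<lambda>n. N (\<lambda>w. lin (trunc n (\<lambda>i. a i + b i)) w - (X a w + X b w))) \<longlonglongrightarrow> 0"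
    unfolding trunc_add ip_half_add_fin_supp[OF trunc_fin_supp trunc_fin_supp]
    by (rule N_limit_add[OF lin_L2_fin_supp[OF trunc_fin_supp] lin_L2_fin_supp[OF trunc_fin_supp]
      X_L2_lin(1)[OF a] X_L2_lin(1)[OF b] X_trunc_limit[OF a] X_trunc_limit[OF b]])
qed (intro lin_L2_fin_supp trunc_fin_supp X_L2_lin(1) H_half_add L2_add a b)+

lemma X_scale:
  assumes a: "a \<in> H_half t"
  shows "AE w in \<mu>. X (\<lambda>i. c * a i) w = cnj c * X a w"
proof (rule L2_limit_cong_AE)
  show "(\<lambda>n. N (\<lambda>w. lin (trunc n (\<lambda>i. c * a i)) w - X (\<lambda>i. c * a i) w)) \<longlonglongrightarrow> 0"
    by (rule X_trunc_limit[OF H_half_scale[OF a]])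
  show "(\<lambda>n. N (\<lambda>w. lin (trunc n (\<lambda>i. c * a i)) w - cnj c * X a w)) \<longlonglongrightarrow> 0"
    unfolding trunc_scale ip_half_scale_right[OF ip_summable_fin_supp[OF trunc_fin_supp]]
    by (rule N_limit_scale[OF X_trunc_limit[OF a]])
qed (intro lin_L2_fin_supp trunc_fin_supp X_L2_lin(1) H_half_scale L2_scale a)+

lemma ip_tendsto:
  assumes f: "\<And>n. f n \<in> L2 t" "\<And>n. f' n \<in> L2 t" "g \<in> L2 t" "g' \<in> L2 t"
    and l: "(\<lambda>n. N (\<lambda>w. f n w - g w)) \<longlonglongrightarrow> 0" "(\<lambda>n. N (\<lambda>w. f' n w - g' w)) \<longlonglongrightarrow> 0"
  shows "(\<lambda>n. ip (f n) (f' n)) \<longlonglongrightarrow> ip g g'"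
proof (rule LIM_zero_cancel, rule Lim_null_comparison)
  let ?a = "\<lambda>n. N (\<lambda>w. f n w - g w)" and ?b = "\<lambda>n. N (\<lambda>w. f' n w - g' w)"
  have "(\<lambda>n. ?a n * (N g' + ?b n) + N g * ?b n) \<longlonglongrightarrow> 0 * (N g' + 0) + N g * 0"
    by (intro tendsto_intros l)
  then show "(\<lambda>n. ?a n * (N g' + ?b n) + N g * ?b n) \<longlonglongrightarrow> 0" by simp
  have "cmod (ip (f n) (f' n) - ip g g') \<le> ?a n * (N g' + ?b n) + N g * ?b n" for n
  proof -
    have d: "(\<lambda>w. f n w - g w) \<in> L2 t" "(\<lambda>w. f' n w - g' w) \<in> L2 t" using f by (auto intro: L2_diff)
    have "ip (f n) (f' n) - ip g g' = ip (\<lambda>w. f n w - g w) (f' n) + ip g (\<lambda>w. f' n w - g' w)"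
      by (simp add: ip_diff_left ip_diff_right f)
    also have "cmod \<dots> \<le> ?a n * N (f' n) + N g * ?b n"
      by (intro order_trans[OF norm_triangle_ineq] add_mono Cauchy_Schwarz f d)
    also have "\<dots> \<le> ?a n * (N g' + ?b n) + N g * ?b n"
      by (intro add_mono mult_left_mono N_le_add_diff f N_nonneg order_refl)
    finally show ?thesis .
  qed
  then show "\<forall>\<^sub>F n in sequentially. norm (ip (f n) (f' n) - ip g g') \<le> ?a n * (N g' + ?b n) + N g * ?b n"
    by (intro always_eventually allI)
qed

lemma ip_E:
  assumes "a \<in> fin_supp" "b \<in> fin_supp"
  shows "ip (E a) (E b) = exp (ip_half t b a)"
  using gaussian_exp_integral[OF assms]
  by (simp add: L2_ip_def E_def has_bochner_integral_iff exp_add exp_cnj)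

text \<open>The coherent state for a general \<open>a\<close> in \<open>H_half t\<close>, built on
  the extended functional. Such states are needed because a Weyl operator with parameter in
  \<open>H_half t\<close> moves \<open>E a\<close> out of the finitely supported family.\<close>

definition coh :: "(nat \<Rightarrow> complex) \<Rightarrow> hfun" where
  "coh a w = exp (X a w)"

lemma coh_measurable: "a \<in> H_half t \<Longrightarrow> coh a \<in> borel_measurable \<mu>"
proof -
  assume "a \<in> H_half t"
  then have [measurable]: "X a \<in> borel_measurable \<mu>" by (rule X_measurable)
  show ?thesis unfolding coh_def[abs_def] by measurable
qed

lemma ip_half_trunc_trunc:
  "ip_half t (trunc m z) (trunc n z) = of_real (\<Sum>i<min m n. (cmod (z i))\<^sup>2 / t i)"
proof -
  have "ip_half t (trunc m z) (trunc n z) = (\<Sum>i<min m n. trunc m z i * cnj (trunc n z i) / complex_of_real (t i))"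
    by (rule ip_half_fin_supp) (auto simp: trunc_def)
  also have "\<dots> = (\<Sum>i<min m n. of_real ((cmod (z i))\<^sup>2 / t i))"
    by (intro sum.cong) (auto simp: trunc_def complex_norm_square simp del: of_real_power)
  finally show ?thesis by simp
qed

text \<open>The inner product of two truncations depends only on the shorter one, so the expansion
  of the squared distance telescopes. Thus the convergence of the real sequence \<open>q\<close>
  makes the truncated coherent states a Cauchy sequence.\<close>

lemma N_E_trunc_diff:
  assumes q: "\<And>n. q n = exp (\<Sum>i<n. (cmod (z i))\<^sup>2 / t i)"
  shows "(N (\<lambda>w. E (trunc m z) w - E (trunc n z) w))\<^sup>2 = \<bar>q m - q n\<bar>"
proof -
  note L = E_L2[OF trunc_fin_supp]
  have ii: "ip (E (trunc m z)) (E (trunc n z)) = of_real (q (min m n))" for m n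
    by (simp add: ip_E trunc_fin_supp ip_half_trunc_trunc q exp_of_real min.commute del: of_real_sum)
  have nn: "(N (E (trunc n z)))\<^sup>2 = q n" for n
    using ip_self[of "E (trunc n z)"] ii[of n n] by (metis min.idem of_real_eq_iff)
  have mono: "q m \<le> q n" if "m \<le> n" for m n
    unfolding q using that t_pos by (intro exp_le_cancel_iff[THEN iffD2] sum_mono2) (auto simp: less_imp_le)
  have "(N (\<lambda>w. E (trunc m z) w + (-1) * E (trunc n z) w))\<^sup>2 = q m - 2 * q (min m n) + q n"
    unfolding N_add_scale[OF L L] ii nn by simp
  then show ?thesis using mono[of m n] mono[of n m] by (simp add: min_def split: if_splits)
qed

lemma coh_limit:
  assumes z: "z \<in> H_half t"
  shows "coh z \<in> Fock t" "(\<lambda>n. N (\<lambda>w. E (trunc n z) w - coh z w)) \<longlonglongrightarrow> 0"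
proof -
  note f = trunc_fin_supp
  define q where "q n = exp (\<Sum>i<n. (cmod (z i))\<^sup>2 / t i)" for n
  have "(\<lambda>n. \<Sum>i<n. (cmod (z i))\<^sup>2 / t i) \<longlonglongrightarrow> (\<Sum>i. (cmod (z i))\<^sup>2 / t i)"
    using z by (intro summable_LIMSEQ) (simp add: H_half_iff)
  then have "convergent q" unfolding q_def by (auto simp: convergent_def intro!: tendsto_exp)
  then have qC: "Cauchy q" by (rule convergent_Cauchy)
  have "\<exists>g\<in>L2 t. (\<lambda>n. N (\<lambda>w. E (trunc n z) w - g w)) \<longlonglongrightarrow> 0"
  proof (rule L2_complete[OF E_L2[OF f]])
    fix e :: real assume e: "e > 0"
    then have "e\<^sup>2 > 0" by simp
    then obtain M where M: "\<And>m n. m \<ge> M \<Longrightarrow> n \<ge> M \<Longrightarrow> norm (q m - q n) < e\<^sup>2" using CauchyD[OF qC] by blast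
    have "N (\<lambda>w. E (trunc m z) w - E (trunc n z) w) < e" if "m \<ge> M" "n \<ge> M" for m n
    proof -
      have "(N (\<lambda>w. E (trunc m z) w - E (trunc n z) w))\<^sup>2 < e\<^sup>2"
        using M[OF that] N_E_trunc_diff[of q z m n] by (simp add: q_def)
      then show ?thesis by (rule power_less_imp_less_base) (use e in simp)
    qed
    then show "\<exists>M. \<forall>m\<ge>M. \<forall>n\<ge>M. N (\<lambda>w. E (trunc m z) w - E (trunc n z) w) < e"
      by (intro exI[of _ M] allI impI)
  qed
  then obtain g where g: "g \<in> L2 t" "(\<lambda>n. N (\<lambda>w. E (trunc n z) w - g w)) \<longlonglongrightarrow> 0" by blast
  \<comment> \<open>Along a subsequence the exponents converge almost everywhere to
    \<open>X z\<close>, hence so do the exponentials; this identifies the limit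
    \<open>g\<close>.\<close>
  obtain r :: "nat \<Rightarrow> nat" where r: "strict_mono r" "AE w in \<mu>. (\<lambda>n. lin (trunc (r n) z) w) \<longlonglongrightarrow> X z w"
    using L2_limit_AE_subseq[OF lin_L2_fin_supp[OF f] X_L2_lin(1)[OF z] X_trunc_limit[OF z]] by blast
  have ae: "AE w in \<mu>. g w = coh z w"
  proof (rule L2_limit_unique_AE)
    show "E (trunc (r n) z) \<in> L2 t" for n by (rule E_L2[OF f])
    show "(\<lambda>n. N (\<lambda>w. E (trunc (r n) z) w - g w)) \<longlonglongrightarrow> 0"
      using LIMSEQ_subseq_LIMSEQ[OF g(2) r(1)] by (simp add: o_def)
    show "AE w in \<mu>. (\<lambda>n. E (trunc (r n) z) w) \<longlonglongrightarrow> coh z w"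
      using r(2) by eventually_elim (simp add: E_def coh_def tendsto_exp)
  qed (rule g(1))
  show lim: "(\<lambda>n. N (\<lambda>w. E (trunc n z) w - coh z w)) \<longlonglongrightarrow> 0"
  proof -
    have "N (\<lambda>w. E (trunc n z) w - g w) = N (\<lambda>w. E (trunc n z) w - coh z w)" for n
    proof (rule N_cong_AE)
      show "AE w in \<mu>. E (trunc n z) w - g w = E (trunc n z) w - coh z w" using ae by eventually_elim simp
    qed (use coh_measurable[OF z] L2_measurable[OF g(1)] measurable_E[OF f] in auto)
    then show ?thesis using g(2) by simp
  qed
  show "coh z \<in> Fock t"
    by (rule Fock_limit[OF E_Fock[OF f] L2_cong_AE[OF g(1) coh_measurable[OF z] ae] lim])
qed

lemma coh_L2: "a \<in> H_half t \<Longrightarrow> coh a \<in> L2 t"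
  using coh_limit(1) Fock_L2 by blast

lemma ip_coh:
  assumes a: "a \<in> H_half t" and b: "b \<in> H_half t"
  shows "ip (coh a) (coh b) = exp (ip_half t b a)"
proof (rule LIMSEQ_unique)
  note f = trunc_fin_supp
  show "(\<lambda>n. ip (E (trunc n a)) (E (trunc n b))) \<longlonglongrightarrow> ip (coh a) (coh b)"
    by (rule ip_tendsto[OF E_L2[OF f] E_L2[OF f] coh_L2[OF a] coh_L2[OF b] coh_limit(2)[OF a] coh_limit(2)[OF b]])
  have "ip_half t (trunc n b) (trunc n a) = ip_half t b (trunc n a)" for n
    by (subst (1 2) ip_half_fin_supp[of "{..<n}"]) (auto simp: trunc_def)
  then show "(\<lambda>n. ip (E (trunc n a)) (E (trunc n b))) \<longlonglongrightarrow> exp (ip_half t b a)"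
    by (simp add: ip_E f) (intro tendsto_exp ip_half_trunc_limit ip_summable_H_half a b)
qed

lemma E_coh_AE:
  assumes "a \<in> fin_supp"
  shows "AE w in \<mu>. coh a w = E a w"
  using X_H_one[OF subsetD[OF fin_supp_subset_H_one assms]]
  by eventually_elim (simp add: coh_def E_def)

end

section \<open>The Fock projection, and uniqueness by testing against coherent states\<close>

context gauss
begin

lemma Fock_proj_props:
  assumes f: "f \<in> L2 t"
  shows "Fock_proj t f \<in> Fock t" "g \<in> Fock t \<Longrightarrow> ip (Fock_proj t f) g = ip f g"
proof -
  have ex: "\<exists>h. h \<in> Fock t \<and> (\<forall>g\<in>Fock t. L2_ip t (\<lambda>w. f w - h w) g = 0)"
    using projection_exists[OF closed_subspace_Fock f] by blast
  from someI_ex[OF this] show F: "Fock_proj t f \<in> Fock t" unfolding Fock_proj_def by blast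
  assume g: "g \<in> Fock t"
  have "ip (\<lambda>w. f w - Fock_proj t f w) g = 0"
    using someI_ex[OF ex] g unfolding Fock_proj_def by blast
  then show "ip (Fock_proj t f) g = ip f g" by (simp add: ip_diff_left f Fock_L2[OF F] Fock_L2[OF g])
qed

lemma N_Fock_proj:
  assumes f: "f \<in> L2 t"
  shows "N (Fock_proj t f) \<le> N f"
proof -
  note P = Fock_proj_props[OF f]
  have "of_real ((N (Fock_proj t f))\<^sup>2) = ip f (Fock_proj t f)"
    using P(2)[OF P(1)] by (simp add: ip_self)
  then have "cmod (of_real ((N (Fock_proj t f))\<^sup>2)) \<le> N f * N (Fock_proj t f)"
    using Cauchy_Schwarz[OF f Fock_L2[OF P(1)]] by simp
  then have "N (Fock_proj t f) * N (Fock_proj t f) \<le> N f * N (Fock_proj t f)"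
    by (simp add: norm_power power2_eq_square norm_mult)
  then show ?thesis using N_nonneg[of "Fock_proj t f"] N_nonneg[of f]
    by (cases "N (Fock_proj t f) = 0") (auto simp: mult_le_cancel_right)
qed

text \<open>The difference is orthogonal to the dense span \<open>Espan\<close>. Its squared norm is
  then at most its norm times any positive number, and half of the norm is the number used.\<close>

lemma Fock_eq_AE:
  assumes f: "f \<in> Fock t" and g: "g \<in> Fock t" and e: "\<And>b. b \<in> fin_supp \<Longrightarrow> ip f (E b) = ip g (E b)"
  shows "AE w in \<mu>. f w = g w"
proof -
  let ?d = "\<lambda>w. f w - g w"
  have d: "?d \<in> Fock t" by (rule Fock_diff[OF f g])
  have sp: "ip ?d h = 0" if "h \<in> Espan" for h
    using that
  proof induction
    case (base a) then show ?case by (simp add: ip_diff_left Fock_L2 f g E_L2 e)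
  next
    case (add h k) then show ?case by (simp add: ip_add_right Fock_L2 d Espan_Fock)
  next
    case (scale h c) then show ?case by (simp add: ip_scale_right)
  qed
  have "(N ?d)\<^sup>2 \<le> N ?d * \<epsilon>" if \<epsilon>: "\<epsilon> > 0" for \<epsilon>
  proof -
    obtain h where h: "h \<in> Espan" "N (\<lambda>w. ?d w - h w) < \<epsilon>" using Espan_dense[OF d \<epsilon>] by blast
    have hF: "h \<in> L2 t" by (rule Fock_L2[OF Espan_Fock[OF h(1)]])
    have "of_real ((N ?d)\<^sup>2) = ip ?d (\<lambda>w. ?d w - h w)"
      by (simp only: ip_diff_right[OF Fock_L2[OF d] hF Fock_L2[OF d]] sp[OF h(1)] ip_self diff_0_right)
    then have "cmod (of_real ((N ?d)\<^sup>2)) \<le> N ?d * N (\<lambda>w. ?d w - h w)"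
      using Cauchy_Schwarz[OF Fock_L2[OF d] L2_diff[OF Fock_L2[OF d] hF]] by simp
    also have "\<dots> \<le> N ?d * \<epsilon>" using h(2) N_nonneg by (intro mult_left_mono) auto
    finally show ?thesis by (simp add: norm_power power_mult_distrib)
  qed
  from this[of "N ?d / 2"] have "N ?d = 0"
    using N_nonneg[of ?d] by (cases "N ?d = 0") (auto simp: power2_eq_square)
  then have "AE w in \<mu>. ?d w = 0" by (rule N_eq_0_AE[OF Fock_L2[OF d]])
  then show ?thesis by eventually_elim simp
qed

lemma Fock_eq_AE':
  assumes f: "f \<in> Fock t" and g: "g \<in> Fock t" and e: "\<And>q. q \<in> Fock t \<Longrightarrow> ip f q = ip g q"
  shows "AE w in \<mu>. f w = g w"
  by (rule Fock_eq_AE[OF f g e[OF E_Fock]])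

lemma N_zero_AE: "f \<in> L2 t \<Longrightarrow> g \<in> L2 t \<Longrightarrow> AE w in \<mu>. f w = g w \<Longrightarrow> N (\<lambda>w. f w - g w) = 0"
proof -
  assume f: "f \<in> L2 t" and g: "g \<in> L2 t" and ae: "AE w in \<mu>. f w = g w"
  have "N (\<lambda>w. f w - g w) = N (\<lambda>w. 0)"
  proof (rule N_cong_AE)
    show "AE w in \<mu>. f w - g w = 0" using ae by eventually_elim simp
  qed (use L2_measurable[OF f] L2_measurable[OF g] in auto)
  then show ?thesis by (simp add: L2_norm_def)
qed

subsection \<open>Bounded operators\<close>

lemma bounded_operatorsD:
  assumes "A \<in> bounded_operators t"
  shows "f \<in> Fock t \<Longrightarrow> A f \<in> Fock t"
    "f \<in> Fock t \<Longrightarrow> g \<in> Fock t \<Longrightarrow> AE w in \<mu>. A (\<lambda>x. f x + g x) w = A f w + A g w"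
    "f \<in> Fock t \<Longrightarrow> AE w in \<mu>. A (\<lambda>x. c * f x) w = c * A f w"
  using assms by (auto simp: bounded_operators_def)

text \<open>Additivity is available only almost everywhere, so the difference of the images is
  replaced by the image of the difference inside the seminorm.\<close>

lemma bounded_operator_diff_le:
  assumes A: "A \<in> bounded_operators t" and K: "\<And>f. f \<in> Fock t \<Longrightarrow> N (A f) \<le> K * N f"
    and f: "f \<in> Fock t" and g: "g \<in> Fock t"
  shows "N (\<lambda>w. A f w - A g w) \<le> K * N (\<lambda>w. f w - g w)"
proof -
  note D = bounded_operatorsD[OF A]
  have mg: "(\<lambda>w. -1 * g w) \<in> Fock t" by (rule Fock_scale[OF g])
  have d: "(\<lambda>w. f w + -1 * g w) \<in> Fock t" by (rule Fock_add[OF f mg])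
  have "N (\<lambda>w. A f w - A g w) = N (A (\<lambda>w. f w + -1 * g w))"
  proof (rule N_cong_AE)
    show "AE w in \<mu>. A f w - A g w = A (\<lambda>w. f w + -1 * g w) w"
      using D(2)[OF f mg] D(3)[OF g, of "-1"] by eventually_elim simp
  qed (use L2_measurable[OF Fock_L2[OF D(1)[OF f]]] L2_measurable[OF Fock_L2[OF D(1)[OF g]]]
      L2_measurable[OF Fock_L2[OF D(1)[OF d]]] in auto)
  also have "\<dots> \<le> K * N (\<lambda>w. f w + -1 * g w)" by (rule K[OF d])
  finally show ?thesis by simp
qed

lemma bounded_operator_bound:
  assumes "A \<in> bounded_operators t"
  shows "\<exists>K\<ge>0. \<forall>f\<in>Fock t. N (A f) \<le> K * N f"
proof -
  obtain K where K: "\<forall>f\<in>Fock t. N (A f) \<le> K * N f" using assms unfolding bounded_operators_def by blast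
  have "N (A f) \<le> \<bar>K\<bar> * N f" if "f \<in> Fock t" for f
    using bspec[OF K that] mult_right_mono[OF abs_ge_self[of K] N_nonneg[of f]] by linarith
  then show ?thesis by (intro exI[of _ "\<bar>K\<bar>"]) auto
qed

lemma bounded_operator_cong_AE:
  assumes A: "A \<in> bounded_operators t" and f: "f \<in> Fock t" and g: "g \<in> Fock t" and e: "AE w in \<mu>. f w = g w"
  shows "AE w in \<mu>. A f w = A g w"
proof -
  obtain K where K: "K \<ge> 0" "\<And>f. f \<in> Fock t \<Longrightarrow> N (A f) \<le> K * N f" using bounded_operator_bound[OF A] by blast
  note L = Fock_L2[OF bounded_operatorsD(1)[OF A]]
  have "N (\<lambda>w. A f w - A g w) \<le> 0"
    using bounded_operator_diff_le[OF A K(2) f g] N_zero_AE[OF Fock_L2[OF f] Fock_L2[OF g] e] by simp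
  then have "N (\<lambda>w. A f w - A g w) = 0" using N_nonneg[of "\<lambda>w. A f w - A g w"] by simp
  then have "AE w in \<mu>. A f w - A g w = 0" by (rule N_eq_0_AE[OF L2_diff[OF L[OF f] L[OF g]]])
  then show ?thesis by eventually_elim simp
qed

lemma bounded_operators_compose:
  assumes A: "A \<in> bounded_operators t" and B: "B \<in> bounded_operators t"
  shows "(\<lambda>f. A (B f)) \<in> bounded_operators t"
proof -
  obtain K where K: "K \<ge> 0" "\<And>f. f \<in> Fock t \<Longrightarrow> N (A f) \<le> K * N f" using bounded_operator_bound[OF A] by blast
  obtain L where L: "L \<ge> 0" "\<And>f. f \<in> Fock t \<Longrightarrow> N (B f) \<le> L * N f" using bounded_operator_bound[OF B] by blast
  note a = bounded_operatorsD[OF A] and b = bounded_operatorsD[OF B]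
  have "AE w in \<mu>. A (B (\<lambda>x. f x + g x)) w = A (B f) w + A (B g) w" if f: "f \<in> Fock t" and g: "g \<in> Fock t" for f g
    using bounded_operator_cong_AE[OF A b(1)[OF Fock_add[OF f g]] Fock_add[OF b(1)[OF f] b(1)[OF g]] b(2)[OF f g]]
      a(2)[OF b(1)[OF f] b(1)[OF g]] by eventually_elim simp
  moreover have "AE w in \<mu>. A (B (\<lambda>x. c * f x)) w = c * A (B f) w" if f: "f \<in> Fock t" for f c
    using bounded_operator_cong_AE[OF A b(1)[OF Fock_scale[OF f]] Fock_scale[OF b(1)[OF f]] b(3)[OF f, of c]]
      a(3)[OF b(1)[OF f], of c] by eventually_elim simp
  moreover have "N (A (B f)) \<le> (K * L) * N f" if f: "f \<in> Fock t" for f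
    using K(2)[OF b(1)[OF f]] mult_left_mono[OF L(2)[OF f] K(1)] by simp
  ultimately show ?thesis using a(1) b(1) unfolding bounded_operators_def by blast
qed

lemma bounded_operators_eq_AE:
  assumes A: "A \<in> bounded_operators t" and B: "B \<in> bounded_operators t"
    and e: "\<And>a. a \<in> fin_supp \<Longrightarrow> AE w in \<mu>. A (E a) w = B (E a) w" and g: "g \<in> Fock t"
  shows "AE w in \<mu>. A g w = B g w"
proof -
  obtain K where K: "K \<ge> 0" "\<And>f. f \<in> Fock t \<Longrightarrow> N (A f) \<le> K * N f" using bounded_operator_bound[OF A] by blast
  obtain L where L: "L \<ge> 0" "\<And>f. f \<in> Fock t \<Longrightarrow> N (B f) \<le> L * N f" using bounded_operator_bound[OF B] by blast
  note a = bounded_operatorsD[OF A] and b = bounded_operatorsD[OF B]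
  have sp: "AE w in \<mu>. A f w = B f w" if "f \<in> Espan" for f
    using that
  proof induction
    case (base a) then show ?case by (rule e)
  next
    case (add f g)
    from a(2)[OF Espan_Fock[OF add(1)] Espan_Fock[OF add(2)]] b(2)[OF Espan_Fock[OF add(1)] Espan_Fock[OF add(2)]] add(3,4)
    show ?case by eventually_elim simp
  next
    case (scale f c)
    from a(3)[OF Espan_Fock[OF scale(1)], of c] b(3)[OF Espan_Fock[OF scale(1)], of c] scale(2)
    show ?case by eventually_elim simp
  qed
  have "N (\<lambda>w. A g w - B g w) \<le> (K + L) * \<epsilon>" if \<epsilon>: "\<epsilon> > 0" for \<epsilon>
  proof -
    obtain f where f: "f \<in> Espan" "N (\<lambda>w. g w - f w) < \<epsilon>" using Espan_dense[OF g \<epsilon>] by blast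
    note fF = Espan_Fock[OF f(1)]
    have "N (\<lambda>w. A g w - B g w) \<le> N (\<lambda>w. A g w - A f w) + N (\<lambda>w. A f w - B g w)"
      by (rule N_triangle_diff) (intro Fock_L2 a(1) b(1) g fF)+
    moreover have "N (\<lambda>w. A f w - B g w) \<le> N (\<lambda>w. A f w - B f w) + N (\<lambda>w. B f w - B g w)"
      by (rule N_triangle_diff) (intro Fock_L2 a(1) b(1) g fF)+
    moreover have "N (\<lambda>w. A f w - B f w) = 0" by (intro N_zero_AE sp f Fock_L2 a(1) b(1) fF)
    moreover have "N (\<lambda>w. A g w - A f w) \<le> K * \<epsilon>"
      using bounded_operator_diff_le[OF A K(2) g fF] mult_left_mono[OF less_imp_le[OF f(2)] K(1)] by linarith
    moreover have "N (\<lambda>w. B f w - B g w) \<le> L * \<epsilon>"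
      using bounded_operator_diff_le[OF B L(2) g fF] mult_left_mono[OF less_imp_le[OF f(2)] L(1)]
        N_minus_commute[of "B f" "B g"] by linarith
    ultimately show ?thesis by (simp add: ring_distribs)
  qed
  note bd = this
  have "N (\<lambda>w. A g w - B g w) \<le> 0"
  proof (rule field_le_epsilon)
    fix e :: real assume e: "e > 0"
    \<comment> \<open>The summand 1 keeps the denominator positive when both bounds are
      zero.\<close>
    have "N (\<lambda>w. A g w - B g w) \<le> (K + L) * (e / (K + L + 1))" using K L e by (intro bd) auto
    also have "\<dots> \<le> e" using K(1) L(1) e by (simp add: field_simps)
    finally show "N (\<lambda>w. A g w - B g w) \<le> 0 + e" by simp
  qed
  then have "N (\<lambda>w. A g w - B g w) = 0" using N_nonneg[of "\<lambda>w. A g w - B g w"] by simp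
  then have "AE w in \<mu>. A g w - B g w = 0"
    by (intro N_eq_0_AE L2_diff Fock_L2 a(1) b(1) g)
  then show ?thesis by eventually_elim simp
qed

lemma toeplitz_props:
  assumes m: "\<phi> \<in> borel_measurable \<mu>" and b: "AE w in \<mu>. cmod (\<phi> w) \<le> K" and K: "K \<ge> 0"
    and g: "g \<in> L2 t"
  shows "toeplitz t \<phi> g \<in> Fock t" "q \<in> Fock t \<Longrightarrow> ip (toeplitz t \<phi> g) q = ip (\<lambda>w. \<phi> w * g w) q"
    "N (toeplitz t \<phi> g) \<le> K * N g"
proof -
  note L = L2_mult_bounded[OF g m b]
  show "toeplitz t \<phi> g \<in> Fock t" "q \<in> Fock t \<Longrightarrow> ip (toeplitz t \<phi> g) q = ip (\<lambda>w. \<phi> w * g w) q"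
    unfolding toeplitz_def by (simp_all add: Fock_proj_props[OF L])
  show "N (toeplitz t \<phi> g) \<le> K * N g"
    unfolding toeplitz_def using N_Fock_proj[OF L] N_mult_bounded[OF g m b K] by linarith
qed

lemma toeplitz_bounded_operator:
  assumes m: "\<phi> \<in> borel_measurable \<mu>" and b: "AE w in \<mu>. cmod (\<phi> w) \<le> K" and K: "K \<ge> 0"
  shows "toeplitz t \<phi> \<in> bounded_operators t"
proof -
  note T = toeplitz_props[OF m b K Fock_L2] and M = L2_mult_bounded[OF Fock_L2 m b]
  have "AE w in \<mu>. toeplitz t \<phi> (\<lambda>x. f x + g x) w = toeplitz t \<phi> f w + toeplitz t \<phi> g w"
    if f: "f \<in> Fock t" and g: "g \<in> Fock t" for f g
  proof (rule Fock_eq_AE'[OF T(1)[OF Fock_add[OF f g]] Fock_add[OF T(1)[OF f] T(1)[OF g]]])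
    fix q assume q: "q \<in> Fock t"
    have "(\<lambda>w. \<phi> w * (f w + g w)) = (\<lambda>w. \<phi> w * f w + \<phi> w * g w)" by (simp add: ring_distribs)
    then show "ip (toeplitz t \<phi> (\<lambda>x. f x + g x)) q = ip (\<lambda>w. toeplitz t \<phi> f w + toeplitz t \<phi> g w) q"
      using f g q by (simp add: T(1,2) Fock_add ip_add_left M Fock_L2)
  qed
  moreover have "AE w in \<mu>. toeplitz t \<phi> (\<lambda>x. c * f x) w = c * toeplitz t \<phi> f w" if f: "f \<in> Fock t" for f c
  proof (rule Fock_eq_AE'[OF T(1)[OF Fock_scale[OF f]] Fock_scale[OF T(1)[OF f]]])
    fix q assume q: "q \<in> Fock t"
    have "(\<lambda>w. \<phi> w * (c * f w)) = (\<lambda>w. c * (\<phi> w * f w))" by (simp add: mult_ac)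
    then show "ip (toeplitz t \<phi> (\<lambda>x. c * f x)) q = ip (\<lambda>w. c * toeplitz t \<phi> f w) q"
      using f q by (simp add: T(2) Fock_scale ip_scale_left)
  qed
  moreover have "\<exists>K. \<forall>f\<in>Fock t. N (toeplitz t \<phi> f) \<le> K * N f" using T(3) by (intro exI[of _ K] ballI)
  ultimately show ?thesis using T(1) unfolding bounded_operators_def by blast
qed

subsection \<open>Weyl operators as Toeplitz operators\<close>

definition phase :: "(nat \<Rightarrow> complex) \<Rightarrow> hfun" where
  "phase z w = exp (2 * \<i> * complex_of_real (sigma_fun t z w))"

lemma phase_norm: "cmod (phase z w) = 1"
  by (simp add: phase_def norm_exp)

lemma phase_measurable: "z \<in> H_half t \<Longrightarrow> phase z \<in> borel_measurable \<mu>"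
proof -
  assume "z \<in> H_half t"
  then have [measurable]: "X z \<in> borel_measurable \<mu>" by (rule X_measurable)
  show ?thesis unfolding phase_def[abs_def] sigma_fun_def[abs_def] by measurable
qed

text \<open>The exponent of the symbol is \<open>X z\<close> minus its conjugate. The first term
  joins the left coherent state and the second the right one, shifting them by \<open>z\<close> and
  by minus \<open>z\<close>.\<close>

lemma ip_phase_coh:
  assumes z: "z \<in> H_half t" and a: "a \<in> H_half t" and b: "b \<in> H_half t"
  shows "ip (\<lambda>w. phase z w * coh a w) (coh b) = exp (ip_half t (\<lambda>i. b i - z i) (\<lambda>i. z i + a i))"
proof -
  note za = H_half_add[OF z a] and bz = H_half_diff[OF b z]
  have mz: "(\<lambda>i. -1 * z i) \<in> H_half t" by (rule H_half_scale[OF z])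
  have "ip (\<lambda>w. phase z w * coh a w) (coh b) = ip (coh (\<lambda>i. z i + a i)) (coh (\<lambda>i. b i - z i))"
    unfolding L2_ip_def
  proof (rule integral_cong_AE)
    show "AE w in \<mu>. phase z w * coh a w * cnj (coh b w) = coh (\<lambda>i. z i + a i) w * cnj (coh (\<lambda>i. b i - z i) w)"
      using X_add[OF z a] X_add[OF b mz] X_scale[OF z, of "-1"]
    proof eventually_elim
      case (elim w)
      have "2 * \<i> * complex_of_real (sigma_fun t z w) = X z w - cnj (X z w)"
        by (simp add: sigma_fun_def complex_eq_iff)
      then have "phase z w * coh a w * cnj (coh b w) = exp ((X z w - cnj (X z w)) + X a w + cnj (X b w))"
        by (simp only: phase_def coh_def exp_cnj exp_add)
      also have "\<dots> = exp ((X z w + X a w) + cnj (X b w + cnj (-1) * X z w))"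
        by (rule arg_cong[where f=exp]) simp
      also have "\<dots> = coh (\<lambda>i. z i + a i) w * cnj (coh (\<lambda>i. b i + -1 * z i) w)"
        unfolding coh_def elim exp_cnj exp_add[symmetric] ..
      finally show ?case by simp
    qed
  qed (use coh_measurable[OF za] coh_measurable[OF bz] coh_measurable[OF a] coh_measurable[OF b] phase_measurable[OF z] in measurable)
  also have "\<dots> = exp (ip_half t (\<lambda>i. b i - z i) (\<lambda>i. z i + a i))" by (rule ip_coh[OF za bz])
  finally show ?thesis .
qed

text \<open>The intended Weyl operator. The scalar compensates the loss of norm under compression to
  the Fock space.\<close>

definition U :: "(nat \<Rightarrow> complex) \<Rightarrow> hfun \<Rightarrow> hfun" where
  "U z g = (\<lambda>w. complex_of_real (exp ((nh z)\<^sup>2 / 2)) * toeplitz t (phase z) g w)"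

lemma U_props:
  assumes z: "z \<in> H_half t" and g: "g \<in> Fock t"
  shows "U z g \<in> Fock t"
    "q \<in> Fock t \<Longrightarrow> ip (U z g) q = complex_of_real (exp ((nh z)\<^sup>2 / 2)) * ip (\<lambda>w. phase z w * g w) q"
  using toeplitz_props[OF phase_measurable[OF z], of 1 g] phase_norm g
  by (auto simp: U_def ip_scale_left Fock_L2 intro: Fock_scale)

lemma U_bounded_operator:
  assumes z: "z \<in> H_half t"
  shows "U z \<in> bounded_operators t"
proof -
  have T: "toeplitz t (phase z) \<in> bounded_operators t"
    by (rule toeplitz_bounded_operator[OF phase_measurable[OF z], of 1]) (auto simp: phase_norm)
  note D = bounded_operatorsD[OF T]
  obtain K where K: "K \<ge> 0" "\<And>f. f \<in> Fock t \<Longrightarrow> N (toeplitz t (phase z) f) \<le> K * N f" using bounded_operator_bound[OF T] by blast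
  let ?c = "complex_of_real (exp ((nh z)\<^sup>2 / 2))"
  have "AE w in \<mu>. U z (\<lambda>x. f x + g x) w = U z f w + U z g w" if f: "f \<in> Fock t" and g: "g \<in> Fock t" for f g
    using D(2)[OF f g] by eventually_elim (simp add: U_def ring_distribs)
  moreover have "AE w in \<mu>. U z (\<lambda>x. c * f x) w = c * U z f w" if f: "f \<in> Fock t" for f c
    using D(3)[OF f, of c] by eventually_elim (simp add: U_def mult_ac)
  moreover have "N (U z f) \<le> (cmod ?c * K) * N f" if f: "f \<in> Fock t" for f
    using mult_left_mono[OF K(2)[OF f] norm_ge_zero[of ?c]] unfolding U_def N_scale by (simp add: mult.assoc)
  ultimately show ?thesis using U_props(1)[OF z] unfolding bounded_operators_def by blast
qed

text \<open>Inner products with all \<open>E b\<close> decide. The kernel computation produces minus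
  the squared norm of \<open>z\<close> in the exponent, and the scalar in \<open>U\<close> halves
  it, which is the normalisation of a unitary operator.\<close>

lemma U_coh:
  assumes z: "z \<in> H_half t" and a: "a \<in> H_half t"
  shows "AE w in \<mu>. U z (coh a) w = exp (- of_real ((nh z)\<^sup>2 / 2) - ip_half t z a) * coh (\<lambda>i. z i + a i) w"
proof (rule Fock_eq_AE[OF U_props(1)[OF z coh_limit(1)[OF a]] Fock_scale[OF coh_limit(1)[OF H_half_add[OF z a]]]])
  fix b assume bf: "b \<in> fin_supp"
  note b = fin_supp_H_half[OF bf] and za = H_half_add[OF z a]
  have eb: "ip f (E b) = ip f (coh b)" if "f \<in> L2 t" for f
    by (rule ip_cong_AE[OF that that E_L2[OF bf] coh_L2[OF b]]) (use E_coh_AE[OF bf] in auto)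
  have s: "ip_half t (\<lambda>i. b i - z i) (\<lambda>i. z i + a i) = ip_half t b z + ip_half t b a - of_real ((nh z)\<^sup>2) - ip_half t z a"
    by (simp add: ip_half_diff_left ip_half_add_right ip_summable_H_half H_half_add z a b ip_half_nh[OF z])
  have "ip (U z (coh a)) (E b) = ip (U z (coh a)) (coh b)"
    by (rule eb[OF Fock_L2[OF U_props(1)[OF z coh_limit(1)[OF a]]]])
  also have "\<dots> = complex_of_real (exp ((nh z)\<^sup>2 / 2)) * exp (ip_half t b z + ip_half t b a - of_real ((nh z)\<^sup>2) - ip_half t z a)"
    by (simp only: U_props(2)[OF z coh_limit(1)[OF a] coh_limit(1)[OF b]] ip_phase_coh[OF z a b] s)
  also have "\<dots> = exp (of_real ((nh z)\<^sup>2 / 2) + (ip_half t b z + ip_half t b a - of_real ((nh z)\<^sup>2) - ip_half t z a))"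
    by (simp only: exp_of_real[symmetric] exp_add)
  also have "of_real ((nh z)\<^sup>2 / 2) + (ip_half t b z + ip_half t b a - of_real ((nh z)\<^sup>2) - ip_half t z a)
     = (- of_real ((nh z)\<^sup>2 / 2) - ip_half t z a) + ip_half t b (\<lambda>i. z i + a i)"
    by (simp add: ip_half_add_right ip_summable_H_half z a b)
  also have "exp \<dots> = ip (\<lambda>w. exp (- of_real ((nh z)\<^sup>2 / 2) - ip_half t z a) * coh (\<lambda>i. z i + a i) w) (coh b)"
    by (simp only: ip_scale_left ip_coh[OF za b] exp_add)
  also have "\<dots> = ip (\<lambda>w. exp (- of_real ((nh z)\<^sup>2 / 2) - ip_half t z a) * coh (\<lambda>i. z i + a i) w) (E b)"
    by (rule eb[symmetric, OF L2_scale[OF coh_L2[OF za]]])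
  finally show "ip (U z (coh a)) (E b) = ip (\<lambda>w. exp (- of_real ((nh z)\<^sup>2 / 2) - ip_half t z a) * coh (\<lambda>i. z i + a i) w) (E b)" .
qed

lemma U_E:
  assumes z: "z \<in> H_half t" and a: "a \<in> fin_supp"
  shows "AE w in \<mu>. U z (E a) w = exp (- of_real ((nh z)\<^sup>2 / 2) - ip_half t z a) * coh (\<lambda>i. z i + a i) w"
  using U_coh[OF z fin_supp_H_half[OF a]]
    bounded_operator_cong_AE[OF U_bounded_operator[OF z] coh_limit(1)[OF fin_supp_H_half[OF a]] E_Fock[OF a] E_coh_AE[OF a]]
  by eventually_elim simp

lemma U_E_isometry:
  assumes z: "z \<in> H_half t" and a: "a \<in> fin_supp" and b: "b \<in> fin_supp"
  shows "ip (U z (E a)) (U z (E b)) = ip (E a) (E b)"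
proof -
  note ah = fin_supp_H_half[OF a] and bh = fin_supp_H_half[OF b]
  note za = H_half_add[OF z ah] and zb = H_half_add[OF z bh]
  let ?e = "\<lambda>a. exp (- of_real ((nh z)\<^sup>2 / 2) - ip_half t z a)"
  have "ip (U z (E a)) (U z (E b)) = ip (\<lambda>w. ?e a * coh (\<lambda>i. z i + a i) w) (\<lambda>w. ?e b * coh (\<lambda>i. z i + b i) w)"
    by (rule ip_cong_AE) (intro Fock_L2 U_props(1) z E_Fock a b L2_scale coh_L2 za zb U_E)+
  also have "\<dots> = ?e a * cnj (?e b) * exp (ip_half t (\<lambda>i. z i + b i) (\<lambda>i. z i + a i))"
    by (simp add: ip_scale_left ip_scale_right ip_coh za zb)
  also have "cnj (?e b) = exp (- of_real ((nh z)\<^sup>2 / 2) - ip_half t b z)"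
    by (simp add: exp_cnj ip_half_cnj[OF ip_summable_H_half[OF z bh]])
  also have "ip_half t (\<lambda>i. z i + b i) (\<lambda>i. z i + a i) = of_real ((nh z)\<^sup>2) + ip_half t z a + ip_half t b z + ip_half t b a"
    by (simp add: ip_half_add_left ip_half_add_right ip_summable_H_half za z ah bh ip_half_nh[OF z])
  also have "?e a * exp (- of_real ((nh z)\<^sup>2 / 2) - ip_half t b z) * exp (of_real ((nh z)\<^sup>2) + ip_half t z a + ip_half t b z + ip_half t b a)
     = exp (ip_half t b a)"
    unfolding exp_add[symmetric] by (rule arg_cong[where f=exp]) simp
  finally show ?thesis by (simp add: ip_E a b)
qed

lemma U_add_ip:
  assumes z: "z \<in> H_half t" and f: "f \<in> Fock t" and g: "g \<in> Fock t" and h: "h \<in> Fock t"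
  shows "ip (U z (\<lambda>w. f w + g w)) h = ip (U z f) h + ip (U z g) h"
proof -
  have "ip (U z (\<lambda>w. f w + g w)) h = ip (\<lambda>w. U z f w + U z g w) h"
    by (rule ip_cong_AE) (intro Fock_L2 U_props(1) z f g h Fock_add bounded_operatorsD(2)[OF U_bounded_operator[OF z]] AE_I2 refl)+
  then show ?thesis by (simp add: ip_add_left Fock_L2 U_props(1) z f g h)
qed

lemma U_scale_ip:
  assumes z: "z \<in> H_half t" and f: "f \<in> Fock t" and h: "h \<in> Fock t"
  shows "ip (U z (\<lambda>w. c * f w)) h = c * ip (U z f) h"
proof -
  have "ip (U z (\<lambda>w. c * f w)) h = ip (\<lambda>w. c * U z f w) h"
    by (rule ip_cong_AE) (intro Fock_L2 U_props(1) z f h Fock_scale bounded_operatorsD(3)[OF U_bounded_operator[OF z]] AE_I2 refl)+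
  then show ?thesis by (simp add: ip_scale_left)
qed

lemma U_Espan_isometry:
  assumes z: "z \<in> H_half t" and f: "f \<in> Espan" and g: "g \<in> Espan"
  shows "ip (U z f) (U z g) = ip f g"
  using f
proof induction
  case (base a)
  have "cnj (ip (U z g) (U z (E a))) = cnj (ip g (E a))"
    using g
  proof induction
    case (base b) then show ?case by (simp only: U_E_isometry[OF z base \<open>a \<in> fin_supp\<close>])
  next
    case (add f g)
    then show ?case
      by (simp add: U_add_ip z Espan_Fock U_props(1) E_Fock \<open>a \<in> fin_supp\<close> ip_add_left Fock_L2)
  next
    case (scale f c)
    then show ?case
      by (simp add: U_scale_ip z Espan_Fock U_props(1) E_Fock \<open>a \<in> fin_supp\<close> ip_scale_left)
  qed
  then show ?case by (simp only: ip_cnj)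
next
  case (add f f')
  then show ?case by (simp add: U_add_ip z Espan_Fock U_props(1) g ip_add_left Fock_L2)
next
  case (scale f c)
  then show ?case by (simp add: U_scale_ip z Espan_Fock U_props(1) g ip_scale_left)
qed

text \<open>As a Toeplitz operator \<open>U z\<close> is only bounded by the scalar in its
  definition. On \<open>Espan\<close> it preserves inner products, as the explicit action on
  coherent states shows, and density carries the bound 1 to the Fock space.\<close>

lemma N_U_le:
  assumes z: "z \<in> H_half t" and g: "g \<in> Fock t"
  shows "N (U z g) \<le> N g"
proof -
  note A = U_bounded_operator[OF z]
  obtain K where K: "K \<ge> 0" "\<And>f. f \<in> Fock t \<Longrightarrow> N (U z f) \<le> K * N f" using bounded_operator_bound[OF A] by blast
  show ?thesis
  proof (rule field_le_epsilon)
    fix e :: real assume e: "e > 0"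
    then have d: "e / (K + 1) > 0" using K(1) by simp
    obtain f where f: "f \<in> Espan" "N (\<lambda>w. g w - f w) < e / (K + 1)" using Espan_dense[OF g d] by blast
    note fF = Espan_Fock[OF f(1)]
    have "complex_of_real ((N (U z f))\<^sup>2) = of_real ((N f)\<^sup>2)"
      using U_Espan_isometry[OF z f(1) f(1)] by (simp only: ip_self)
    then have eq: "N (U z f) = N f" using N_nonneg by (simp only: of_real_eq_iff power2_eq_iff_nonneg)
    have "N (U z g) \<le> N (U z f) + N (\<lambda>w. U z g w - U z f w)"
      by (intro N_le_add_diff Fock_L2 U_props(1) z g fF)
    also have "\<dots> \<le> N f + K * N (\<lambda>w. g w - f w)"
      unfolding eq using bounded_operator_diff_le[OF A K(2) g fF] by simp
    finally have 1: "N (U z g) \<le> N f + K * N (\<lambda>w. g w - f w)" .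
    have 2: "N f \<le> N g + N (\<lambda>w. g w - f w)"
      using N_le_add_diff[OF Fock_L2[OF fF] Fock_L2[OF g]] N_minus_commute[of f g] by simp
    have "(K + 1) * N (\<lambda>w. g w - f w) \<le> (K + 1) * (e / (K + 1))"
      using f(2) K(1) by (intro mult_left_mono) auto
    also have "\<dots> = e" using K(1) by simp
    finally have 3: "K * N (\<lambda>w. g w - f w) + N (\<lambda>w. g w - f w) \<le> e" by (simp add: ring_distribs)
    from 1 2 3 show "N (U z g) \<le> N g + e" by argo
  qed
qed

lemma U_diff_le:
  "z \<in> H_half t \<Longrightarrow> f \<in> Fock t \<Longrightarrow> g \<in> Fock t \<Longrightarrow> N (\<lambda>w. U z f w - U z g w) \<le> N (\<lambda>w. f w - g w)"
  using bounded_operator_diff_le[OF U_bounded_operator, of z 1 f g] N_U_le by simp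

text \<open>The hypothesis \<open>real\<close> says that the symplectic form vanishes at the pair,
  so the phase of the Weyl relation disappears. It holds for real multiples of a single vector,
  which is the case used.\<close>

lemma U_compose:
  assumes x: "x \<in> H_half t" and y: "y \<in> H_half t" and real: "ip_half t x y = ip_half t y x" and g: "g \<in> Fock t"
  shows "AE w in \<mu>. U x (U y g) w = U (\<lambda>i. x i + y i) g w"
proof (rule bounded_operators_eq_AE[OF bounded_operators_compose[OF U_bounded_operator[OF x] U_bounded_operator[OF y]]
      U_bounded_operator[OF H_half_add[OF x y]] _ g])
  fix a assume af: "a \<in> fin_supp"
  note a = fin_supp_H_half[OF af] and xy = H_half_add[OF x y]
  note ya = H_half_add[OF y a]
  let ?c = "exp (- of_real ((nh y)\<^sup>2 / 2) - ip_half t y a)"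
  have 1: "AE w in \<mu>. U x (U y (E a)) w = U x (\<lambda>w. ?c * coh (\<lambda>i. y i + a i) w) w"
    by (rule bounded_operator_cong_AE[OF U_bounded_operator[OF x] U_props(1)[OF y E_Fock[OF af]]
      Fock_scale[OF coh_limit(1)[OF ya]] U_E[OF y af]])
  have 2: "AE w in \<mu>. U x (\<lambda>w. ?c * coh (\<lambda>i. y i + a i) w) w = ?c * U x (coh (\<lambda>i. y i + a i)) w"
    by (rule bounded_operatorsD(3)[OF U_bounded_operator[OF x] coh_limit(1)[OF ya]])
  have sum: "(\<lambda>i. x i + (y i + a i)) = (\<lambda>i. (x i + y i) + a i)" by (simp add: add.assoc)
  have n: "of_real ((nh (\<lambda>i. x i + y i))\<^sup>2) = of_real ((nh x)\<^sup>2) + 2 * ip_half t x y + of_real ((nh y)\<^sup>2)"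
    unfolding ip_half_nh[OF xy, symmetric] ip_half_nh[OF x, symmetric] ip_half_nh[OF y, symmetric]
    by (simp add: ip_half_add_left ip_half_add_right ip_summable_H_half xy x y real)
  have c: "?c * exp (- of_real ((nh x)\<^sup>2 / 2) - ip_half t x (\<lambda>i. y i + a i)) =
      exp (- of_real ((nh (\<lambda>i. x i + y i))\<^sup>2 / 2) - ip_half t (\<lambda>i. x i + y i) a)"
  proof -
    have m: "of_real ((nh (\<lambda>i. x i + y i))\<^sup>2 / 2) =
        (of_real ((nh x)\<^sup>2) + 2 * ip_half t x y + of_real ((nh y)\<^sup>2)) / (2 :: complex)"
      unfolding n[symmetric] by simp
    show ?thesis unfolding exp_add[symmetric] m
      ip_half_add_left[OF ip_summable_H_half[OF x a] ip_summable_H_half[OF y a]]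
      ip_half_add_right[OF ip_summable_H_half[OF x y] ip_summable_H_half[OF x a]]
      by (rule arg_cong[where f=exp]) (simp add: field_simps)
  qed
  from 1 2 U_coh[OF x ya] U_E[OF xy af] show "AE w in \<mu>. U x (U y (E a)) w = U (\<lambda>i. x i + y i) (E a) w"
    by eventually_elim (simp only: sum c[symmetric] mult.assoc)
qed

lemma N_X_diff:
  assumes y: "y \<in> H_half t" and z: "z \<in> H_half t"
  shows "N (\<lambda>w. X y w - X z w) \<le> 3 * nh (\<lambda>i. y i - z i)"
proof (rule LIMSEQ_le_const)
  note f = trunc_fin_supp and h1 = subsetD[OF fin_supp_subset_H_one trunc_fin_supp]
  let ?B = "\<lambda>n. N (\<lambda>w. lin (trunc n y) w - X y w) + 3 * (nh (\<lambda>i. trunc n y i - y i) + nh (\<lambda>i. y i - z i))"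
  have "?B \<longlonglongrightarrow> 0 + 3 * (0 + nh (\<lambda>i. y i - z i))"
    by (intro tendsto_intros X_trunc_limit nh_trunc_limit y)
  then show "?B \<longlonglongrightarrow> 3 * nh (\<lambda>i. y i - z i)" by simp
  show "\<exists>M. \<forall>n\<ge>M. N (\<lambda>w. X y w - X z w) \<le> ?B n"
  proof (intro exI allI impI)
    fix n
    have "N (\<lambda>w. X y w - X z w) \<le> N (\<lambda>w. X y w - lin (trunc n y) w) + N (\<lambda>w. lin (trunc n y) w - X z w)"
      by (rule N_triangle_diff[OF X_L2_lin(1)[OF y] lin_L2_fin_supp[OF f] X_L2_lin(1)[OF z]])
    moreover have "N (\<lambda>w. lin (trunc n y) w - X z w) \<le> 3 * nh (\<lambda>i. trunc n y i - z i)" by (rule X_L2_lin(2)[OF z h1])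
    moreover have "nh (\<lambda>i. trunc n y i - z i) \<le> nh (\<lambda>i. trunc n y i - y i) + nh (\<lambda>i. y i - z i)"
      by (rule nh_triangle_diff[OF fin_supp_H_half[OF f] y z])
    ultimately show "N (\<lambda>w. X y w - X z w) \<le> ?B n"
      using N_minus_commute[of "X y" "lin (trunc n y)"] by argo
  qed
qed

text \<open>The functionals \<open>X\<close> converge in norm, hence almost everywhere only along a
  subsequence; there the symbols converge boundedly and dominated convergence applies. The
  difference of the images is the projection of the difference of the multiplied functions, so its
  norm is no larger.\<close>

lemma U_continuous_seq:
  assumes y: "\<And>n. y n \<in> H_half t" and z: "z \<in> H_half t" and g: "g \<in> Fock t"
    and lim: "(\<lambda>n. nh (\<lambda>i. y n i - z i)) \<longlonglongrightarrow> 0"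
  shows "\<exists>r::nat\<Rightarrow>nat. strict_mono r \<and> (\<lambda>n. N (\<lambda>w. U (y (r n)) g w - U z g w)) \<longlonglongrightarrow> 0"
proof -
  note gL = Fock_L2[OF g]
  have "(\<lambda>n. N (\<lambda>w. X (y n) w - X z w)) \<longlonglongrightarrow> 0"
  proof (rule tendsto_sandwich[OF _ _ tendsto_const])
    show "(\<lambda>n. 3 * nh (\<lambda>i. y n i - z i)) \<longlonglongrightarrow> 0" using tendsto_mult_right_zero[OF lim, of 3] by simp
    show "\<forall>\<^sub>F n in sequentially. N (\<lambda>w. X (y n) w - X z w) \<le> 3 * nh (\<lambda>i. y n i - z i)"
      by (intro always_eventually allI N_X_diff y z)
  qed (simp add: N_nonneg)
  from L2_limit_AE_subseq[OF X_L2_lin(1)[OF y] X_L2_lin(1)[OF z] this]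
  obtain r :: "nat \<Rightarrow> nat" where r: "strict_mono r" "AE w in \<mu>. (\<lambda>n. X (y (r n)) w) \<longlonglongrightarrow> X z w" by blast
  define c where "c z = complex_of_real (exp ((nh z)\<^sup>2 / 2))" for z
  have cl: "(\<lambda>n. c (y (r n))) \<longlonglongrightarrow> c z"
    unfolding c_def using LIMSEQ_subseq_LIMSEQ[OF nh_tendsto[OF y z lim] r(1)]
    by (intro tendsto_intros) (auto simp: o_def)
  let ?F = "\<lambda>z w. c z * (phase z w * g w)"
  have FL: "?F z \<in> L2 t" if "z \<in> H_half t" for z
    by (intro L2_scale L2_mult_bounded[OF gL phase_measurable[OF that], of 1]) (simp add: phase_norm)
  obtain C where C: "\<And>n. norm (c (y (r n))) \<le> C" using convergent_imp_Bseq[of "\<lambda>n. c (y (r n))"] cl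
    by (auto simp: convergent_def Bseq_def)
  have "(\<lambda>n. N (\<lambda>w. ?F (y (r n)) w - ?F z w)) \<longlonglongrightarrow> 0"
  proof (rule N_dominated_convergence)
    show "?F (y (r n)) \<in> borel_measurable \<mu>" for n by (rule L2_measurable[OF FL[OF y]])
    show "?F z \<in> borel_measurable \<mu>" by (rule L2_measurable[OF FL[OF z]])
    show "integrable \<mu> (\<lambda>w. (C + norm (c z))\<^sup>2 * (cmod (g w))\<^sup>2)"
      by (intro integrable_mult_right L2_square_integrable gL)
    show "AE w in \<mu>. (cmod (?F (y (r n)) w - ?F z w))\<^sup>2 \<le> (C + norm (c z))\<^sup>2 * (cmod (g w))\<^sup>2" for n
    proof (rule AE_I2)
      fix w
      have "cmod (?F (y (r n)) w - ?F z w) \<le> norm (c (y (r n))) * cmod (g w) + norm (c z) * cmod (g w)"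
        by (rule order_trans[OF norm_triangle_ineq4]) (simp add: norm_mult phase_norm)
      also have "\<dots> \<le> (C + norm (c z)) * cmod (g w)"
        unfolding distrib_right using C[of n] by (intro add_right_mono mult_right_mono) auto
      finally have "(cmod (?F (y (r n)) w - ?F z w))\<^sup>2 \<le> ((C + norm (c z)) * cmod (g w))\<^sup>2"
        by (rule power_mono) simp
      then show "(cmod (?F (y (r n)) w - ?F z w))\<^sup>2 \<le> (C + norm (c z))\<^sup>2 * (cmod (g w))\<^sup>2"
        by (simp only: power_mult_distrib)
    qed
    show "AE w in \<mu>. (\<lambda>n. ?F (y (r n)) w) \<longlonglongrightarrow> ?F z w"
      using r(2)
    proof eventually_elim
      case (elim w)
      then show ?case unfolding phase_def sigma_fun_def
        by (intro tendsto_mult cl tendsto_const tendsto_exp tendsto_of_real tendsto_Im)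
    qed
  qed
  note F0 = this
  have le: "N (\<lambda>w. U (y (r n)) g w - U z g w) \<le> N (\<lambda>w. ?F (y (r n)) w - ?F z w)" for n
  proof -
    let ?G = "\<lambda>w. ?F (y (r n)) w - ?F z w"
    have GL: "?G \<in> L2 t" by (rule L2_diff[OF FL[OF y] FL[OF z]])
    have d: "(\<lambda>w. U (y (r n)) g w - U z g w) \<in> Fock t" by (intro Fock_diff U_props(1) y z g)
    have "AE w in \<mu>. Fock_proj t ?G w = U (y (r n)) g w - U z g w"
    proof (rule Fock_eq_AE'[OF Fock_proj_props(1)[OF GL] d])
      fix q assume q: "q \<in> Fock t"
      have "ip (Fock_proj t ?G) q = ip (?F (y (r n))) q - ip (?F z) q"
        unfolding Fock_proj_props(2)[OF GL q] by (rule ip_diff_left[OF FL[OF y] FL[OF z] Fock_L2[OF q]])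
      also have "\<dots> = ip (U (y (r n)) g) q - ip (U z g) q"
        by (simp only: ip_scale_left U_props(2)[OF y g q] U_props(2)[OF z g q] c_def)
      also have "\<dots> = ip (\<lambda>w. U (y (r n)) g w - U z g w) q"
        by (rule ip_diff_left[symmetric]) (intro Fock_L2 U_props(1) y z g q)+
      finally show "ip (Fock_proj t ?G) q = ip (\<lambda>w. U (y (r n)) g w - U z g w) q" .
    qed
    then have "N (\<lambda>w. U (y (r n)) g w - U z g w) = N (Fock_proj t ?G)"
      using L2_measurable[OF Fock_L2[OF d]] L2_measurable[OF Fock_L2[OF Fock_proj_props(1)[OF GL]]]
      by (intro N_cong_AE) auto
    then show ?thesis using N_Fock_proj[OF GL] by simp
  qed
  have "(\<lambda>n. N (\<lambda>w. U (y (r n)) g w - U z g w)) \<longlonglongrightarrow> 0"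
    by (rule tendsto_sandwich[OF _ _ tendsto_const F0]) (simp_all add: N_nonneg le)
  with r(1) show ?thesis by (intro exI[of _ r] conjI)
qed

text \<open>A subsequence is enough here: a sequence of parameters staying bad would have a good
  subsequence.\<close>

lemma U_continuous:
  assumes z: "z \<in> H_half t" and g: "g \<in> Fock t" and e: "e > 0"
  shows "\<exists>r>0. \<forall>y\<in>H_half t. nh (\<lambda>i. y i - z i) < r \<longrightarrow> N (\<lambda>w. U y g w - U z g w) < e"
proof (rule ccontr)
  assume H: "\<not> ?thesis"
  have "\<exists>y\<in>H_half t. nh (\<lambda>i. y i - z i) < inverse (real (Suc n)) \<and> N (\<lambda>w. U y g w - U z g w) \<ge> e" for n
  proof (rule ccontr)
    assume "\<not> (\<exists>y\<in>H_half t. nh (\<lambda>i. y i - z i) < inverse (real (Suc n)) \<and> N (\<lambda>w. U y g w - U z g w) \<ge> e)"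
    then have "\<forall>y\<in>H_half t. nh (\<lambda>i. y i - z i) < inverse (real (Suc n)) \<longrightarrow> N (\<lambda>w. U y g w - U z g w) < e"
      by (simp add: not_le)
    then have "\<exists>r>0. \<forall>y\<in>H_half t. nh (\<lambda>i. y i - z i) < r \<longrightarrow> N (\<lambda>w. U y g w - U z g w) < e"
      by (intro exI[of _ "inverse (real (Suc n))"] conjI) simp_all
    with H show False by (rule notE)
  qed
  then have "\<forall>n. \<exists>y. y \<in> H_half t \<and> nh (\<lambda>i. y i - z i) < inverse (real (Suc n)) \<and> N (\<lambda>w. U y g w - U z g w) \<ge> e"
    unfolding Bex_def by (rule allI)
  from choice[OF this] obtain y where y: "\<And>n. y n \<in> H_half t" "\<And>n. nh (\<lambda>i. y n i - z i) < inverse (real (Suc n))"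
    "\<And>n. N (\<lambda>w. U (y n) g w - U z g w) \<ge> e" by blast
  have "(\<lambda>n. nh (\<lambda>i. y n i - z i)) \<longlonglongrightarrow> 0"
    by (rule tendsto_sandwich[OF _ _ tendsto_const LIMSEQ_inverse_real_of_nat])
      (intro always_eventually allI nh_nonneg H_half_diff y(1) z less_imp_le[OF y(2)])+
  from U_continuous_seq[OF y(1) z g this] obtain r :: "nat \<Rightarrow> nat" where
    "(\<lambda>n. N (\<lambda>w. U (y (r n)) g w - U z g w)) \<longlonglongrightarrow> 0" by blast
  from order_tendstoD(2)[OF this e] obtain n where "N (\<lambda>w. U (y (r n)) g w - U z g w) < e"
    by (auto simp: eventually_sequentially)
  then show False using y(3)[of "r n"] by simp
qed

lemma poly_prod: "finite A \<Longrightarrow> (\<And>i. i \<in> A \<Longrightarrow> p i \<in> analytic_polys) \<Longrightarrow> (\<lambda>w. \<Prod>i\<in>A. p i w) \<in> analytic_polys"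
  by (induction rule: finite_induct) (auto simp: poly_const intro: poly_mult)

lemma poly_shift: "p \<in> analytic_polys \<Longrightarrow> (\<lambda>w. p (\<lambda>n. w n - y n)) \<in> analytic_polys"
proof (induction rule: poly_induct)
  case (monomial \<alpha>)
  have "(\<lambda>w. w i - y i) \<in> analytic_polys" for i
    using poly_add[OF poly_coord[of i] poly_const[of "- y i"]] by simp
  from poly_prod[OF monomial poly_power[OF this]] show ?case by (simp add: monomial_def)
qed (auto intro: poly_zero poly_add poly_scale)

lemma weyl_poly_measurable:
  assumes y: "y \<in> H_one t" and p: "p \<in> analytic_polys"
  shows "weyl_poly t y p \<in> borel_measurable \<mu>"
proof -
  have [measurable]: "(\<lambda>w. p (\<lambda>n. w n - y n)) \<in> borel_measurable \<mu>" "lin y \<in> borel_measurable \<mu>"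
    using poly_growth_measurable[OF poly_shift[OF p]] L2_measurable[OF lin_H_one(1)[OF y]] by auto
  show ?thesis unfolding weyl_poly_def[abs_def] by measurable
qed

text \<open>The formula in \<open>weyl_poly\<close> makes sense for any function, and on coherent
  states it can be evaluated: the shift by \<open>y\<close> only contributes a scalar. Polynomials
  are reached afterwards as limits.\<close>

lemma weyl_poly_Espan:
  assumes y: "y \<in> H_one t" and f: "f \<in> Espan"
  shows "AE w in \<mu>. weyl_poly t y f w = U y f w"
proof -
  note yh = subsetD[OF H_one_subset_H_half y]
  note B = bounded_operatorsD[OF U_bounded_operator[OF yh]]
  show ?thesis using f
  proof induction
    case (base a)
    have "AE w in \<mu>. w \<in> ell2" by (rule AE_I2) (simp add: space_gaussian)
    with U_E[OF yh base] X_add[OF yh fin_supp_H_half[OF base]] X_H_one[OF y] X_H_one[OF subsetD[OF fin_supp_subset_H_one base]]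
    show ?case
    proof eventually_elim
      case (elim w)
      have "ip_half t (\<lambda>n. w n - y n) a = lin a w - ip_half t y a"
        by (rule ip_half_diff_left[OF ip_summable_fin_supp[OF base] ip_summable_fin_supp[OF base]])
      then have "weyl_poly t y (E a) w = exp (lin y w - of_real ((nh y)\<^sup>2 / 2)) * exp (lin a w - ip_half t y a)"
        by (simp only: weyl_poly_def E_def)
      also have "\<dots> = exp (- of_real ((nh y)\<^sup>2 / 2) - ip_half t y a) * exp (lin y w + lin a w)"
        unfolding exp_add[symmetric] by (rule arg_cong[where f=exp]) simp
      finally show ?case using elim by (simp add: coh_def)
    qed
  next
    case (add f g)
    from B(2)[OF Espan_Fock[OF add(1)] Espan_Fock[OF add(2)]] add(3,4)
    show ?case by eventually_elim (simp add: weyl_poly_def ring_distribs)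
  next
    case (scale f c)
    from B(3)[OF Espan_Fock[OF scale(1)], of c] scale(2)
    show ?case by eventually_elim (simp add: weyl_poly_def mult_ac)
  qed
qed

text \<open>Along approximants from \<open>Espan\<close> the left side converges pointwise and the
  right side in norm, by contractivity. The two limits must coincide almost everywhere.\<close>

lemma weyl_poly_AE:
  assumes y: "y \<in> H_one t" and p: "p \<in> analytic_polys"
  shows "weyl_poly t y p \<in> L2 t" "AE w in \<mu>. weyl_poly t y p w = U y p w"
proof -
  note yh = subsetD[OF H_one_subset_H_half y]
  obtain L where L: "\<And>n. L n \<in> Espan" "\<And>w. (\<lambda>n. L n w) \<longlonglongrightarrow> p w"
    "(\<lambda>n. N (\<lambda>w. L n w - p w)) \<longlonglongrightarrow> 0" using poly_approx[OF p] by blast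
  have "AE w in \<mu>. \<forall>n. weyl_poly t y (L n) w = U y (L n) w"
    unfolding AE_all_countable using weyl_poly_Espan[OF y L(1)] by blast
  then have lim: "AE w in \<mu>. (\<lambda>n. U y (L n) w) \<longlonglongrightarrow> weyl_poly t y p w"
  proof eventually_elim
    case (elim w)
    have "(\<lambda>n. weyl_poly t y (L n) w) \<longlonglongrightarrow> weyl_poly t y p w"
      unfolding weyl_poly_def by (intro tendsto_mult tendsto_const L(2))
    then show ?case using elim by simp
  qed
  have UL: "(\<lambda>n. N (\<lambda>w. U y (L n) w - U y p w)) \<longlonglongrightarrow> 0"
    by (rule tendsto_sandwich[OF _ _ tendsto_const L(3)])
      (rule always_eventually, rule allI, rule N_nonneg U_diff_le[OF yh Espan_Fock[OF L(1)] poly_Fock[OF p]])+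
  have "AE w in \<mu>. U y p w = weyl_poly t y p w"
    by (rule L2_limit_unique_AE[OF _ _ UL lim]) (intro Fock_L2 U_props(1) yh Espan_Fock L(1) poly_Fock p)+
  then show ae: "AE w in \<mu>. weyl_poly t y p w = U y p w" by eventually_elim simp
  show "weyl_poly t y p \<in> L2 t"
    by (rule L2_cong_AE[OF Fock_L2[OF U_props(1)[OF yh poly_Fock[OF p]]] weyl_poly_measurable[OF y p]])
      (use ae in eventually_elim, simp)
qed

lemma N_diff_cong_AE:
  assumes "f \<in> L2 t" "f' \<in> L2 t" "g \<in> L2 t" "AE w in \<mu>. f w = f' w"
  shows "N (\<lambda>w. f w - g w) = N (\<lambda>w. f' w - g w)"
proof (rule N_cong_AE)
  show "AE w in \<mu>. f w - g w = f' w - g w" using assms(4) by eventually_elim simp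
qed (use assms L2_measurable in auto)

lemma weyl_one_AE:
  assumes y: "y \<in> H_one t" and g: "g \<in> Fock t"
  shows "weyl_one t y g \<in> L2 t" "AE w in \<mu>. weyl_one t y g w = U y g w"
proof -
  note yh = subsetD[OF H_one_subset_H_half y]
  note UL = Fock_L2[OF U_props(1)[OF yh]]
  have c: "\<exists>r>0. \<forall>p\<in>analytic_polys. N (\<lambda>w. p w - g w) < r \<longrightarrow> N (\<lambda>w. weyl_poly t y p w - U y g w) < e"
    if e: "e > 0" for e
  proof (intro exI[of _ e] conjI ballI impI e)
    fix p assume p: "p \<in> analytic_polys" "N (\<lambda>w. p w - g w) < e"
    show "N (\<lambda>w. weyl_poly t y p w - U y g w) < e"
      using N_diff_cong_AE[OF weyl_poly_AE(1)[OF y p(1)] UL[OF poly_Fock[OF p(1)]] UL[OF g] weyl_poly_AE(2)[OF y p(1)]]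
        U_diff_le[OF yh poly_Fock[OF p(1)] g] p(2) by simp
  qed
  have d: "\<exists>p\<in>analytic_polys. N (\<lambda>w. p w - g w) < r" if r: "r > 0" for r
  proof -
    obtain p where p: "p \<in> analytic_polys" "N (\<lambda>w. g w - p w) < r" using Fock_poly_approx[OF g r] by blast
    then have "N (\<lambda>w. p w - g w) < r" using N_minus_commute[of p g] by simp
    then show "\<exists>p\<in>analytic_polys. N (\<lambda>w. p w - g w) < r" using p(1) by (rule bexI)
  qed
  show "weyl_one t y g \<in> L2 t" "AE w in \<mu>. weyl_one t y g w = U y g w" unfolding weyl_one_def
    by (rule L2_extend_AE[OF UL[OF g] c weyl_poly_AE(1)[OF y] d]; assumption)+
qed

text \<open>Strong continuity makes \<open>U z g\<close> a valid value of the last extension by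
  continuity, and such values are unique up to null sets.\<close>

lemma weyl_AE:
  assumes z: "z \<in> H_half t" and g: "g \<in> Fock t"
  shows "weyl t z g \<in> Fock t" "AE w in \<mu>. weyl t z g w = U z g w"
proof -
  note UL = Fock_L2[OF U_props(1)]
  have ext: "\<exists>r>0. \<forall>y\<in>H_one t. half_dist t z y < r \<longrightarrow> N (\<lambda>w. weyl_one t y g w - U z g w) < e" if e: "e > 0" for e
  proof -
    obtain r where r: "r > 0" "\<And>y. y \<in> H_half t \<Longrightarrow> nh (\<lambda>i. y i - z i) < r \<Longrightarrow> N (\<lambda>w. U y g w - U z g w) < e"
      using U_continuous[OF z g e] by auto
    have "N (\<lambda>w. weyl_one t y g w - U z g w) < e" if y: "y \<in> H_one t" "half_dist t z y < r" for y
      using N_diff_cong_AE[OF weyl_one_AE(1)[OF y(1) g] UL[OF subsetD[OF H_one_subset_H_half y(1)] g] UL[OF z g] weyl_one_AE(2)[OF y(1) g]]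
        r(2)[OF subsetD[OF H_one_subset_H_half y(1)]] y(2) by (simp add: half_dist_def)
    then show ?thesis using r(1) by blast
  qed
  have L: "weyl t z g \<in> L2 t" and ae: "AE w in \<mu>. weyl t z g w = U z g w" unfolding weyl_def
    by (rule L2_extend_AE[OF UL[OF z g] ext weyl_one_AE(1)[OF _ g] H_one_dense[OF z]]; assumption)+
  show "AE w in \<mu>. weyl t z g w = U z g w" by (rule ae)
  show "weyl t z g \<in> Fock t"
    by (rule Fock_cong_AE[OF U_props(1)[OF z g] L2_measurable[OF L]]) (use ae in eventually_elim, simp)
qed

end

section \<open>The one-parameter group, its Laplace transforms and its generator\<close>

lemma exp_decay_limit: "k > 0 \<Longrightarrow> (\<lambda>n. exp (- k * real n)) \<longlonglongrightarrow> 0"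
proof -
  assume "k > 0"
  then have "(\<lambda>n. exp (- k) ^ n) \<longlonglongrightarrow> 0" by (intro LIMSEQ_realpow_zero) auto
  then show ?thesis by (simp add: exp_of_nat_mult[symmetric] mult.commute)
qed

lemma exp_has_vector_derivative:
  "((\<lambda>s. exp (a * complex_of_real s)) has_vector_derivative a * exp (a * of_real s)) (at s)"
proof -
  have "((\<lambda>u. exp (a * u)) has_field_derivative a * exp (a * of_real s)) (at (of_real s))"
    by (auto intro!: derivative_eq_intros)
  then show ?thesis by (rule has_vector_derivative_real_field)
qed

context gauss
begin

text \<open>Testing with \<open>q = f\<close>. This turns estimates of scalar integrals that are
  uniform in \<open>q\<close> into norm estimates.\<close>

lemma N_le_ip:
  assumes f: "f \<in> Fock t" and C: "C \<ge> 0" and b: "\<And>q. q \<in> Fock t \<Longrightarrow> cmod (ip f q) \<le> C * N q"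
  shows "N f \<le> C"
proof (cases "N f = 0")
  case False
  have "N f * N f \<le> C * N f"
    using b[OF f] by (simp add: ip_self norm_power power2_eq_square norm_mult N_nonneg)
  then show ?thesis using False N_nonneg[of f] by simp
qed (use C in simp)

lemma measurable_diff_L2: "f \<in> L2 t \<Longrightarrow> g \<in> L2 t \<Longrightarrow> (\<lambda>w. f w - g w) \<in> borel_measurable \<mu>"
  by (rule L2_measurable[OF L2_diff])

definition weyl_group :: "(nat \<Rightarrow> complex) \<Rightarrow> real \<Rightarrow> hfun \<Rightarrow> hfun" where
  "weyl_group z s = U (\<lambda>n. complex_of_real s * z n)"

context
  fixes z assumes z: "z \<in> H_half t"
begin

abbreviation "V \<equiv> weyl_group z"

lemma sz: "(\<lambda>n. complex_of_real s * z n) \<in> H_half t"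
  by (rule H_half_scale[OF z])

lemma V_Fock: "g \<in> Fock t \<Longrightarrow> V s g \<in> Fock t"
  unfolding weyl_group_def by (rule U_props(1)[OF sz])

lemma V_L2: "g \<in> Fock t \<Longrightarrow> V s g \<in> L2 t"
  by (rule Fock_L2[OF V_Fock])

lemma N_V_le: "g \<in> Fock t \<Longrightarrow> N (V s g) \<le> N g"
  unfolding weyl_group_def by (rule N_U_le[OF sz])

lemma V_diff_le: "f \<in> Fock t \<Longrightarrow> g \<in> Fock t \<Longrightarrow> N (\<lambda>w. V s f w - V s g w) \<le> N (\<lambda>w. f w - g w)"
  unfolding weyl_group_def by (rule U_diff_le[OF sz])

lemma ip_V_add: "f \<in> Fock t \<Longrightarrow> g \<in> Fock t \<Longrightarrow> q \<in> Fock t \<Longrightarrow> ip (V s (\<lambda>w. f w + g w)) q = ip (V s f) q + ip (V s g) q"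
  unfolding weyl_group_def by (rule U_add_ip[OF sz])

lemma ip_V_scale: "f \<in> Fock t \<Longrightarrow> q \<in> Fock t \<Longrightarrow> ip (V s (\<lambda>w. d * f w)) q = d * ip (V s f) q"
  unfolding weyl_group_def by (rule U_scale_ip[OF sz])

lemma ip_V_diff: "f \<in> Fock t \<Longrightarrow> g \<in> Fock t \<Longrightarrow> q \<in> Fock t \<Longrightarrow> ip (V s (\<lambda>w. f w - g w)) q = ip (V s f) q - ip (V s g) q"
  using ip_V_add[of f "\<lambda>w. -1 * g w" q s] ip_V_scale[of g q s "-1"] Fock_scale[of g "-1"] by simp

lemma V_compose: "g \<in> Fock t \<Longrightarrow> AE w in \<mu>. V s (V r g) w = V (s + r) g w"
proof -
  assume g: "g \<in> Fock t"
  have "ip_half t (\<lambda>n. complex_of_real s * z n) (\<lambda>n. complex_of_real r * z n) =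
      ip_half t (\<lambda>n. complex_of_real r * z n) (\<lambda>n. complex_of_real s * z n)"
    unfolding ip_half_def by (simp add: mult_ac)
  from U_compose[OF sz sz this g] show ?thesis by (simp add: weyl_group_def ring_distribs)
qed

lemma phase_scale_AE: "AE w in \<mu>. phase (\<lambda>n. complex_of_real s * z n) w = exp (\<i> * of_real (s * (2 * sigma_fun t z w)))"
  using X_scale[OF z, of "of_real s"]
proof eventually_elim
  case (elim w)
  have "2 * \<i> * complex_of_real (sigma_fun t (\<lambda>n. complex_of_real s * z n) w) = \<i> * of_real (s * (2 * sigma_fun t z w))"
    by (simp add: sigma_fun_def elim)
  then show ?case by (simp only: phase_def)
qed

definition fld :: "(nat \<Rightarrow> complex) \<Rightarrow> real" where "fld w = 2 * sigma_fun t z w"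
definition hv :: real where "hv = (nh z)\<^sup>2 / 2"

lemma fld_measurable [measurable]: "fld \<in> borel_measurable \<mu>"
proof -
  have [measurable]: "X z \<in> borel_measurable \<mu>" by (rule X_measurable[OF z])
  show ?thesis unfolding fld_def[abs_def] sigma_fun_def[abs_def] by measurable
qed

lemma L2_exp_fld: "g \<in> L2 t \<Longrightarrow> (\<lambda>w. exp (\<i> * of_real (s * fld w)) * g w) \<in> L2 t"
proof (rule L2_mult_bounded[of _ _ 1])
  show "(\<lambda>w. exp (\<i> * of_real (s * fld w))) \<in> borel_measurable \<mu>" by measurable
qed (simp_all add: norm_exp)

text \<open>This is the bridge between operators and symbols: a matrix coefficient of the group is a
  Gaussian factor in \<open>s\<close> times a Fourier integral of the real variable
  \<open>fld\<close>. The Gaussian factor reappears in \<open>Lap\<close>.\<close>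

lemma ip_V:
  assumes g: "g \<in> Fock t" and q: "q \<in> Fock t"
  shows "ip (V s g) q = of_real (exp (hv * s\<^sup>2)) * ip (\<lambda>w. exp (\<i> * of_real (s * fld w)) * g w) q"
proof -
  have "ip (V s g) q = of_real (exp ((nh (\<lambda>n. complex_of_real s * z n))\<^sup>2 / 2)) * ip (\<lambda>w. phase (\<lambda>n. complex_of_real s * z n) w * g w) q"
    unfolding weyl_group_def by (rule U_props(2)[OF sz g q])
  also have "ip (\<lambda>w. phase (\<lambda>n. complex_of_real s * z n) w * g w) q = ip (\<lambda>w. exp (\<i> * of_real (s * fld w)) * g w) q"
  proof (rule ip_cong_AE)
    show "AE w in \<mu>. phase (\<lambda>n. complex_of_real s * z n) w * g w = exp (\<i> * of_real (s * fld w)) * g w"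
      using phase_scale_AE[of s] by eventually_elim (simp add: fld_def)
    show "(\<lambda>w. phase (\<lambda>n. complex_of_real s * z n) w * g w) \<in> L2 t"
      by (rule L2_mult_bounded[OF Fock_L2[OF g] phase_measurable[OF sz], of _ 1]) (simp add: phase_norm)
    show "(\<lambda>w. exp (\<i> * of_real (s * fld w)) * g w) \<in> L2 t" by (rule L2_exp_fld[OF Fock_L2[OF g]])
  qed (simp_all add: Fock_L2 q)
  also have "(nh (\<lambda>n. complex_of_real s * z n))\<^sup>2 / 2 = hv * s\<^sup>2"
    by (simp add: nh_scale[OF z] power_mult_distrib hv_def)
  finally show ?thesis .
qed

lemma ip_V_zero: "g \<in> Fock t \<Longrightarrow> q \<in> Fock t \<Longrightarrow> ip (V 0 g) q = ip g q"
  by (simp add: ip_V)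

lemma V_zero_AE: "g \<in> Fock t \<Longrightarrow> AE w in \<mu>. V 0 g w = g w"
  by (rule Fock_eq_AE'[OF V_Fock]) (simp_all add: ip_V_zero)

text \<open>Conjugating the phase reverses the sign of \<open>s\<close>, while the Gaussian factor
  is even in \<open>s\<close>.\<close>

lemma ip_V_adjoint:
  assumes g: "g \<in> Fock t" and q: "q \<in> Fock t"
  shows "ip (V s g) q = ip g (V (- s) q)"
proof -
  have "ip g (V (- s) q) = cnj (ip (V (- s) q) g)" by (simp only: ip_cnj)
  also have "\<dots> = of_real (exp (hv * s\<^sup>2)) * ip g (\<lambda>w. exp (\<i> * of_real (- s * fld w)) * q w)"
    unfolding ip_V[OF q g] complex_cnj_mult ip_cnj by simp
  also have "ip g (\<lambda>w. exp (\<i> * of_real (- s * fld w)) * q w) = ip (\<lambda>w. exp (\<i> * of_real (s * fld w)) * g w) q"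
    unfolding L2_ip_def by (simp add: exp_cnj mult_ac)
  finally show ?thesis by (simp add: ip_V g q)
qed

lemma V_continuous_0:
  assumes g: "g \<in> Fock t" and e: "e > 0"
  shows "\<exists>d>0. \<forall>s. \<bar>s\<bar> < d \<longrightarrow> N (\<lambda>w. V s g w - g w) < e"
proof -
  have Z: "(\<lambda>n. complex_of_real 0 * z n) \<in> H_half t" by (rule sz)
  obtain r where r: "r > 0" "\<forall>y\<in>H_half t. nh (\<lambda>i. y i - complex_of_real 0 * z i) < r \<longrightarrow>
      N (\<lambda>w. U y g w - U (\<lambda>n. complex_of_real 0 * z n) g w) < e"
    using U_continuous[OF Z g e] by auto
  \<comment> \<open>The summand 1 covers the case that \<open>z\<close> has norm zero.\<close>
  define d where "d = r / (nh z + 1)"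
  have nz: "nh z \<ge> 0" by (rule nh_nonneg[OF z])
  have "N (\<lambda>w. V s g w - g w) < e" if s: "\<bar>s\<bar> < d" for s
  proof -
    have "nh (\<lambda>i. complex_of_real s * z i - complex_of_real 0 * z i) = \<bar>s\<bar> * nh z" by (simp add: nh_scale[OF z])
    also have "\<dots> \<le> d * nh z" using s nz by (intro mult_right_mono) auto
    also have "\<dots> < r" using r(1) nz by (simp add: d_def field_simps)
    finally have "N (\<lambda>w. V s g w - V 0 g w) < e"
      using bspec[OF r(2) sz[of s]] unfolding weyl_group_def by simp
    moreover have "N (\<lambda>w. V s g w - g w) = N (\<lambda>w. V s g w - V 0 g w)"
    proof (rule N_cong_AE)
      show "AE w in \<mu>. V s g w - g w = V s g w - V 0 g w" using V_zero_AE[OF g] by eventually_elim simp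
    qed (intro measurable_diff_L2 V_L2 Fock_L2 g)+
    ultimately show ?thesis by simp
  qed
  moreover have "d > 0" using r(1) nz by (simp add: d_def)
  ultimately show ?thesis by (intro exI[of _ d] conjI allI impI)
qed

lemma V_time_diff:
  assumes g: "g \<in> Fock t"
  shows "N (\<lambda>w. V (s + r) g w - V s g w) \<le> N (\<lambda>w. V r g w - g w)"
proof -
  have "N (\<lambda>w. V (s + r) g w - V s g w) = N (\<lambda>w. V s (V r g) w - V s g w)"
  proof (rule N_cong_AE)
    show "AE w in \<mu>. V (s + r) g w - V s g w = V s (V r g) w - V s g w"
      using V_compose[OF g, of s r] by eventually_elim simp
  qed (intro measurable_diff_L2 V_L2 V_Fock g)+
  also have "\<dots> \<le> N (\<lambda>w. V r g w - g w)" by (rule V_diff_le[OF V_Fock[OF g] g])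
  finally show ?thesis .
qed

lemma ip_V_bound:
  assumes g: "g \<in> Fock t" and q: "q \<in> Fock t"
  shows "cmod (ip (V s g) q) \<le> N g * N q"
  using order_trans[OF Cauchy_Schwarz[OF V_L2[OF g] Fock_L2[OF q]] mult_right_mono[OF N_V_le[OF g] N_nonneg]] .

lemma ip_V_continuous:
  assumes g: "g \<in> Fock t" and q: "q \<in> Fock t"
  shows "continuous_on A (\<lambda>s. ip (V s g) q)"
proof (rule continuous_at_imp_continuous_on, rule ballI)
  fix s
  show "isCont (\<lambda>s. ip (V s g) q) s"
    unfolding continuous_at_eps_delta
  proof (intro allI impI)
    fix e :: real assume e: "e > 0"
    then have e': "e / (N q + 1) > 0" using N_nonneg[of q] by simp
    obtain d where d: "d > 0" "\<And>s. \<bar>s\<bar> < d \<Longrightarrow> N (\<lambda>w. V s g w - g w) < e / (N q + 1)"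
      using V_continuous_0[OF g e'] by auto
    show "\<exists>d>0. \<forall>s'. dist s' s < d \<longrightarrow> dist (ip (V s' g) q) (ip (V s g) q) < e"
    proof (intro exI[of _ d] conjI allI impI d(1))
      fix s' assume s': "dist s' s < d"
      have "ip (V s' g) q - ip (V s g) q = ip (\<lambda>w. V s' g w - V s g w) q"
        by (rule ip_diff_left[symmetric]) (intro V_L2 Fock_L2 g q)+
      also have "cmod \<dots> \<le> N (\<lambda>w. V s' g w - V s g w) * N q"
        by (rule Cauchy_Schwarz) (intro L2_diff V_L2 Fock_L2 g q)+
      also have "\<dots> \<le> (e / (N q + 1)) * N q"
        using V_time_diff[OF g, of s "s' - s"] d(2)[of "s' - s"] s'
        by (intro mult_right_mono N_nonneg) (simp add: dist_real_def)
      also have "\<dots> < e" using e N_nonneg[of q] by (simp add: field_simps)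
      finally show "dist (ip (V s' g) q) (ip (V s g) q) < e" by (simp add: dist_norm)
    qed
  qed
qed

text \<open>Here \<open>h\<close> is the derivative at 0 of the orbit of \<open>g\<close>, without
  the factor \<i> that appears in \<open>weyl_phi\<close>.\<close>

definition gen :: "hfun \<Rightarrow> hfun \<Rightarrow> bool" where
  "gen g h \<longleftrightarrow> ((\<lambda>s::real. N (\<lambda>w. (V s g w - g w) / complex_of_real s - h w)) \<longlongrightarrow> 0) (at 0)"

text \<open>The group law moves the difference quotient at \<open>s\<close> back to 0, and
  contractivity keeps the error there. Only the weak derivative along the orbit is needed for the
  fundamental theorem of calculus.\<close>

lemma gen_derivative:
  assumes g: "g \<in> Fock t" and h: "h \<in> Fock t" and q: "q \<in> Fock t" and G: "gen g h"
  shows "((\<lambda>s. ip (V s g) q) has_vector_derivative ip (V s h) q) (at s)"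
  unfolding has_vector_derivative_def has_derivative_at
proof (intro conjI)
  show "bounded_linear (\<lambda>x. x *\<^sub>R ip (V s h) q)" by (rule bounded_linear_scaleR_left)
  have lim: "(\<lambda>r. N (\<lambda>w. (V r g w - g w) / complex_of_real r - h w) * N q) \<midarrow>0\<rightarrow> 0"
    using tendsto_mult_left_zero[OF G[unfolded gen_def]] .
  have bd: "norm (ip (V (s + r) g) q - ip (V s g) q - r *\<^sub>R ip (V s h) q) / norm r
        \<le> N (\<lambda>w. (V r g w - g w) / complex_of_real r - h w) * N q" if r: "r \<noteq> 0" for r
  proof -
    let ?d = "\<lambda>w. (1 / complex_of_real r) * (V r g w - g w) - h w"
    have d1: "(\<lambda>w. V r g w - g w) \<in> Fock t" by (intro Fock_diff V_Fock g)
    note d2 = Fock_scale[OF d1, of "1 / complex_of_real r"]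
    have d: "?d \<in> Fock t" by (rule Fock_diff[OF d2 h])
    have "ip (V s ?d) q = (1 / complex_of_real r) * (ip (V s (V r g)) q - ip (V s g) q) - ip (V s h) q"
      by (simp only: ip_V_diff[OF d2 h q] ip_V_scale[OF d1 q] ip_V_diff[OF V_Fock[OF g] g q])
    also have "ip (V s (V r g)) q = ip (V (s + r) g) q"
      by (rule ip_cong_AE[OF V_L2[OF V_Fock[OF g]] V_L2[OF g] Fock_L2[OF q] Fock_L2[OF q] V_compose[OF g]]) simp
    finally have "ip (V (s + r) g) q - ip (V s g) q - r *\<^sub>R ip (V s h) q = of_real r * ip (V s ?d) q"
      using r by (simp add: scaleR_conv_of_real field_simps)
    then have "norm (ip (V (s + r) g) q - ip (V s g) q - r *\<^sub>R ip (V s h) q) / norm r = cmod (ip (V s ?d) q)"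
      using r by (simp add: norm_mult)
    also have "\<dots> \<le> N ?d * N q" by (rule ip_V_bound[OF d q])
    finally show ?thesis by simp
  qed
  show "(\<lambda>r. norm (ip (V (s + r) g) q - ip (V s g) q - r *\<^sub>R ip (V s h) q) / norm r) \<midarrow>0\<rightarrow> 0"
  proof (rule tendsto_sandwich[OF _ _ tendsto_const lim])
    show "\<forall>\<^sub>F r in at 0. norm (ip (V (s + r) g) q - ip (V s g) q - r *\<^sub>R ip (V s h) q) / norm r
        \<le> N (\<lambda>w. (V r g w - g w) / complex_of_real r - h w) * N q"
      unfolding eventually_at_filter by (intro always_eventually allI impI bd)
  qed simp
qed

definition Lap :: "complex \<Rightarrow> real \<Rightarrow> real \<Rightarrow> complex" where
  "Lap k L y = integral {0..L} (\<lambda>s. exp (- k * of_real s + of_real (hv * s\<^sup>2)) * exp (\<i> * of_real (s * y)))"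

lemma Lap_continuous: "continuous_on A (Lap k L)"
proof -
  have "continuous_on UNIV (\<lambda>y. integral (cbox 0 L) (\<lambda>s. exp (- k * of_real s + of_real (hv * s\<^sup>2)) * exp (\<i> * of_real (s * y))))"
    by (rule integral_continuous_on_param) (unfold case_prod_unfold, intro continuous_intros)
  then have "continuous_on UNIV (Lap k L)" unfolding Lap_def[abs_def] by simp
  then show ?thesis by (rule continuous_on_subset) simp
qed

lemma Lap_bounded: "\<exists>M\<ge>0. \<forall>y. cmod (Lap k L y) \<le> M"
proof -
  let ?a = "\<lambda>s. exp (- k * complex_of_real s + of_real (hv * s\<^sup>2))"
  have i: "(\<lambda>s. cmod (?a s)) integrable_on {0..L}"
    by (intro integrable_continuous_real continuous_intros)
  have "cmod (Lap k L y) \<le> integral {0..L} (\<lambda>s. cmod (?a s))" for y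
    unfolding Lap_def
  proof (rule Henstock_Kurzweil_Integration.integral_norm_bound_integral[OF _ i])
    show "(\<lambda>s. ?a s * exp (\<i> * of_real (s * y))) integrable_on {0..L}"
      by (intro integrable_continuous_real continuous_intros)
    show "norm (?a s * exp (\<i> * of_real (s * y))) \<le> cmod (?a s)" for s
      unfolding norm_mult by simp
  qed
  moreover have "0 \<le> integral {0..L} (\<lambda>s. cmod (?a s))"
    by (rule Henstock_Kurzweil_Integration.integral_nonneg[OF i]) simp
  ultimately show ?thesis by blast
qed

lemma Lap_toeplitz:
  "\<exists>M\<ge>0. (\<lambda>w. d * Lap k L (fld w)) \<in> borel_measurable \<mu> \<and> (\<forall>w. cmod (d * Lap k L (fld w)) \<le> M)"
proof -
  have [measurable]: "Lap k L \<in> borel_measurable borel"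
    by (rule borel_measurable_continuous_onI[OF Lap_continuous])
  obtain M where M: "M \<ge> 0" "\<forall>y. cmod (Lap k L y) \<le> M" using Lap_bounded by blast
  have "cmod (d * Lap k L (fld w)) \<le> cmod d * M" for w
    unfolding norm_mult using M(2) by (intro mult_left_mono) auto
  moreover have "(\<lambda>w. d * Lap k L (fld w)) \<in> borel_measurable \<mu>" by measurable
  ultimately show ?thesis using M(1) by (intro exI[of _ "cmod d * M"]) auto
qed

text \<open>Exchanging the integrals over \<open>s\<close> and over the Gaussian measure lets
  \<open>ip_V\<close> absorb the Gaussian factor of the symbol. What remains is a truncated Laplace
  transform of the contraction group.\<close>

lemma Lap_integral:
  assumes h: "h \<in> Fock t" and q: "q \<in> Fock t"
  shows "ip (\<lambda>w. Lap k L (fld w) * h w) q = integral {0..L} (\<lambda>s. exp (- k * of_real s) * ip (V s h) q)"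
proof -
  let ?a = "\<lambda>s. exp (- k * complex_of_real s + of_real (hv * s\<^sup>2))"
  \<comment> \<open>The cutoff is put into the integrand so that Fubini's theorem can be applied
    with Lebesgue measure on the whole line.\<close>
  define A where "A s = indicator {0..L} s *\<^sub>R ?a s" for s
  define G where "G s w = A s * exp (\<i> * of_real (s * fld w)) * (h w * cnj (q w))" for s w
  have Aint: "integrable lborel A"
    unfolding A_def by (rule borel_integrable_compact) (auto intro!: continuous_intros)
  have hq: "integrable \<mu> (\<lambda>w. h w * cnj (q w))" by (rule L2_ip_integrable[OF Fock_L2[OF h] Fock_L2[OF q]])
  have [measurable]: "h \<in> borel_measurable \<mu>" "q \<in> borel_measurable \<mu>"
    using L2_measurable[OF Fock_L2] h q by auto
  have [measurable]: "A \<in> borel_measurable borel" using borel_measurable_integrable[OF Aint] by simp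
  interpret pair: pair_sigma_finite lborel \<mu> ..
  have Gn: "norm (G s w) = norm (A s) * norm (h w * cnj (q w))" for s w
    by (simp only: G_def norm_mult norm_exp_i_times mult_1_right)
  have Gint: "integrable (lborel \<Otimes>\<^sub>M \<mu>) (case_prod G)"
  proof (rule pair.Fubini_integrable)
    show "case_prod G \<in> borel_measurable (lborel \<Otimes>\<^sub>M \<mu>)" unfolding G_def by measurable
    have "(\<lambda>s. \<integral>w. norm (case (s, w) of (s, w) \<Rightarrow> G s w) \<partial>\<mu>) = (\<lambda>s. norm (A s) * (\<integral>w. norm (h w * cnj (q w)) \<partial>\<mu>))"
      by (simp only: prod.case Gn integral_mult_right_zero)
    moreover have "integrable lborel (\<lambda>s. norm (A s) * (\<integral>w. norm (h w * cnj (q w)) \<partial>\<mu>))"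
      by (intro integrable_mult_left integrable_norm Aint)
    ultimately show "integrable lborel (\<lambda>s. \<integral>w. norm (case (s, w) of (s, w) \<Rightarrow> G s w) \<partial>\<mu>)" by simp
    have "integrable \<mu> (\<lambda>w. G s w)" for s
    proof (rule Bochner_Integration.integrable_bound[OF integrable_mult_right[OF integrable_norm[OF hq], of "norm (A s)"]])
      show "AE w in \<mu>. norm (G s w) \<le> norm (norm (A s) * norm (h w * cnj (q w)))"
        by (intro AE_I2) (simp only: Gn, simp)
      show "(\<lambda>w. G s w) \<in> borel_measurable \<mu>" unfolding G_def by measurable
    qed
    then show "AE s in lborel. integrable \<mu> (\<lambda>w. case (s, w) of (s, w) \<Rightarrow> G s w)" by simp
  qed
  have HK: "integral {0..L} f = (\<integral>s. indicator {0..L} s *\<^sub>R f s \<partial>lborel)" if "continuous_on {0..L} f" for f :: "real \<Rightarrow> complex"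
    using set_borel_integral_eq_integral(2)[OF borel_integrable_atLeastAtMost'[OF that]]
    by (simp add: set_lebesgue_integral_def)
  have "ip (\<lambda>w. Lap k L (fld w) * h w) q = (\<integral>w. (\<integral>s. G s w \<partial>lborel) \<partial>\<mu>)"
    unfolding L2_ip_def
  proof (rule Bochner_Integration.integral_cong[OF refl])
    fix w
    have "Lap k L (fld w) = (\<integral>s. indicator {0..L} s *\<^sub>R (?a s * exp (\<i> * of_real (s * fld w))) \<partial>lborel)"
      unfolding Lap_def by (rule HK) (intro continuous_intros)
    also have "(\<lambda>s. indicator {0..L} s *\<^sub>R (?a s * exp (\<i> * of_real (s * fld w)))) = (\<lambda>s. A s * exp (\<i> * of_real (s * fld w)))"
      by (simp only: A_def mult_scaleR_left)
    finally have *: "Lap k L (fld w) = (\<integral>s. A s * exp (\<i> * of_real (s * fld w)) \<partial>lborel)" .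
    show "Lap k L (fld w) * h w * cnj (q w) = (\<integral>s. G s w \<partial>lborel)"
      unfolding G_def integral_mult_left_zero *[symmetric] by (simp only: mult.assoc)
  qed
  also have "\<dots> = (\<integral>s. (\<integral>w. G s w \<partial>\<mu>) \<partial>lborel)" by (rule pair.Fubini_integral[OF Gint])
  also have "\<dots> = (\<integral>s. indicator {0..L} s *\<^sub>R (exp (- k * of_real s) * ip (V s h) q) \<partial>lborel)"
  proof (rule Bochner_Integration.integral_cong[OF refl])
    fix s
    have "(\<integral>w. G s w \<partial>\<mu>) = A s * ip (\<lambda>w. exp (\<i> * of_real (s * fld w)) * h w) q"
      by (simp only: G_def L2_ip_def mult.assoc integral_mult_right_zero)
    also have "\<dots> = indicator {0..L} s *\<^sub>R (exp (- k * of_real s) * ip (V s h) q)"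
      unfolding ip_V[OF h q] A_def exp_add exp_of_real by (simp only: mult_scaleR_left mult.assoc)
    finally show "(\<integral>w. G s w \<partial>\<mu>) = indicator {0..L} s *\<^sub>R (exp (- k * of_real s) * ip (V s h) q)" .
  qed
  also have "\<dots> = integral {0..L} (\<lambda>s. exp (- k * of_real s) * ip (V s h) q)"
    by (rule HK[symmetric]) (intro continuous_intros ip_V_continuous[OF h q])
  finally show ?thesis .
qed

definition TL :: "complex \<Rightarrow> real \<Rightarrow> hfun \<Rightarrow> hfun" where
  "TL k L = toeplitz t (\<lambda>w. Lap k L (fld w))"

lemma TL_props:
  assumes h: "h \<in> Fock t"
  shows "TL k L h \<in> Fock t"
    "q \<in> Fock t \<Longrightarrow> ip (TL k L h) q = integral {0..L} (\<lambda>s. exp (- k * of_real s) * ip (V s h) q)"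
proof -
  obtain M where M: "M \<ge> 0" "(\<lambda>w. Lap k L (fld w)) \<in> borel_measurable \<mu>" "AE w in \<mu>. cmod (Lap k L (fld w)) \<le> M"
    using Lap_toeplitz[of 1 k L] by auto
  note T = toeplitz_props[OF M(2,3,1) Fock_L2[OF h]]
  show "TL k L h \<in> Fock t" unfolding TL_def by (rule T(1))
  assume q: "q \<in> Fock t"
  show "ip (TL k L h) q = integral {0..L} (\<lambda>s. exp (- k * of_real s) * ip (V s h) q)"
    unfolding TL_def T(2)[OF q] by (rule Lap_integral[OF h q])
qed

text \<open>Contractivity bounds the coefficient independently of \<open>s\<close>, leaving the
  integral of a decaying exponential. The bound does not depend on \<open>b\<close>.\<close>

lemma integral_exp_V_bound:
  assumes h: "h \<in> Fock t" and q: "q \<in> Fock t" and k: "Re k > 0" and ab: "a \<le> b"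
  shows "cmod (integral {a..b} (\<lambda>s. exp (- k * of_real s) * ip (V s h) q)) \<le> exp (- Re k * a) / Re k * N h * N q"
proof -
  have hi: "((\<lambda>s. exp (- Re k * s)) has_integral (- exp (- Re k * b) / Re k - - exp (- Re k * a) / Re k)) {a..b}"
  proof (rule fundamental_theorem_of_calculus[OF ab])
    fix s :: real
    have "((\<lambda>s. - exp (- Re k * s) / Re k) has_real_derivative exp (- Re k * s)) (at s within {a..b})"
      using k by (auto intro!: derivative_eq_intros)
    then show "((\<lambda>s. - exp (- Re k * s) / Re k) has_vector_derivative exp (- Re k * s)) (at s within {a..b})"
      by (simp add: has_real_derivative_iff_has_vector_derivative)
  qed
  have hi': "((\<lambda>s. exp (- Re k * s) * (N h * N q)) has_integral ((- exp (- Re k * b) / Re k - - exp (- Re k * a) / Re k) * (N h * N q))) {a..b}"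
    by (rule has_integral_mult_left[OF hi])
  have "cmod (integral {a..b} (\<lambda>s. exp (- k * of_real s) * ip (V s h) q)) \<le> integral {a..b} (\<lambda>s. exp (- Re k * s) * (N h * N q))"
  proof (rule Henstock_Kurzweil_Integration.integral_norm_bound_integral)
    show "(\<lambda>s. exp (- k * of_real s) * ip (V s h) q) integrable_on {a..b}"
      by (intro integrable_continuous_real continuous_intros ip_V_continuous[OF h q])
    show "(\<lambda>s. exp (- Re k * s) * (N h * N q)) integrable_on {a..b}" using hi' by blast
    show "cmod (exp (- k * of_real s) * ip (V s h) q) \<le> exp (- Re k * s) * (N h * N q)" for s
      unfolding norm_mult using ip_V_bound[OF h q, of s] by simp
  qed
  also have "\<dots> = (exp (- Re k * a) - exp (- Re k * b)) / Re k * (N h * N q)"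
    using integral_unique[OF hi'] by (simp add: diff_divide_distrib)
  also have "\<dots> \<le> exp (- Re k * a) / Re k * (N h * N q)"
    using k by (intro mult_right_mono divide_right_mono mult_nonneg_nonneg N_nonneg) auto
  finally show ?thesis by (simp add: mult.assoc)
qed

text \<open>The estimate holds for every solution of the generator equation, hence for whichever one
  a choice returns. Its right side contains only \<open>h\<close>, which makes it an operator norm
  estimate with the same symbol for all \<open>h\<close>.\<close>

lemma resolvent_approx:
  assumes g: "g \<in> Fock t" and h: "h \<in> Fock t" and k: "Re k > 0"
    and G: "gen g (\<lambda>w. k * g w - h w)" and L: "L \<ge> 0"
  shows "N (\<lambda>w. g w - TL k L h w) \<le> exp (- Re k * L) * (N h / Re k)"
proof -
  have kgh: "(\<lambda>w. k * g w - h w) \<in> Fock t" by (intro Fock_diff Fock_scale g h)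
  \<comment> \<open>The exponentially damped orbit of \<open>g\<close> has as derivative minus the
    damped orbit of \<open>h\<close>; the boundary term at \<open>L\<close> is the truncation
    error.\<close>
  have key: "ip g q - ip (TL k L h) q = exp (- k * of_real L) * ip (V L g) q" if q: "q \<in> Fock t" and L: "L \<ge> 0" for q L
  proof -
    have "((\<lambda>s. - (exp (- k * of_real s) * ip (V s h) q)) has_integral
       (exp (- k * of_real L) * ip (V L g) q - exp (- k * of_real 0) * ip (V 0 g) q)) {0..L}"
    proof (rule fundamental_theorem_of_calculus[OF L])
      fix s :: real
      have e: "((\<lambda>s. exp (- k * complex_of_real s)) has_vector_derivative - k * exp (- k * of_real s)) (at s)"
        by (rule exp_has_vector_derivative)
      have "ip (V s (\<lambda>w. k * g w - h w)) q = k * ip (V s g) q - ip (V s h) q"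
        by (simp only: ip_V_diff[OF Fock_scale[OF g] h q] ip_V_scale[OF g q])
      then have d: "((\<lambda>s. ip (V s g) q) has_vector_derivative k * ip (V s g) q - ip (V s h) q) (at s)"
        using gen_derivative[OF g kgh q G, of s] by simp
      have "((\<lambda>s. exp (- k * of_real s) * ip (V s g) q) has_vector_derivative
         exp (- k * of_real s) * (k * ip (V s g) q - ip (V s h) q) + (- k * exp (- k * of_real s)) * ip (V s g) q) (at s)"
        by (rule has_vector_derivative_mult[OF e d])
      then show "((\<lambda>s. exp (- k * of_real s) * ip (V s g) q) has_vector_derivative - (exp (- k * of_real s) * ip (V s h) q)) (at s within {0..L})"
        by (rule has_vector_derivative_at_within[OF has_vector_derivative_eq_rhs]) (simp add: algebra_simps)
    qed
    from integral_unique[OF this] have "- integral {0..L} (\<lambda>s. exp (- k * of_real s) * ip (V s h) q) =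
       exp (- k * of_real L) * ip (V L g) q - ip g q"
      by (simp add: ip_V_zero g q)
    then show ?thesis by (simp add: TL_props(2)[OF h q] algebra_simps)
  qed
  have b1: "N (\<lambda>w. g w - TL k L h w) \<le> exp (- Re k * L) * N g" if L: "L \<ge> 0" for L
  proof (rule N_le_ip)
    show "(\<lambda>w. g w - TL k L h w) \<in> Fock t" by (intro Fock_diff g TL_props(1) h)
    show "cmod (ip (\<lambda>w. g w - TL k L h w) q) \<le> exp (- Re k * L) * N g * N q" if q: "q \<in> Fock t" for q
    proof -
      have "ip (\<lambda>w. g w - TL k L h w) q = exp (- k * of_real L) * ip (V L g) q"
        by (simp only: ip_diff_left[OF Fock_L2[OF g] Fock_L2[OF TL_props(1)[OF h]] Fock_L2[OF q]] key[OF q L])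
      then show ?thesis using ip_V_bound[OF g q, of L] by (simp add: norm_mult mult.assoc)
    qed
  qed (simp add: N_nonneg)
  have NT: "N (TL k L h) \<le> N h / Re k" if L: "L \<ge> 0" for L
  proof (rule N_le_ip[OF TL_props(1)[OF h]])
    show "cmod (ip (TL k L h) q) \<le> N h / Re k * N q" if q: "q \<in> Fock t" for q
      using integral_exp_V_bound[OF h q k L] by (simp add: TL_props(2)[OF h q])
  qed (use k N_nonneg in simp)
  \<comment> \<open>Letting the truncation tend to infinity bounds the solution by the datum, so
    that \<open>N g\<close> can be replaced in \<open>b1\<close>.\<close>
  have "N g \<le> N h / Re k"
  proof (rule LIMSEQ_le_const)
    from tendsto_add[OF tendsto_const tendsto_mult_left_zero[OF exp_decay_limit[OF k], of "N g"], of "N h / Re k"]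
    show "(\<lambda>n. N h / Re k + exp (- Re k * real n) * N g) \<longlonglongrightarrow> N h / Re k" by simp
    show "\<exists>M. \<forall>n\<ge>M. N g \<le> N h / Re k + exp (- Re k * real n) * N g"
    proof (intro exI allI impI)
      fix n :: nat
      have "N g \<le> N (TL k (real n) h) + N (\<lambda>w. g w - TL k (real n) h w)"
        by (rule N_le_add_diff[OF Fock_L2[OF g] Fock_L2[OF TL_props(1)[OF h]]])
      then show "N g \<le> N h / Re k + exp (- Re k * real n) * N g"
        using NT[of "real n"] b1[of "real n"] by simp
    qed
  qed
  then have "exp (- Re k * L) * N g \<le> exp (- Re k * L) * (N h / Re k)" by (intro mult_left_mono) auto
  with b1[OF L] show ?thesis by linarith
qed

lemma TL_Cauchy_bound:
  assumes h: "h \<in> Fock t" and k: "Re k > 0" and mn: "0 \<le> m" "m \<le> n"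
  shows "N (\<lambda>w. TL k n h w - TL k m h w) \<le> exp (- Re k * m) / Re k * N h"
proof (rule N_le_ip)
  show "(\<lambda>w. TL k n h w - TL k m h w) \<in> Fock t" by (intro Fock_diff TL_props(1) h)
  fix q assume q: "q \<in> Fock t"
  let ?f = "\<lambda>s. exp (- k * of_real s) * ip (V s h) q"
  have "?f integrable_on {0..n}" by (intro integrable_continuous_real continuous_intros ip_V_continuous[OF h q])
  then have "integral {0..m} ?f + integral {m..n} ?f = integral {0..n} ?f"
    by (rule Henstock_Kurzweil_Integration.integral_combine[OF mn])
  then have "ip (\<lambda>w. TL k n h w - TL k m h w) q = integral {m..n} ?f"
    unfolding ip_diff_left[OF Fock_L2[OF TL_props(1)[OF h]] Fock_L2[OF TL_props(1)[OF h]] Fock_L2[OF q]] TL_props(2)[OF h q]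
    by (simp add: diff_eq_eq add.commute)
  then show "cmod (ip (\<lambda>w. TL k n h w - TL k m h w) q) \<le> exp (- Re k * m) / Re k * N h * N q"
    using integral_exp_V_bound[OF h q k mn(2)] by simp
qed (use k N_nonneg in simp)

lemma TL_limit:
  assumes h: "h \<in> Fock t" and k: "Re k > 0"
  shows "\<exists>g\<in>Fock t. (\<lambda>n. N (\<lambda>w. TL k (real n) h w - g w)) \<longlonglongrightarrow> 0"
proof -
  note TF = TL_props(1)[OF h]
  have lim: "(\<lambda>n. exp (- Re k * real n) / Re k * N h) \<longlonglongrightarrow> 0"
    using tendsto_mult_left_zero[OF exp_decay_limit[OF k], of "N h / Re k"] by simp
  have "\<exists>g\<in>L2 t. (\<lambda>n. N (\<lambda>w. TL k (real n) h w - g w)) \<longlonglongrightarrow> 0"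
  proof (rule L2_complete[OF Fock_L2[OF TF]])
    fix e :: real assume "e > 0"
    from order_tendstoD(2)[OF lim this] obtain M where
      M: "\<And>n. n \<ge> M \<Longrightarrow> exp (- Re k * real n) / Re k * N h < e" by (auto simp: eventually_sequentially)
    have "N (\<lambda>w. TL k (real m) h w - TL k (real n) h w) < e" if "m \<ge> M" "n \<ge> M" for m n
    proof (cases "n \<le> m")
      case True
      then show ?thesis using TL_Cauchy_bound[OF h k, of "real n" "real m"] M[OF that(2)] by simp
    next
      case False
      then show ?thesis using TL_Cauchy_bound[OF h k, of "real m" "real n"] M[OF that(1)]
        N_minus_commute[of "TL k (real m) h" "TL k (real n) h"] by simp
    qed
    then show "\<exists>M. \<forall>m\<ge>M. \<forall>n\<ge>M. N (\<lambda>w. TL k (real m) h w - TL k (real n) h w) < e"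
      by (intro exI[of _ M] allI impI)
  qed
  then obtain g where g: "g \<in> L2 t" "(\<lambda>n. N (\<lambda>w. TL k (real n) h w - g w)) \<longlonglongrightarrow> 0" by blast
  show ?thesis using g(2) Fock_limit[OF TF g] by (rule bexI)
qed

text \<open>Moving the group onto the test vector shifts the variable of the Laplace integral, which
  expresses the orbit of the limit \<open>g\<close> through a primitive of the damped orbit of
  \<open>h\<close>. That expression can be differentiated.\<close>

lemma TL_limit_derivative:
  assumes h: "h \<in> Fock t" and k: "Re k > 0" and g: "g \<in> Fock t"
    and lim: "(\<lambda>n. N (\<lambda>w. TL k (real n) h w - g w)) \<longlonglongrightarrow> 0" and q: "q \<in> Fock t"
    and r: "\<bar>r\<bar> < 1"
  shows "((\<lambda>r. ip (V r g) q) has_vector_derivative (k * ip (V r g) q - ip (V r h) q)) (at r)"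
proof -
  let ?f = "\<lambda>s. exp (- k * of_real s) * ip (V s h) q"
  have fc: "continuous_on A ?f" for A by (intro continuous_intros ip_V_continuous[OF h q])
  \<comment> \<open>The arguments \<open>s + r\<close> that occur exceed -1, so the base point -2
    keeps them in the interior of the domain of integration.\<close>
  define \<Psi> where "\<Psi> r = integral {-2..r} ?f" for r
  have D: "(\<Psi> has_vector_derivative ?f r) (at r)" if "r > -2" for r
  proof -
    have "(\<Psi> has_vector_derivative ?f r) (at r within {-2..r+1})"
      unfolding \<Psi>_def using that by (intro integral_has_vector_derivative fc) auto
    moreover have "at r within {-2..r+1} = at r" using that by (intro at_within_interior) auto
    ultimately show ?thesis by simp
  qed
  have diff: "\<Psi> b - \<Psi> a = integral {a..b} ?f" if "-2 < a" "a \<le> b" for a b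
  proof -
    have "(?f has_integral (\<Psi> b - \<Psi> a)) {a..b}"
    proof (rule fundamental_theorem_of_calculus[OF that(2)])
      show "(\<Psi> has_vector_derivative ?f x) (at x within {a..b})" if "x \<in> {a..b}" for x
        by (rule has_vector_derivative_at_within[OF D]) (use that \<open>-2 < a\<close> in auto)
    qed
    then show ?thesis by (simp add: integral_unique)
  qed
  \<comment> \<open>Substitution of \<open>s + r\<close>, verified by differentiating the
    primitive.\<close>
  have shift: "integral {0..L} (\<lambda>s. exp (- k * of_real s) * ip (V (s + r) h) q) = exp (k * of_real r) * (\<Psi> (L + r) - \<Psi> r)"
    if r: "\<bar>r\<bar> < 1" and L: "L \<ge> 0" for r L
  proof (rule integral_unique)
    have "((\<lambda>s. exp (- k * of_real s) * ip (V (s + r) h) q) has_integral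
       (exp (k * of_real r) * \<Psi> (L + r) - exp (k * of_real r) * \<Psi> (0 + r))) {0..L}"
    proof (rule fundamental_theorem_of_calculus[OF L])
      fix s assume "s \<in> {0..L}"
      then have sr: "s + r > -2" using r by auto
      have "((\<lambda>s. s + r) has_vector_derivative 1) (at s)" by (auto intro!: derivative_eq_intros)
      from vector_diff_chain_at[OF this D[OF sr]]
      have "((\<lambda>s. \<Psi> (s + r)) has_vector_derivative ?f (s + r)) (at s)" by (simp add: o_def)
      then have "((\<lambda>s. exp (k * of_real r) * \<Psi> (s + r)) has_vector_derivative exp (k * of_real r) * ?f (s + r)) (at s within {0..L})"
        by (rule has_vector_derivative_at_within[OF has_vector_derivative_mult_right])
      moreover have "exp (k * of_real r) * ?f (s + r) = exp (- k * of_real s) * ip (V (s + r) h) q"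
        by (simp add: mult.assoc[symmetric] exp_add[symmetric] algebra_simps)
      ultimately show "((\<lambda>s. exp (k * of_real r) * \<Psi> (s + r)) has_vector_derivative exp (- k * of_real s) * ip (V (s + r) h) q) (at s within {0..L})"
        by (simp only:)
    qed
    then show "((\<lambda>s. exp (- k * of_real s) * ip (V (s + r) h) q) has_integral exp (k * of_real r) * (\<Psi> (L + r) - \<Psi> r)) {0..L}"
      by (simp add: right_diff_distrib)
  qed
  have lim1: "(\<lambda>n. exp (k * of_real r) * (\<Psi> (real n + r) - \<Psi> r)) \<longlonglongrightarrow> ip (V r g) q" if r: "\<bar>r\<bar> < 1" for r
  proof -
    have "(\<lambda>n. ip (TL k (real n) h) (V (- r) q)) \<longlonglongrightarrow> ip g (V (- r) q)"
      by (rule ip_tendsto[OF Fock_L2[OF TL_props(1)[OF h]] V_L2[OF q] Fock_L2[OF g] V_L2[OF q] lim])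
        (simp add: L2_norm_def)
    moreover have "ip (TL k (real n) h) (V (- r) q) = exp (k * of_real r) * (\<Psi> (real n + r) - \<Psi> r)" for n
    proof -
      have "ip (V s h) (V (- r) q) = ip (V (s + r) h) q" for s
      proof -
        have "ip (V s h) (V (- r) q) = ip (V r (V s h)) q" by (rule ip_V_adjoint[symmetric, OF V_Fock[OF h] q])
        also have "\<dots> = ip (V (r + s) h) q"
          by (rule ip_cong_AE[OF V_L2[OF V_Fock[OF h]] V_L2[OF h] Fock_L2[OF q] Fock_L2[OF q] V_compose[OF h]]) simp
        finally show ?thesis by (simp add: add.commute)
      qed
      then show ?thesis unfolding TL_props(2)[OF h V_Fock[OF q]] using shift[OF r, of "real n"] by simp
    qed
    ultimately show ?thesis by (simp add: ip_V_adjoint[OF g q])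
  qed
  \<comment> \<open>This is an integral over an interval of length below 1 near \<open>n\<close>,
    starting no earlier than \<open>n - 1\<close>, so it decays exponentially. Hence the shifted and
    unshifted primitives have the same limit.\<close>
  have lim2: "(\<lambda>n. \<Psi> (real n + r) - \<Psi> (real n)) \<longlonglongrightarrow> 0" if r: "\<bar>r\<bar> < 1" for r
  proof (rule Lim_null_comparison)
    have "(\<lambda>n. exp (Re k) * exp (- Re k * real n)) \<longlonglongrightarrow> exp (Re k) * 0"
      by (intro tendsto_intros exp_decay_limit k)
    then have "(\<lambda>n. exp (- Re k * (real n - 1))) \<longlonglongrightarrow> 0"
      by (simp add: exp_add[symmetric] algebra_simps)
    from tendsto_mult_left_zero[OF this, of "N h * N q / Re k"]
    show "(\<lambda>n. exp (- Re k * (real n - 1)) * (N h * N q / Re k)) \<longlonglongrightarrow> 0" .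
    have "norm (\<Psi> (real n + r) - \<Psi> (real n)) \<le> exp (- Re k * (real n - 1)) * (N h * N q / Re k)" if n: "n \<ge> 1" for n
    proof -
      have *: "norm (\<Psi> b - \<Psi> a) \<le> exp (- Re k * (real n - 1)) * (N h * N q / Re k)" if ab: "real n - 1 \<le> a" "a \<le> b" for a b
      proof -
        have "norm (\<Psi> b - \<Psi> a) \<le> exp (- Re k * a) / Re k * N h * N q"
          using diff[of a b] integral_exp_V_bound[OF h q k ab(2)] ab n by simp
        also have "\<dots> = exp (- Re k * a) * (N h * N q / Re k)" by simp
        also have "\<dots> \<le> exp (- Re k * (real n - 1)) * (N h * N q / Re k)"
          using ab(1) k by (intro mult_right_mono divide_nonneg_pos mult_nonneg_nonneg N_nonneg) auto
        finally show ?thesis .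
      qed
      show ?thesis
      proof (cases "r \<ge> 0")
        case True then show ?thesis by (intro *) auto
      next
        case False
        then show ?thesis using *[of "real n + r" "real n"] r by (simp add: norm_minus_commute)
      qed
    qed
    then show "\<forall>\<^sub>F n in sequentially. norm (\<Psi> (real n + r) - \<Psi> (real n)) \<le> exp (- Re k * (real n - 1)) * (N h * N q / Re k)"
      unfolding eventually_sequentially by (intro exI[of _ 1] allI impI)
  qed
  have lim0: "(\<lambda>n. \<Psi> (real n)) \<longlonglongrightarrow> ip g q + \<Psi> 0"
    using tendsto_add[OF lim1[of 0] tendsto_const[of "\<Psi> 0"]] by (simp add: ip_V_zero g q)
  have val: "ip (V r g) q = exp (k * of_real r) * (ip g q + \<Psi> 0 - \<Psi> r)" if r: "\<bar>r\<bar> < 1" for r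
  proof (rule LIMSEQ_unique[OF lim1[OF r]])
    have "(\<lambda>n. \<Psi> (real n + r)) \<longlonglongrightarrow> ip g q + \<Psi> 0"
      using tendsto_add[OF lim2[OF r] lim0] by simp
    then show "(\<lambda>n. exp (k * of_real r) * (\<Psi> (real n + r) - \<Psi> r)) \<longlonglongrightarrow> exp (k * of_real r) * (ip g q + \<Psi> 0 - \<Psi> r)"
      by (intro tendsto_intros)
  qed
  have e: "((\<lambda>s. exp (k * complex_of_real s)) has_vector_derivative k * exp (k * of_real r)) (at r)"
    by (rule exp_has_vector_derivative)
  have "((\<lambda>s. ip g q + \<Psi> 0 - \<Psi> s) has_vector_derivative (0 - ?f r)) (at r)"
    using r by (intro has_vector_derivative_diff has_vector_derivative_const D) auto
  from has_vector_derivative_mult[OF e this]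
  have "((\<lambda>s. exp (k * of_real s) * (ip g q + \<Psi> 0 - \<Psi> s)) has_vector_derivative
     (exp (k * of_real r) * (0 - ?f r) + k * exp (k * of_real r) * (ip g q + \<Psi> 0 - \<Psi> r))) (at r)" .
  moreover have "exp (k * of_real r) * (0 - ?f r) + k * exp (k * of_real r) * (ip g q + \<Psi> 0 - \<Psi> r) = k * ip (V r g) q - ip (V r h) q"
  proof -
    have "exp (k * of_real r) * ?f r = ip (V r h) q" by (simp add: mult.assoc[symmetric] exp_add[symmetric])
    then show ?thesis by (simp add: val[OF r] algebra_simps)
  qed
  ultimately have "((\<lambda>s. exp (k * of_real s) * (ip g q + \<Psi> 0 - \<Psi> s)) has_vector_derivative k * ip (V r g) q - ip (V r h) q) (at r)"
    by simp
  then show ?thesis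
  proof (rule has_vector_derivative_transform_within_open[where S="{-1<..<1}"])
    show "exp (k * of_real s) * (ip g q + \<Psi> 0 - \<Psi> s) = ip (V s g) q" if "s \<in> {-1<..<1}" for s
      using val[of s] that by auto
  qed (use r in auto)
qed

text \<open>The weak derivative is known on a whole neighbourhood of 0 and is continuous there
  uniformly for test vectors of bounded norm. The mean value inequality then makes the difference
  quotient converge in norm.\<close>

lemma gen_exists:
  assumes h: "h \<in> Fock t" and k: "Re k > 0"
  shows "\<exists>g\<in>Fock t. gen g (\<lambda>w. k * g w - h w)"
proof -
  obtain g where g: "g \<in> Fock t" and lim: "(\<lambda>n. N (\<lambda>w. TL k (real n) h w - g w)) \<longlonglongrightarrow> 0"
    using TL_limit[OF h k] by blast
  note D = TL_limit_derivative[OF h k g lim]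
  have "gen g (\<lambda>w. k * g w - h w)"
    unfolding gen_def
  proof (rule tendstoI)
    fix e :: real assume e: "e > 0"
    \<comment> \<open>The derivative involves \<open>k\<close> times the orbit of \<open>g\<close>
      and the orbit of \<open>h\<close>, giving the factor \<open>cmod k + 1\<close>; the factor 2
      yields a strict inequality at the end.\<close>
    define \<epsilon> where "\<epsilon> = e / (2 * (cmod k + 1))"
    have kp: "cmod k + 1 > 0" by (simp add: add_nonneg_pos)
    have \<epsilon>: "\<epsilon> > 0" using e kp by (simp add: \<epsilon>_def)
    obtain d1 where d1: "d1 > 0" "\<And>s. \<bar>s\<bar> < d1 \<Longrightarrow> N (\<lambda>w. V s g w - g w) < \<epsilon>" using V_continuous_0[OF g \<epsilon>] by auto
    obtain d2 where d2: "d2 > 0" "\<And>s. \<bar>s\<bar> < d2 \<Longrightarrow> N (\<lambda>w. V s h w - h w) < \<epsilon>" using V_continuous_0[OF h \<epsilon>] by auto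
    define d where "d = min 1 (min d1 d2)"
    have d: "d > 0" "d \<le> 1" "d \<le> d1" "d \<le> d2" using d1(1) d2(1) by (auto simp: d_def)
    have small: "cmod (ip (V s f) q - ip f q) \<le> \<epsilon> * N q" if f: "f \<in> Fock t" and q: "q \<in> Fock t" and s: "N (\<lambda>w. V s f w - f w) < \<epsilon>" for f q s
    proof -
      have "ip (V s f) q - ip f q = ip (\<lambda>w. V s f w - f w) q"
        by (rule ip_diff_left[symmetric]) (intro V_L2 Fock_L2 f q)+
      also have "cmod \<dots> \<le> N (\<lambda>w. V s f w - f w) * N q"
        by (rule Cauchy_Schwarz) (intro L2_diff V_L2 Fock_L2 f q)+
      also have "\<dots> \<le> \<epsilon> * N q" by (rule mult_right_mono[OF less_imp_le[OF s] N_nonneg])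
      finally show ?thesis .
    qed
    have main: "N (\<lambda>w. (V r g w - g w) / complex_of_real r - (k * g w - h w)) < e" if r: "r \<noteq> 0" "\<bar>r\<bar> < d" for r
    proof -
      let ?F = "\<lambda>w. (1 / complex_of_real r) * (V r g w - g w) - (k * g w - h w)"
      have F1: "(\<lambda>w. V r g w - g w) \<in> Fock t" by (intro Fock_diff V_Fock g)
      have F2: "(\<lambda>w. k * g w - h w) \<in> Fock t" by (intro Fock_diff Fock_scale g h)
      have F: "?F \<in> Fock t" by (rule Fock_diff[OF Fock_scale[OF F1] F2])
      have "N ?F \<le> (cmod k + 1) * \<epsilon>"
      proof (rule N_le_ip[OF F])
        fix q assume q: "q \<in> Fock t"
        \<comment> \<open>With the expected linear part removed, the derivative is small on all of
          the interval, not only at 0.\<close>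
        define \<eta> where "\<eta> s = ip (V s g) q - s *\<^sub>R (k * ip g q - ip h q)" for s
        have "norm (\<eta> r - \<eta> 0) \<le> ((cmod k + 1) * \<epsilon> * N q) * norm (r - 0)"
        proof (rule differentiable_bound[of "{-\<bar>r\<bar>..\<bar>r\<bar>}"])
          fix s assume s: "s \<in> {-\<bar>r\<bar>..\<bar>r\<bar>}"
          then have sd: "\<bar>s\<bar> < d" using r(2) by auto
          let ?D = "(k * ip (V s g) q - ip (V s h) q) - (k * ip g q - ip h q)"
          have s1: "\<bar>s\<bar> < 1" using sd d(2) by simp
          have "((\<lambda>s. s *\<^sub>R (k * ip g q - ip h q)) has_vector_derivative (k * ip g q - ip h q)) (at s)"
            by (auto intro!: derivative_eq_intros)
          then have "(\<eta> has_vector_derivative ?D) (at s)"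
            unfolding \<eta>_def by (rule has_vector_derivative_diff[OF D[OF q s1]])
          then show "(\<eta> has_derivative (\<lambda>h. h *\<^sub>R ?D)) (at s within {-\<bar>r\<bar>..\<bar>r\<bar>})"
            unfolding has_vector_derivative_def by (rule has_derivative_at_withinI)
          have "onorm (\<lambda>h. h *\<^sub>R ?D) \<le> cmod ?D"
            by (rule onorm_le) (simp add: mult.commute)
          also have "?D = k * (ip (V s g) q - ip g q) - (ip (V s h) q - ip h q)" by (simp add: algebra_simps)
          also have "cmod \<dots> \<le> cmod k * (\<epsilon> * N q) + \<epsilon> * N q"
          proof (rule order_trans[OF norm_triangle_ineq4 add_mono])
            have "N (\<lambda>w. V s g w - g w) < \<epsilon>" "N (\<lambda>w. V s h w - h w) < \<epsilon>"
              using sd d(3,4) by (auto intro: d1(2) d2(2))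
            note sm = small[OF g q this(1)] small[OF h q this(2)]
            show "cmod (k * (ip (V s g) q - ip g q)) \<le> cmod k * (\<epsilon> * N q)"
              unfolding norm_mult by (rule mult_left_mono[OF sm(1) norm_ge_zero])
            show "cmod (ip (V s h) q - ip h q) \<le> \<epsilon> * N q" by (rule sm(2))
          qed
          finally show "onorm (\<lambda>h. h *\<^sub>R ?D) \<le> (cmod k + 1) * \<epsilon> * N q" by (simp add: algebra_simps)
        qed auto
        moreover have "\<eta> r - \<eta> 0 = of_real r * ip ?F q"
        proof -
          have "ip ?F q = (1 / complex_of_real r) * (ip (V r g) q - ip g q) - (k * ip g q - ip h q)"
            by (simp only: ip_diff_left[OF Fock_L2[OF Fock_scale[OF F1]] Fock_L2[OF F2] Fock_L2[OF q]] ip_scale_left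
              ip_diff_left[OF V_L2[OF g] Fock_L2[OF g] Fock_L2[OF q]]
              ip_diff_left[OF Fock_L2[OF Fock_scale[OF g]] Fock_L2[OF h] Fock_L2[OF q]])
          then show ?thesis using r(1) by (simp add: \<eta>_def ip_V_zero g q scaleR_conv_of_real field_simps)
        qed
        ultimately show "cmod (ip ?F q) \<le> (cmod k + 1) * \<epsilon> * N q"
          using r(1) by (simp add: norm_mult mult.commute)
      qed (use \<epsilon> in simp)
      also have "\<dots> = e / 2"
      proof -
        have "K * (e / (2 * K)) = e / 2" if "K > 0" for K :: real using that by simp
        from this[OF kp] show ?thesis by (simp only: \<epsilon>_def)
      qed
      also have "\<dots> < e" using e by simp
      finally show ?thesis by simp
    qed
    show "\<forall>\<^sub>F s in at 0. dist (N (\<lambda>w. (V s g w - g w) / complex_of_real s - (k * g w - h w))) 0 < e"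
      unfolding eventually_at
    proof (intro exI[of _ d] conjI ballI impI d(1))
      fix s :: real assume "s \<noteq> 0 \<and> dist s 0 < d"
      then show "dist (N (\<lambda>w. (V s g w - g w) / complex_of_real s - (k * g w - h w))) 0 < e"
        using main[of s] by (simp add: N_nonneg)
    qed
  qed
  then show ?thesis using g by (rule bexI)
qed

end

text \<open>The resolvent is chosen separately for each argument, so its linearity is not given by
  construction. It passes over from the approximating Toeplitz operators, up to null sets.\<close>

lemma bounded_operators_limit:
  assumes A: "\<And>f. f \<in> Fock t \<Longrightarrow> A f \<in> Fock t"
    and approx: "\<And>e. e > 0 \<Longrightarrow> \<exists>B\<in>bounded_operators t. \<forall>f\<in>Fock t. N (\<lambda>w. A f w - B f w) \<le> e * N f"
  shows "A \<in> bounded_operators t"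
proof -
  have zero: "AE w in \<mu>. F w = G w" if F: "F \<in> Fock t" and G: "G \<in> Fock t" and C: "C \<ge> 0"
    and b: "\<And>e. e > 0 \<Longrightarrow> N (\<lambda>w. F w - G w) \<le> e * C" for F G C
  proof -
    have "N (\<lambda>w. F w - G w) \<le> 0"
    proof (rule field_le_epsilon)
      fix e :: real assume e: "e > 0"
      have "e / (C + 1) > 0" using e C by simp
      from b[OF this] have "N (\<lambda>w. F w - G w) \<le> e / (C + 1) * C" .
      also have "\<dots> \<le> e" using e C by (simp add: field_simps)
      finally show "N (\<lambda>w. F w - G w) \<le> 0 + e" by simp
    qed
    then have "N (\<lambda>w. F w - G w) = 0" using N_nonneg[of "\<lambda>w. F w - G w"] by simp
    then have "AE w in \<mu>. F w - G w = 0" by (rule N_eq_0_AE[OF Fock_L2[OF Fock_diff[OF F G]]])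
    then show ?thesis by eventually_elim simp
  qed
  have add: "AE w in \<mu>. A (\<lambda>x. f x + g x) w = A f w + A g w" if f: "f \<in> Fock t" and g: "g \<in> Fock t" for f g
  proof (rule zero[OF A[OF Fock_add[OF f g]] Fock_add[OF A[OF f] A[OF g]]])
    note fg = Fock_add[OF f g]
    show "0 \<le> N (\<lambda>x. f x + g x) + N f + N g" by (simp add: N_nonneg)
    fix e :: real assume e: "e > 0"
    obtain B where B: "B \<in> bounded_operators t" "\<And>f. f \<in> Fock t \<Longrightarrow> N (\<lambda>w. A f w - B f w) \<le> e * N f"
      using approx[OF e] by blast
    note BF = bounded_operatorsD(1)[OF B(1)]
    have "N (\<lambda>w. A (\<lambda>x. f x + g x) w - (A f w + A g w)) =
       N (\<lambda>w. (A (\<lambda>x. f x + g x) w - B (\<lambda>x. f x + g x) w) + ((B f w - A f w) + (B g w - A g w)))"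
    proof (rule N_cong_AE)
      show "AE w in \<mu>. A (\<lambda>x. f x + g x) w - (A f w + A g w) =
         (A (\<lambda>x. f x + g x) w - B (\<lambda>x. f x + g x) w) + ((B f w - A f w) + (B g w - A g w))"
        using bounded_operatorsD(2)[OF B(1) f g] by eventually_elim simp
    qed (intro L2_measurable L2_diff L2_add Fock_L2 A BF fg f g)+
    also have "\<dots> \<le> N (\<lambda>w. A (\<lambda>x. f x + g x) w - B (\<lambda>x. f x + g x) w) + N (\<lambda>w. (B f w - A f w) + (B g w - A g w))"
      by (intro N_triangle L2_diff L2_add Fock_L2 A BF fg f g)
    also have "\<dots> \<le> N (\<lambda>w. A (\<lambda>x. f x + g x) w - B (\<lambda>x. f x + g x) w) + (N (\<lambda>w. B f w - A f w) + N (\<lambda>w. B g w - A g w))"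
      by (intro add_left_mono N_triangle L2_diff Fock_L2 A BF f g)
    also have "\<dots> \<le> e * N (\<lambda>x. f x + g x) + (e * N f + e * N g)"
      using B(2)[OF fg] B(2)[OF f] B(2)[OF g] N_minus_commute[of "B f" "A f"] N_minus_commute[of "B g" "A g"] by simp
    finally show "N (\<lambda>w. A (\<lambda>x. f x + g x) w - (A f w + A g w)) \<le> e * (N (\<lambda>x. f x + g x) + N f + N g)"
      by (simp add: algebra_simps)
  qed
  have scale: "AE w in \<mu>. A (\<lambda>x. d * f x) w = d * A f w" if f: "f \<in> Fock t" for f d
  proof (rule zero[OF A[OF Fock_scale[OF f]] Fock_scale[OF A[OF f]]])
    note df = Fock_scale[OF f, of d]
    show "0 \<le> N (\<lambda>x. d * f x) + cmod d * N f" by (simp add: N_nonneg)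
    fix e :: real assume e: "e > 0"
    obtain B where B: "B \<in> bounded_operators t" "\<And>f. f \<in> Fock t \<Longrightarrow> N (\<lambda>w. A f w - B f w) \<le> e * N f"
      using approx[OF e] by blast
    note BF = bounded_operatorsD(1)[OF B(1)]
    have "N (\<lambda>w. A (\<lambda>x. d * f x) w - d * A f w) =
       N (\<lambda>w. (A (\<lambda>x. d * f x) w - B (\<lambda>x. d * f x) w) + d * (B f w - A f w))"
    proof (rule N_cong_AE)
      show "AE w in \<mu>. A (\<lambda>x. d * f x) w - d * A f w =
         (A (\<lambda>x. d * f x) w - B (\<lambda>x. d * f x) w) + d * (B f w - A f w)"
        using bounded_operatorsD(3)[OF B(1) f, of d] by eventually_elim (simp add: algebra_simps)
    qed (intro L2_measurable L2_diff L2_add L2_scale Fock_L2 A BF df f)+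
    also have "\<dots> \<le> N (\<lambda>w. A (\<lambda>x. d * f x) w - B (\<lambda>x. d * f x) w) + N (\<lambda>w. d * (B f w - A f w))"
      by (intro N_triangle L2_diff L2_scale Fock_L2 A BF df f)
    also have "N (\<lambda>w. d * (B f w - A f w)) = cmod d * N (\<lambda>w. A f w - B f w)"
      by (simp only: N_scale N_minus_commute[of "B f" "A f"])
    also have "N (\<lambda>w. A (\<lambda>x. d * f x) w - B (\<lambda>x. d * f x) w) + cmod d * N (\<lambda>w. A f w - B f w)
       \<le> e * N (\<lambda>x. d * f x) + cmod d * (e * N f)"
      by (intro add_mono mult_left_mono B(2) df f norm_ge_zero)
    finally show "N (\<lambda>w. A (\<lambda>x. d * f x) w - d * A f w) \<le> e * (N (\<lambda>x. d * f x) + cmod d * N f)"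
      by (simp add: algebra_simps)
  qed
  obtain B where B: "B \<in> bounded_operators t" "\<forall>f\<in>Fock t. N (\<lambda>w. A f w - B f w) \<le> 1 * N f"
    using approx[OF zero_less_one] by blast
  obtain K where K: "K \<ge> 0" "\<And>f. f \<in> Fock t \<Longrightarrow> N (B f) \<le> K * N f" using bounded_operator_bound[OF B(1)] by blast
  have "N (A f) \<le> (K + 1) * N f" if f: "f \<in> Fock t" for f
    using N_le_add_diff[OF Fock_L2[OF A[OF f]] Fock_L2[OF bounded_operatorsD(1)[OF B(1) f]]] bspec[OF B(2) f] K(2)[OF f]
    by (simp add: ring_distribs)
  then have bound: "\<exists>K. \<forall>f\<in>Fock t. N (A f) \<le> K * N f" by blast
  show ?thesis unfolding bounded_operators_def
    by (intro CollectI conjI ballI allI A add scale bound)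
qed

end

section \<open>Symbols in the classical algebra, and resolvents as norm limits\<close>

context gauss
begin

text \<open>Integrating the derivative of the integrand over the interval isolates \<open>y\<close>
  times the transform and leaves terms bounded independently of \<open>y\<close>. So the transform
  decays like \<open>1 / y\<close>.\<close>

lemma Lap_vanishes:
  assumes z: "z \<in> H_half t" and L: "L \<ge> 0" and e: "e > 0"
  shows "\<exists>R\<ge>0. \<forall>y. \<bar>y\<bar> > R \<longrightarrow> cmod (Lap z k L y) < e"
proof -
  define f where "f y s = exp (- k * complex_of_real s + of_real (hv z * s\<^sup>2)) * exp (\<i> * of_real (s * y))" for y s
  \<comment> \<open>Boundary terms at \<open>L\<close> and at 0, the latter of modulus 1, and the
    integral of the remaining part of the derivative. The modulus of \<open>f y s\<close> does not
    depend on \<open>y\<close>, so neither does \<open>C\<close>.\<close>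
  define C where "C = cmod (f 0 L) + 1 + integral {0..L} (\<lambda>s. cmod ((- k + 2 * of_real (hv z * s)) * f 0 s))"
  have fn: "cmod (f y s) = cmod (f 0 s)" for y s by (simp only: f_def norm_mult norm_exp_i_times)
  have fc: "continuous_on A (f y)" for A y unfolding f_def by (intro continuous_intros)
  have i0: "(\<lambda>s. cmod ((- k + 2 * of_real (hv z * s)) * f 0 s)) integrable_on {0..L}"
    by (intro integrable_continuous_real continuous_intros fc)
  have C: "C > 0" unfolding C_def
  proof (rule add_pos_nonneg)
    show "cmod (f 0 L) + 1 > 0" by (rule add_nonneg_pos) simp_all
  qed (rule Henstock_Kurzweil_Integration.integral_nonneg[OF i0], simp)
  have bound: "\<bar>y\<bar> * cmod (Lap z k L y) \<le> C" for y
  proof -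
    have "((\<lambda>s. (- k + 2 * of_real (hv z * s)) * f y s + (\<i> * of_real y) * f y s) has_integral (f y L - f y 0)) {0..L}"
    proof (rule fundamental_theorem_of_calculus[OF L])
      fix s :: real
      let ?g = "\<lambda>u. exp (- k * u + of_real (hv z) * u\<^sup>2) * exp (\<i> * (u * of_real y))"
      have "(?g has_field_derivative (- k + 2 * of_real (hv z) * of_real s + \<i> * of_real y) * ?g (of_real s)) (at (of_real s))"
        by (auto intro!: derivative_eq_intros simp: algebra_simps)
      from has_vector_derivative_real_field[OF this]
      have "((\<lambda>s. ?g (of_real s)) has_vector_derivative (- k + 2 * of_real (hv z) * of_real s + \<i> * of_real y) * ?g (of_real s)) (at s within {0..L})" .
      moreover have "(\<lambda>s. ?g (of_real s)) = f y" by (simp add: f_def fun_eq_iff)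
      moreover have "(- k + 2 * of_real (hv z) * of_real s + \<i> * of_real y) * ?g (of_real s) =
          (- k + 2 * of_real (hv z * s)) * f y s + (\<i> * of_real y) * f y s"
        by (simp add: f_def algebra_simps)
      ultimately show "(f y has_vector_derivative (- k + 2 * of_real (hv z * s)) * f y s + (\<i> * of_real y) * f y s) (at s within {0..L})"
        by simp
    qed
    from integral_unique[OF this]
    have "integral {0..L} (\<lambda>s. (- k + 2 * of_real (hv z * s)) * f y s) + (\<i> * of_real y) * integral {0..L} (f y) = f y L - f y 0"
      by (subst (asm) Henstock_Kurzweil_Integration.integral_add)
        (auto intro!: integrable_continuous_real continuous_intros fc)
    moreover have "integral {0..L} (f y) = Lap z k L y"
      unfolding Lap_def[OF z] f_def ..
    ultimately have "(\<i> * of_real y) * Lap z k L y = (f y L - f y 0) - integral {0..L} (\<lambda>s. (- k + 2 * of_real (hv z * s)) * f y s)"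
      by (simp add: algebra_simps)
    then have "\<bar>y\<bar> * cmod (Lap z k L y) = cmod ((f y L - f y 0) - integral {0..L} (\<lambda>s. (- k + 2 * of_real (hv z * s)) * f y s))"
      by (metis norm_mult norm_ii norm_of_real mult_1)
    also have "\<dots> \<le> (cmod (f y L) + cmod (f y 0)) + integral {0..L} (\<lambda>s. cmod ((- k + 2 * of_real (hv z * s)) * f 0 s))"
    proof (rule order_trans[OF norm_triangle_ineq4 add_mono[OF norm_triangle_ineq4]])
      show "cmod (integral {0..L} (\<lambda>s. (- k + 2 * of_real (hv z * s)) * f y s)) \<le> integral {0..L} (\<lambda>s. cmod ((- k + 2 * of_real (hv z * s)) * f 0 s))"
      proof (rule Henstock_Kurzweil_Integration.integral_norm_bound_integral[OF _ i0])
        show "(\<lambda>s. (- k + 2 * of_real (hv z * s)) * f y s) integrable_on {0..L}"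
          by (intro integrable_continuous_real continuous_intros fc)
        show "cmod ((- k + 2 * of_real (hv z * s)) * f y s) \<le> cmod ((- k + 2 * of_real (hv z * s)) * f 0 s)" for s
          by (simp only: norm_mult fn[of y])
      qed
    qed
    also have "\<dots> = C" unfolding C_def fn[of y] by (simp add: f_def)
    finally show ?thesis .
  qed
  show ?thesis
  proof (intro exI[of _ "C / e"] conjI allI impI)
    fix y assume y: "\<bar>y\<bar> > C / e"
    then have y0: "\<bar>y\<bar> > 0" using C e by (meson divide_pos_pos less_trans)
    have "\<bar>y\<bar> * cmod (Lap z k L y) < \<bar>y\<bar> * e"
      using bound[of y] y e by (simp add: field_simps)
    then show "cmod (Lap z k L y) < e" using y0 by simp
  qed (use C e in simp)
qed

lemma Linf_norm_le:
  assumes "f \<in> borel_measurable \<mu>" "\<And>w. cmod (f w) \<le> d" "d \<ge> 0"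
  shows "norm_op (Linf t) f \<le> d"
proof -
  have [measurable]: "f \<in> borel_measurable \<mu>" by fact
  have "esssup \<mu> (\<lambda>w. ereal (cmod (f w))) \<le> ereal d"
    by (rule esssup_I) (use assms(2) in auto)
  \<comment> \<open>Should the essential supremum be minus infinity, \<open>real_of_ereal\<close>
    returns 0, which is at most \<open>d\<close>.\<close>
  then show ?thesis using assms(3) unfolding Linf_def
    by (cases "esssup \<mu> (\<lambda>w. ereal (cmod (f w)))") auto
qed

text \<open>The Cayley-type transform \<open>y \<mapsto> 1 / (1 - \<i> y)\<close> maps the real line onto the circle
  \<open>\<bar>\<zeta>\<bar>\<^sup>2 = Re \<zeta>\<close> without the origin, which corresponds to the point at infinity. Polynomials in
  \<open>Re \<zeta>\<close> and \<open>Im \<zeta>\<close> vanishing at the origin lie in the algebra generated by the transform.\<close>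

lemma vanishing_function_in_classical_algebra:
  fixes F :: "real \<Rightarrow> complex"
  assumes z: "z \<in> H_half t" and F: "continuous_on UNIV F" and bd: "\<And>y. cmod (F y) \<le> M"
    and van: "\<And>e. e > 0 \<Longrightarrow> \<exists>R\<ge>0. \<forall>y. \<bar>y\<bar> > R \<longrightarrow> cmod (F y) < e"
  shows "(\<lambda>w. F (fld z w)) \<in> classical_resolvent_algebra t"
  unfolding classical_resolvent_algebra_def cstar_generated_def
proof (intro CollectI conjI allI impI)
  have [measurable]: "fld z \<in> borel_measurable \<mu>" by (rule fld_measurable[OF z])
  have [measurable]: "F \<in> borel_measurable borel" by (rule borel_measurable_continuous_onI[OF F])
  have Fm[measurable]: "(\<lambda>w. F (fld z w)) \<in> borel_measurable \<mu>" by measurable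
  then show el: "(\<lambda>w. F (fld z w)) \<in> elems (Linf t)"
    using bd by (auto simp: Linf_def)
  fix B assume "cstar_subalgebra (Linf t) B \<and>
     {(\<lambda>w. inverse (l - 2 * \<i> * complex_of_real (sigma_fun t z w))) | l z. Re l \<noteq> 0 \<and> z \<in> H_half t} \<subseteq> B"
  then have B: "cstar_subalgebra (Linf t) B"
    and gens: "\<And>l. Re l \<noteq> 0 \<Longrightarrow> (\<lambda>w. inverse (l - 2 * \<i> * complex_of_real (sigma_fun t z w))) \<in> B"
    using z by auto
  have B_add: "(\<lambda>w. f w + g w) \<in> B" and B_mult: "(\<lambda>w. f w * g w) \<in> B" if "f \<in> B" "g \<in> B" for f g
    using B that by (auto simp: cstar_subalgebra_def Linf_def)
  have scale: "(\<lambda>w. d * f w) \<in> B" if "f \<in> B" for f d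
    using B that by (auto simp: cstar_subalgebra_def Linf_def)
  have star: "(\<lambda>w. cnj (f w)) \<in> B" if "f \<in> B" for f
    using B that by (auto simp: cstar_subalgebra_def Linf_def)
  have sub: "f \<in> borel_measurable \<mu>" if "f \<in> B" for f
    using B that by (auto simp: cstar_subalgebra_def Linf_def)
  have closed: "f \<in> B" if "f \<in> elems (Linf t)" "\<And>e. e > 0 \<Longrightarrow> \<exists>b\<in>B. norm_op (Linf t) (\<lambda>w. f w + (-1) * b w) < e" for f
  proof -
    have "\<forall>a\<in>elems (Linf t). (\<forall>e>0. \<exists>b\<in>B. norm_op (Linf t) (plus_op (Linf t) a (scale_op (Linf t) (-1) b)) < e) \<longrightarrow> a \<in> B"
      using B unfolding cstar_subalgebra_def by (elim conjE)
    moreover have "plus_op (Linf t) f (scale_op (Linf t) (-1) b) = (\<lambda>w. f w + (-1) * b w)" for b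
      by (simp add: Linf_def)
    ultimately show ?thesis using that by simp
  qed
  \<comment> \<open>The generator with parameter 1, since \<open>fld\<close> is twice
    \<sigma>.\<close>
  define c where "c y = inverse (1 - \<i> * complex_of_real y)" for y
  have c: "(\<lambda>w. c (fld z w)) \<in> B"
    using gens[of 1] by (simp add: c_def fld_def[OF z] mult_ac)
  have czero: "(\<lambda>w. 0) \<in> B" using scale[OF c, of 0] by simp
  have poly: "(\<lambda>w. complex_of_real (p (c (fld z w)) - p 0)) \<in> B" if "real_polynomial_function p" for p :: "complex \<Rightarrow> real"
    using that
  proof induction
    case (linear f)
    have f: "f \<zeta> = Re \<zeta> * f 1 + Im \<zeta> * f \<i>" for \<zeta>
    proof -
      have "f \<zeta> = f (Re \<zeta> *\<^sub>R 1 + Im \<zeta> *\<^sub>R \<i>)" by (rule arg_cong[where f=f]) (simp add: complex_eq_iff)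
      also have "\<dots> = Re \<zeta> * f 1 + Im \<zeta> * f \<i>"
        using linear by (simp add: bounded_linear.linear linear_add linear_cmul)
      finally show ?thesis .
    qed
    have "(\<lambda>w. (of_real (f 1) / 2) * (c (fld z w) + cnj (c (fld z w))) +
        (- \<i> * of_real (f \<i>) / 2) * (c (fld z w) + (-1) * cnj (c (fld z w)))) \<in> B"
      by (intro B_add scale star c)
    moreover have "(of_real (f 1) / 2) * (\<zeta> + cnj \<zeta>) + (- \<i> * of_real (f \<i>) / 2) * (\<zeta> + (-1) * cnj \<zeta>) = complex_of_real (f \<zeta> - f 0)" for \<zeta>
      unfolding f[of \<zeta>] f[of 0] by (simp add: complex_eq_iff field_simps)
    ultimately show ?case by simp
  next
    case (const c) show ?case using czero by simp
  next
    case (add f g)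
    then show ?case using B_add[OF add.IH] by (simp add: algebra_simps)
  next
    \<comment> \<open>The generated algebra need not contain constants, so values at 0 are
      subtracted; the product minus its value at 0 is the product of the differences plus a
      combination of them.\<close>
    case (mult f g)
    let ?f = "\<lambda>w. complex_of_real (f (c (fld z w)) - f 0)" and ?g = "\<lambda>w. complex_of_real (g (c (fld z w)) - g 0)"
    have "(\<lambda>w. ?f w * ?g w + (of_real (f 0) * ?g w + of_real (g 0) * ?f w)) \<in> B"
      by (intro B_add scale B_mult[OF mult.IH] mult.IH)
    then show ?case by (simp add: algebra_simps)
  qed
  \<comment> \<open>The full circle with the origin included, which makes it compact.\<close>
  define S where "S = {\<zeta> :: complex. (cmod \<zeta>)\<^sup>2 = Re \<zeta>}"
  have "closed S" unfolding S_def by (intro closed_Collect_eq continuous_intros)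
  moreover have "bounded S"
  proof (rule boundedI)
    fix \<zeta> assume "\<zeta> \<in> S"
    then have "cmod \<zeta> * cmod \<zeta> \<le> 1 * cmod \<zeta>" using complex_Re_le_cmod[of \<zeta>] by (simp add: S_def power2_eq_square)
    then show "cmod \<zeta> \<le> 1" by (cases "\<zeta> = 0") (auto simp: mult_le_cancel_right)
  qed
  ultimately have compact: "compact S" by (simp add: compact_eq_bounded_closed)
  have nz: "1 - \<i> * complex_of_real y \<noteq> 0" for y by (simp add: complex_eq_iff)
  have cS: "c y \<in> S" for y
  proof -
    have "(cmod (c y))\<^sup>2 = inverse ((cmod (1 - \<i> * complex_of_real y))\<^sup>2)"
      by (simp only: c_def norm_inverse power_inverse)
    also have "\<dots> = inverse (1 + y\<^sup>2)" by (simp only: cmod_power2) simp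
    also have "\<dots> = Re (c y)" by (simp only: c_def inverse_complex.sel) (simp add: inverse_eq_divide)
    finally show ?thesis by (simp add: S_def)
  qed
  \<comment> \<open>The reciprocal of \<open>c y\<close> is \<open>1 - \<i> * y\<close>, so
    \<open>y\<close> is recovered as minus its imaginary part. The value 0 at the origin is the
    continuous one because \<open>F\<close> vanishes at infinity.\<close>
  define \<Phi> where "\<Phi> \<zeta> = (if \<zeta> = 0 then 0 else F (- Im (inverse \<zeta>)))" for \<zeta> :: complex
  have \<Phi>c: "\<Phi> (c y) = F y" for y using nz[of y] by (simp add: \<Phi>_def c_def)
  have cont: "continuous_on S \<Phi>"
    unfolding continuous_on_eq_continuous_within
  proof
    fix \<zeta> assume \<zeta>: "\<zeta> \<in> S"
    show "continuous (at \<zeta> within S) \<Phi>"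
    proof (cases "\<zeta> = 0")
      case False
      have "continuous_on (- {0}) (\<lambda>\<zeta>::complex. - Im (inverse \<zeta>))"
        by (rule continuous_on_minus[OF continuous_on_Im[OF continuous_on_inverse[OF continuous_on_id]]]) simp
      from continuous_on_compose2[OF F this]
      have "continuous_on (- {0}) (\<lambda>\<zeta>. F (- Im (inverse \<zeta>)))" by simp
      then have "continuous_on (- {0}) \<Phi>" by (rule continuous_on_eq) (simp add: \<Phi>_def)
      then have "isCont \<Phi> \<zeta>" using False by (simp add: continuous_on_eq_continuous_at open_Compl)
      then show ?thesis by (rule continuous_at_imp_continuous_at_within)
    next
      case True
      show ?thesis unfolding continuous_within_eps_delta
      proof (intro allI impI)
        fix e :: real assume e: "e > 0"
        obtain R where R: "R \<ge> 0" "\<And>y. \<bar>y\<bar> > R \<Longrightarrow> cmod (F y) < e" using van[OF e] by blast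
        show "\<exists>d>0. \<forall>x'\<in>S. dist x' \<zeta> < d \<longrightarrow> dist (\<Phi> x') (\<Phi> \<zeta>) < e"
        proof (intro exI[of _ "1 / (R + 1)"] conjI ballI impI)
          fix \<xi> assume \<xi>: "\<xi> \<in> S" "dist \<xi> \<zeta> < 1 / (R + 1)"
          show "dist (\<Phi> \<xi>) (\<Phi> \<zeta>) < e"
          proof (cases "\<xi> = 0")
            case True then show ?thesis using \<open>\<zeta> = 0\<close> e by simp
          next
            case False
            \<comment> \<open>On the circle the reciprocal has real part 1, so a small nonzero point
              can only have a reciprocal of large imaginary part.\<close>
            have "Re (inverse \<xi>) = Re \<xi> / (cmod \<xi>)\<^sup>2" by (simp add: cmod_power2)
            also have "\<dots> = 1" using \<xi>(1) False by (simp add: S_def flip: \<xi>(1)[unfolded S_def mem_Collect_eq])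
            finally have re: "Re (inverse \<xi>) = 1" .
            have "cmod \<xi> < inverse (R + 1)" using \<xi>(2) True by (simp add: inverse_eq_divide)
            from less_imp_inverse_less[OF this] have "R + 1 < cmod (inverse \<xi>)"
              unfolding norm_inverse using False R(1) by simp
            also have "\<dots> \<le> \<bar>Re (inverse \<xi>)\<bar> + \<bar>Im (inverse \<xi>)\<bar>" by (rule cmod_le)
            finally have "R < \<bar>- Im (inverse \<xi>)\<bar>" unfolding re by simp
            from R(2)[OF this] show ?thesis using True False by (simp add: \<Phi>_def)
          qed
        qed (use R in simp)
      qed
    qed
  qed
  show "(\<lambda>w. F (fld z w)) \<in> B"
  proof (rule closed[OF el])
    fix e :: real assume e: "e > 0"
    \<comment> \<open>Subtracting \<open>g 0\<close> costs a second error of \<open>e / 4\<close>,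
      as \<open>g\<close> approximates the value 0 at the origin; the total \<open>e / 2\<close> is
      strictly below \<open>e\<close>.\<close>
    obtain g where g: "polynomial_function g" "\<forall>\<zeta>\<in>S. norm (\<Phi> \<zeta> - g \<zeta>) < e / 4"
      using Stone_Weierstrass_polynomial_function[OF compact cont, of "e / 4"] e by auto
    have gr: "real_polynomial_function (Re \<circ> g)" "real_polynomial_function (Im \<circ> g)"
      using g(1) bounded_linear_Re bounded_linear_Im unfolding polynomial_function_def by blast+
    define b where "b w = complex_of_real ((Re \<circ> g) (c (fld z w)) - (Re \<circ> g) 0) + \<i> * complex_of_real ((Im \<circ> g) (c (fld z w)) - (Im \<circ> g) 0)" for w
    have b: "b \<in> B" unfolding b_def[abs_def] by (intro B_add scale poly gr)
    have b': "b w = g (c (fld z w)) - g 0" for w by (simp add: b_def complex_eq_iff)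
    have "norm_op (Linf t) (\<lambda>w. F (fld z w) + (-1) * b w) \<le> e / 2"
    proof (rule Linf_norm_le)
      have [measurable]: "b \<in> borel_measurable \<mu>" by (rule sub[OF b])
      show "(\<lambda>w. F (fld z w) + (-1) * b w) \<in> borel_measurable \<mu>" by measurable
      fix w
      have "0 \<in> S" by (simp add: S_def)
      have "F (fld z w) + (-1) * b w = (\<Phi> (c (fld z w)) - g (c (fld z w))) - (\<Phi> 0 - g 0)"
        unfolding b' \<Phi>c by (simp add: \<Phi>_def)
      also have "cmod \<dots> \<le> e / 4 + e / 4"
        using g(2) cS \<open>0 \<in> S\<close> by (intro order_trans[OF norm_triangle_ineq4 add_mono]) (auto intro: less_imp_le)
      finally show "cmod (F (fld z w) + (-1) * b w) \<le> e / 2" by simp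
    qed (use e in simp)
    then have "norm_op (Linf t) (\<lambda>w. F (fld z w) + (-1) * b w) < e" using e by simp
    then show "\<exists>b\<in>B. norm_op (Linf t) (\<lambda>w. F (fld z w) + (-1) * b w) < e" using b by (rule bexI)
  qed
qed

text \<open>Replacing \<open>z\<close> by its negative reverses the group, which changes the signs
  of both coefficients of the equation. In this way both half planes for \<open>l\<close> lead to an
  equation with \<open>Re k > 0\<close>.\<close>

lemma weyl_phi_iff_gen:
  assumes z: "z \<in> H_half t" and g: "g \<in> Fock t" and h: "h \<in> Fock t" and \<sigma>: "\<sigma> = 1 \<or> \<sigma> = -1"
  shows "weyl_phi t z g (\<lambda>w. h w + \<i> * l * g w) \<longleftrightarrow>
    gen (\<lambda>n. complex_of_real \<sigma> * z n) g (\<lambda>w. (- of_real \<sigma> * l) * g w - (- of_real \<sigma> * \<i>) * h w)"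
proof -
  let ?z = "\<lambda>n. complex_of_real \<sigma> * z n"
  have zz: "?z \<in> H_half t" by (rule H_half_scale[OF z])
  have \<sigma>2: "complex_of_real \<sigma> * complex_of_real \<sigma> = 1" using \<sigma> by auto
  let ?H = "\<lambda>w. h w + \<i> * l * g w"
  let ?G = "\<lambda>w. (- of_real \<sigma> * l) * g w - (- of_real \<sigma> * \<i>) * h w"
  define f where "f s = N (\<lambda>w. (weyl t (\<lambda>n. complex_of_real s * z n) g w - g w) / complex_of_real s - \<i> * ?H w)" for s
  define k where "k s = N (\<lambda>w. (weyl_group ?z s g w - g w) / complex_of_real s - ?G w)" for s
  have HF: "?H \<in> Fock t" by (intro Fock_add Fock_scale g h)
  have GF: "?G \<in> Fock t" by (intro Fock_diff Fock_scale g h)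
  have fk: "f s = k (\<sigma> * s)" for s
  proof -
    note sz = H_half_scale[OF z, of "complex_of_real s"]
    have eq: "(\<lambda>n. complex_of_real s * z n) = (\<lambda>n. complex_of_real (\<sigma> * s) * ?z n)"
    proof
      fix n
      have "complex_of_real (\<sigma> * s) * ?z n = (complex_of_real \<sigma> * complex_of_real \<sigma>) * (complex_of_real s * z n)"
        by (simp only: of_real_mult mult_ac)
      then show "complex_of_real s * z n = complex_of_real (\<sigma> * s) * ?z n" by (simp only: \<sigma>2 mult_1_left)
    qed
    have ae: "AE w in \<mu>. weyl t (\<lambda>n. complex_of_real s * z n) g w = weyl_group ?z (\<sigma> * s) g w"
      using weyl_AE(2)[OF sz g] unfolding weyl_group_def eq .
    let ?K = "\<lambda>w. (weyl_group ?z (\<sigma> * s) g w - g w) / complex_of_real (\<sigma> * s) - ?G w"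
    have VF: "weyl_group ?z (\<sigma> * s) g \<in> Fock t" by (rule V_Fock[OF zz g])
    have KF: "?K \<in> Fock t"
      using Fock_diff[OF Fock_scale[OF Fock_diff[OF VF g], of "1 / complex_of_real (\<sigma> * s)"] GF] by simp
    have WF: "(\<lambda>w. (weyl t (\<lambda>n. complex_of_real s * z n) g w - g w) / complex_of_real s - \<i> * ?H w) \<in> Fock t"
      using Fock_diff[OF Fock_scale[OF Fock_diff[OF weyl_AE(1)[OF sz g] g], of "1 / complex_of_real s"] Fock_scale[OF HF, of \<i>]]
      by simp
    have "f s = N (\<lambda>w. complex_of_real \<sigma> * ?K w)"
      unfolding f_def
    proof (rule N_cong_AE[OF L2_measurable[OF Fock_L2[OF WF]] L2_measurable[OF Fock_L2[OF Fock_scale[OF KF]]]])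
      show "AE w in \<mu>. (weyl t (\<lambda>n. complex_of_real s * z n) g w - g w) / complex_of_real s - \<i> * ?H w = complex_of_real \<sigma> * ?K w"
        using ae
      proof eventually_elim
        case (elim w)
        show ?case unfolding elim using \<sigma> by (auto simp: algebra_simps diff_divide_distrib)
      qed
    qed
    also have "\<dots> = cmod (complex_of_real \<sigma>) * N ?K" by (rule N_scale)
    also have "\<dots> = k (\<sigma> * s)" using \<sigma> by (auto simp: k_def)
    finally show ?thesis .
  qed
  have fl: "filterlim (\<lambda>s. \<sigma> * s) (at 0) (at (0::real))"
  proof (rule filterlim_atI)
    show "((\<lambda>s. \<sigma> * s) \<longlongrightarrow> 0) (at 0)" by (rule tendsto_mult_right_zero[OF tendsto_ident_at])
    show "\<forall>\<^sub>F s in at 0. \<sigma> * s \<noteq> 0" using \<sigma> by (auto simp: eventually_at_filter)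
  qed
  have kf: "k s = f (\<sigma> * s)" for s
  proof -
    have e: "\<sigma> * (\<sigma> * s) = s" using \<sigma> by auto
    show ?thesis unfolding fk e ..
  qed
  have "(f \<longlongrightarrow> 0) (at 0) \<longleftrightarrow> (k \<longlongrightarrow> 0) (at 0)"
  proof
    assume "(f \<longlongrightarrow> 0) (at 0)"
    from filterlim_compose[OF this fl] show "(k \<longlongrightarrow> 0) (at 0)" by (simp add: kf[abs_def])
  next
    assume "(k \<longlongrightarrow> 0) (at 0)"
    from filterlim_compose[OF this fl] show "(f \<longlongrightarrow> 0) (at 0)" by (simp add: fk[abs_def])
  qed
  then show ?thesis unfolding weyl_phi_def gen_def[OF zz] f_def k_def using g HF by simp
qed

lemma resolvent_in_toeplitz_algebra:
  assumes z: "z \<in> H_half t" and l: "Re l \<noteq> 0"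
  shows "resolvent t l z \<in> bounded_operators t"
    "e > 0 \<Longrightarrow> \<exists>\<phi>\<in>classical_resolvent_algebra t. \<forall>h\<in>Fock t. N (\<lambda>w. resolvent t l z h w - toeplitz t \<phi> h w) \<le> e * N h"
proof -
  \<comment> \<open>With this sign \<open>Re k\<close> is the absolute value of \<open>Re l\<close>;
    the unimodular factor \<open>d\<close> is moved from the right-hand side of the equation into
    the symbol.\<close>
  define \<sigma> :: real where "\<sigma> = (if Re l > 0 then -1 else 1)"
  have \<sigma>: "\<sigma> = 1 \<or> \<sigma> = -1" by (simp add: \<sigma>_def)
  define k where "k = - of_real \<sigma> * l"
  define d where "d = - of_real \<sigma> * \<i>"
  have k: "Re k > 0" using l by (auto simp: k_def \<sigma>_def)
  have d: "cmod d = 1" by (simp add: d_def norm_mult \<sigma>_def)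
  define u where "u = (\<lambda>n. complex_of_real \<sigma> * z n)"
  have u: "u \<in> H_half t" unfolding u_def by (rule H_half_scale[OF z])
  have res: "resolvent t l z h \<in> Fock t \<and> gen u (resolvent t l z h) (\<lambda>w. k * resolvent t l z h w - d * h w)"
    if h: "h \<in> Fock t" for h
  proof -
    obtain g where g: "g \<in> Fock t" "gen u g (\<lambda>w. k * g w - d * h w)"
      using gen_exists[OF u Fock_scale[OF h] k] by blast
    then have "weyl_phi t z g (\<lambda>w. h w + \<i> * l * g w)"
      using weyl_phi_iff_gen[OF z g(1) h \<sigma>] by (simp add: k_def d_def u_def)
    \<comment> \<open>The existence just shown makes the choice in \<open>resolvent\<close> satisfy
      its defining equation.\<close>
    then have W: "weyl_phi t z (resolvent t l z h) (\<lambda>w. h w + \<i> * l * resolvent t l z h w)"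
      unfolding resolvent_def by (rule someI[where P="\<lambda>g. weyl_phi t z g (\<lambda>w. h w + \<i> * l * g w)"])
    then have F: "resolvent t l z h \<in> Fock t" by (simp add: weyl_phi_def)
    with W show ?thesis using weyl_phi_iff_gen[OF z F h \<sigma>, of l] by (simp add: k_def d_def u_def)
  qed
  define \<phi> where "\<phi> L w = d * Lap u k L (fld u w)" for L w
  have \<phi>R: "\<phi> L \<in> classical_resolvent_algebra t" if L: "L \<ge> 0" for L
  proof -
    obtain M where M: "\<forall>y. cmod (Lap u k L y) \<le> M" using Lap_bounded[OF u] by blast
    have "(\<lambda>w. (\<lambda>y. d * Lap u k L y) (fld u w)) \<in> classical_resolvent_algebra t"
    proof (rule vanishing_function_in_classical_algebra[OF u])
      show "continuous_on UNIV (\<lambda>y. d * Lap u k L y)" by (intro continuous_intros Lap_continuous[OF u])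
      show "cmod (d * Lap u k L y) \<le> M" for y using M by (simp add: norm_mult d)
      show "\<exists>R\<ge>0. \<forall>y. \<bar>y\<bar> > R \<longrightarrow> cmod (d * Lap u k L y) < e" if "e > 0" for e
        using Lap_vanishes[OF u L that] by (simp add: norm_mult d)
    qed
    then show ?thesis by (simp add: \<phi>_def[abs_def])
  qed
  have approx: "N (\<lambda>w. resolvent t l z h w - toeplitz t (\<phi> L) h w) \<le> exp (- Re k * L) / Re k * N h"
    and bop: "toeplitz t (\<phi> L) \<in> bounded_operators t" if h: "h \<in> Fock t" and L: "L \<ge> 0" for h L
  proof -
    obtain M where M: "M \<ge> 0" "\<phi> L \<in> borel_measurable \<mu>" "\<forall>w. cmod (\<phi> L w) \<le> M"
      using Lap_toeplitz[OF u, of d k L] unfolding \<phi>_def[abs_def] by blast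
    have M': "AE w in \<mu>. cmod (\<phi> L w) \<le> M" using M(3) by simp
    show "toeplitz t (\<phi> L) \<in> bounded_operators t" by (rule toeplitz_bounded_operator[OF M(2) M' M(1)])
    note T = toeplitz_props[OF M(2) M' M(1) Fock_L2[OF h]]
    have dh: "(\<lambda>w. d * h w) \<in> Fock t" by (rule Fock_scale[OF h])
    have ae: "AE w in \<mu>. TL u k L (\<lambda>w. d * h w) w = toeplitz t (\<phi> L) h w"
    proof (rule Fock_eq_AE'[OF TL_props(1)[OF u dh] T(1)])
      fix q assume q: "q \<in> Fock t"
      have "(\<lambda>w. \<phi> L w * h w) = (\<lambda>w. Lap u k L (fld u w) * (d * h w))" by (simp add: \<phi>_def mult_ac)
      then show "ip (TL u k L (\<lambda>w. d * h w)) q = ip (toeplitz t (\<phi> L) h) q"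
        by (simp only: TL_props(2)[OF u dh q] T(2)[OF q] Lap_integral[OF u dh q])
    qed
    have "N (\<lambda>w. resolvent t l z h w - toeplitz t (\<phi> L) h w) = N (\<lambda>w. resolvent t l z h w - TL u k L (\<lambda>w. d * h w) w)"
    proof (rule N_cong_AE)
      show "AE w in \<mu>. resolvent t l z h w - toeplitz t (\<phi> L) h w = resolvent t l z h w - TL u k L (\<lambda>w. d * h w) w"
        using ae by eventually_elim simp
    qed (intro measurable_diff_L2 Fock_L2 T(1) TL_props(1)[OF u dh] conjunct1[OF res[OF h]])+
    also have "\<dots> \<le> exp (- Re k * L) * (N (\<lambda>w. d * h w) / Re k)"
      by (rule resolvent_approx[OF u conjunct1[OF res[OF h]] dh k conjunct2[OF res[OF h]] L])
    finally show "N (\<lambda>w. resolvent t l z h w - toeplitz t (\<phi> L) h w) \<le> exp (- Re k * L) / Re k * N h"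
      by (simp add: N_scale d)
  qed
  have ex: "\<exists>L\<ge>0. exp (- Re k * L) / Re k \<le> e" if e: "e > 0" for e
  proof -
    have "e * Re k > 0" using e k by simp
    from order_tendstoD(2)[OF exp_decay_limit[OF k] this] obtain n where "exp (- Re k * real n) < e * Re k"
      by (auto simp: eventually_sequentially)
    then show ?thesis using k by (intro exI[of _ "real n"]) (simp add: field_simps)
  qed
  have ap: "\<exists>L\<ge>0. \<forall>h\<in>Fock t. N (\<lambda>w. resolvent t l z h w - toeplitz t (\<phi> L) h w) \<le> e * N h" if e: "e > 0" for e
  proof -
    obtain L where L: "L \<ge> 0" "exp (- Re k * L) / Re k \<le> e" using ex[OF e] by blast
    have "N (\<lambda>w. resolvent t l z h w - toeplitz t (\<phi> L) h w) \<le> e * N h" if h: "h \<in> Fock t" for h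
      using order_trans[OF approx[OF h L(1)] mult_right_mono[OF L(2) N_nonneg]] .
    then show ?thesis using L(1) by blast
  qed
  show "resolvent t l z \<in> bounded_operators t"
  proof (rule bounded_operators_limit)
    show "resolvent t l z f \<in> Fock t" if "f \<in> Fock t" for f using res[OF that] by simp
    show "\<exists>B\<in>bounded_operators t. \<forall>f\<in>Fock t. N (\<lambda>w. resolvent t l z f w - B f w) \<le> e * N f" if "e > 0" for e
    proof -
      obtain L where L: "L \<ge> 0" "\<forall>h\<in>Fock t. N (\<lambda>w. resolvent t l z h w - toeplitz t (\<phi> L) h w) \<le> e * N h"
        using ap[OF \<open>e > 0\<close>] by blast
      from L(2) bop[OF Fock_zero L(1)] show ?thesis by (rule bexI)
    qed
  qed
  assume "e > 0"
  then obtain L where L: "L \<ge> 0" "\<forall>h\<in>Fock t. N (\<lambda>w. resolvent t l z h w - toeplitz t (\<phi> L) h w) \<le> e * N h"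
    using ap by blast
  from L(2) \<phi>R[OF L(1)] show "\<exists>\<phi>\<in>classical_resolvent_algebra t. \<forall>h\<in>Fock t. N (\<lambda>w. resolvent t l z h w - toeplitz t \<phi> h w) \<le> e * N h"
    by (rule bexI)
qed

text \<open>A bound relative to \<open>N h\<close> controls the supremum over the unit ball; halving
  \<open>e\<close> gives the strict inequality required by \<open>cstar_subalgebra\<close>.\<close>

lemma Fock_operators_closed:
  assumes B: "cstar_subalgebra (Fock_operators t) B" and A: "A \<in> bounded_operators t"
    and approx: "\<And>e. e > 0 \<Longrightarrow> \<exists>T\<in>B. \<forall>h\<in>Fock t. N (\<lambda>w. A h w - T h w) \<le> e * N h"
  shows "A \<in> B"
proof -
  have "\<exists>T\<in>B. norm_op (Fock_operators t) (plus_op (Fock_operators t) A (scale_op (Fock_operators t) (-1) T)) < e" if e: "e > 0" for e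
  proof -
    have "e / 2 > 0" using e by simp
    then obtain T where T: "T \<in> B" "\<forall>h\<in>Fock t. N (\<lambda>w. A h w - T h w) \<le> e / 2 * N h" using approx by blast
    have "norm_op (Fock_operators t) (plus_op (Fock_operators t) A (scale_op (Fock_operators t) (-1) T)) =
        (SUP f\<in>{f \<in> Fock t. N f \<le> 1}. N (\<lambda>w. A f w - T f w))"
      by (simp add: Fock_operators_def)
    also have "\<dots> \<le> e / 2"
    proof (rule cSUP_least)
      show "{f \<in> Fock t. N f \<le> 1} \<noteq> {}" using Fock_zero by (auto simp: L2_norm_def intro!: exI[of _ "\<lambda>w. 0"])
      fix f assume f: "f \<in> {f \<in> Fock t. N f \<le> 1}"
      then have "N (\<lambda>w. A f w - T f w) \<le> e / 2 * N f" using T(2) by simp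
      also have "\<dots> \<le> e / 2 * 1" using f e by (intro mult_left_mono) auto
      finally show "N (\<lambda>w. A f w - T f w) \<le> e / 2" by simp
    qed
    finally have "norm_op (Fock_operators t) (plus_op (Fock_operators t) A (scale_op (Fock_operators t) (-1) T)) < e"
      using e by simp
    then show ?thesis using T(1) by (rule bexI)
  qed
  moreover have "A \<in> elems (Fock_operators t)" using A by (simp add: Fock_operators_def)
  ultimately show ?thesis using B unfolding cstar_subalgebra_def by blast
qed

text \<open>Every closed subalgebra containing the Toeplitz operators contains the resolvents, being
  norm limits of such operators, and therefore everything they generate.\<close>

lemma resolvent_algebra_subset: "resolvent_algebra t \<subseteq> toeplitz_algebra t (classical_resolvent_algebra t)"
proof
  fix A assume A: "A \<in> resolvent_algebra t"
  show "A \<in> toeplitz_algebra t (classical_resolvent_algebra t)"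
    unfolding toeplitz_algebra_def cstar_generated_def
  proof (intro CollectI conjI allI impI)
    show "A \<in> elems (Fock_operators t)" using A by (simp add: resolvent_algebra_def cstar_generated_def)
    fix B assume B: "cstar_subalgebra (Fock_operators t) B \<and> toeplitz t ` classical_resolvent_algebra t \<subseteq> B"
    have "resolvent t l z \<in> B" if l: "Re l \<noteq> 0" and z: "z \<in> H_half t" for l z
    proof (rule Fock_operators_closed[OF conjunct1[OF B] resolvent_in_toeplitz_algebra(1)[OF z l]])
      fix e :: real assume "e > 0"
      from resolvent_in_toeplitz_algebra(2)[OF z l this] obtain \<phi> where
        \<phi>: "\<phi> \<in> classical_resolvent_algebra t" "\<forall>h\<in>Fock t. N (\<lambda>w. resolvent t l z h w - toeplitz t \<phi> h w) \<le> e * N h"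
        by blast
      have "toeplitz t \<phi> \<in> B" using B \<phi>(1) by blast
      with \<phi>(2) show "\<exists>T\<in>B. \<forall>h\<in>Fock t. N (\<lambda>w. resolvent t l z h w - T h w) \<le> e * N h" by (rule bexI)
    qed
    then have "{resolvent t l z | l z. Re l \<noteq> 0 \<and> z \<in> H_half t} \<subseteq> B" by auto
    moreover have "\<forall>B. cstar_subalgebra (Fock_operators t) B \<and>
        {resolvent t l z | l z. Re l \<noteq> 0 \<and> z \<in> H_half t} \<subseteq> B \<longrightarrow> A \<in> B"
      using A unfolding resolvent_algebra_def cstar_generated_def by (elim CollectE conjE)
    ultimately show "A \<in> B" using B by (elim allE[of _ B]) simp
  qed
qed

end

theorem theorem5p4:
  fixes t :: "nat \<Rightarrow> real"
  assumes "\<And>k. t k > 0" and "summable t"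
  shows "resolvent_algebra t \<subseteq> toeplitz_algebra t (classical_resolvent_algebra t)"
proof -
  interpret gauss t by standard (use assms in auto)
  show ?thesis by (rule resolvent_algebra_subset)
qed

end
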